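(* There is a universal constant $C\geq 1$ such that the following holds. Let $r>0$ and let $\mu$ be a symmetric probability measure on $\mathbb{R}^{d}$ supported on $\{x\in\mathbb{R}^{d}:\|x\|_{2}\leq r\}$, and let $\Sigma=\int_{\mathbb{R}^{d}}xx^{T}\,d\mu(x)$. Let $n\geq 2$ be an integer and let $X_{1},\ldots,X_{n}$ be i.i.d. random vectors with distribution $\mu$. Then \[\mathbb{E}\left[W_{2,1}\Big(\mu,\frac{1}{2n}\sum_{i=1}^{n}(\delta_{X_{i}}+\delta_{-X_{i}})\Big)^{2}\right]\leq C\|\Sigma\|_{\mathrm{op}}\left(\frac{r^{2}\ln n}{n\|\Sigma\|_{\mathrm{op}}}+\sqrt{\frac{r^{2}\ln n}{n\|\Sigma\|_{\mathrm{op}}}}\right).\]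
   Context: A probability measure $\mu$ on $\mathbb{R}^{d}$ is symmetric if $\mu(A)=\mu(-A)$ for all measurable $A$. $\|\cdot\|_{\mathrm{op}}$ is the operator norm. For probability measures $\nu_{1},\nu_{2}$ on $\mathbb{R}$, $W_{2}(\nu_{1},\nu_{2})=\inf_{\gamma}\left(\int|x-y|^{2}\,d\gamma(x,y)\right)^{1/2}$ over couplings $\gamma$. For probability measures $\mu_{1},\mu_{2}$ on $\mathbb{R}^{d}$, $W_{2,1}(\mu_{1},\mu_{2})=\sup_{v\in\mathbb{R}^{d},\|v\|_{2}=1}W_{2}(v_{\#}\mu_{1},v_{\#}\mu_{2})$, where $v_{\#}\mu_{i}$ is the pushforward of $\mu_{i}$ under $x\mapsto\langle x,v\rangle$. $\delta_{x}$ is the Dirac mass at $x$. *)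

theory Defs
  imports "HOL-Probability.Probability"
begin

text \<open>Euclidean space R^d with d varying is modelled by the explicit carrier
  PiM {..<d} (\<lambda>_. borel): functions nat => real, extensional on {..<d}.\<close>

definition Rd :: "nat \<Rightarrow> (nat \<Rightarrow> real) measure" where
  "Rd d = PiM {..<d} (\<lambda>_. borel)"

definition ip :: "nat \<Rightarrow> (nat \<Rightarrow> real) \<Rightarrow> (nat \<Rightarrow> real) \<Rightarrow> real" where
  "ip d x y = (\<Sum>i<d. x i * y i)"

definition enorm2 :: "nat \<Rightarrow> (nat \<Rightarrow> real) \<Rightarrow> real" where
  "enorm2 d x = sqrt (ip d x x)"

definition vneg :: "nat \<Rightarrow> (nat \<Rightarrow> real) \<Rightarrow> (nat \<Rightarrow> real)" where
  "vneg d x = restrict (\<lambda>i. - x i) {..<d}"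

definition symmetric_measure :: "nat \<Rightarrow> (nat \<Rightarrow> real) measure \<Rightarrow> bool" where
  "symmetric_measure d \<mu> \<longleftrightarrow> (\<forall>A\<in>sets (Rd d). emeasure \<mu> A = emeasure \<mu> (vneg d ` A))"

definition cov :: "nat \<Rightarrow> (nat \<Rightarrow> real) measure \<Rightarrow> nat \<Rightarrow> nat \<Rightarrow> real" where
  "cov d \<mu> i j = (\<integral>x. x i * x j \<partial>\<mu>)"

definition opnorm :: "nat \<Rightarrow> (nat \<Rightarrow> nat \<Rightarrow> real) \<Rightarrow> real" where
  "opnorm d S = Sup {enorm2 d (\<lambda>i. \<Sum>j<d. S i j * v j) | v. enorm2 d v = 1}"

definition couplings :: "real measure \<Rightarrow> real measure \<Rightarrow> (real \<times> real) measure set" where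
  "couplings \<nu>1 \<nu>2 = {\<gamma>. sets \<gamma> = sets (borel :: (real \<times> real) measure) \<and> prob_space \<gamma>
      \<and> distr \<gamma> borel fst = \<nu>1 \<and> distr \<gamma> borel snd = \<nu>2}"

definition W2 :: "real measure \<Rightarrow> real measure \<Rightarrow> real" where
  "W2 \<nu>1 \<nu>2 = sqrt (enn2real (INF \<gamma>\<in>couplings \<nu>1 \<nu>2. \<integral>\<^sup>+ p. ennreal ((fst p - snd p)\<^sup>2) \<partial>\<gamma>))"

definition proj :: "nat \<Rightarrow> (nat \<Rightarrow> real) \<Rightarrow> (nat \<Rightarrow> real) measure \<Rightarrow> real measure" where
  "proj d v \<mu> = distr \<mu> borel (\<lambda>x. ip d x v)"

definition W21 :: "nat \<Rightarrow> (nat \<Rightarrow> real) measure \<Rightarrow> (nat \<Rightarrow> real) measure \<Rightarrow> real" where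
  "W21 d \<mu>1 \<mu>2 = Sup {W2 (proj d v \<mu>1) (proj d v \<mu>2) | v. enorm2 d v = 1}"

text \<open>Symmetrized empirical measure (1/(2n)) sum_{i<n} (delta_{X i} + delta_{-X i}).\<close>
definition emp :: "nat \<Rightarrow> (nat \<Rightarrow> nat \<Rightarrow> real) \<Rightarrow> nat \<Rightarrow> (nat \<Rightarrow> real) measure" where
  "emp d X n = distr (measure_pmf (pmf_of_set ({..<n} \<times> (UNIV :: bool set)))) (Rd d)
     (\<lambda>(i, b). restrict (\<lambda>j. (if b then 1 else -1) * X i j) {..<d})"

end

(*
For measures on the line, the quantile coupling of the signed squares x|x| gives
W_2(nu1, nu2)^2 <= 2 sup_f (int f(x|x|) dnu1 - int f(x|x|) dnu2) over 1-Lipschitz f with f(0) = 0,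
and symmetry replaces f(x|x|) by an even function f(x^2). After symmetrization one has to bound the
Rademacher process sum_i e_i f(<X_i,v>^2) indexed by unit vectors v and Lipschitz f.

Quantize f at relative precision 2^-l along a geometric grid. The increments of (v, f) |-> f(<x,v>^2)
are then dominated by those of a Hilbert space valued map whose coordinates are multiples of <x,v>^2,
one for each quantized function of each level l, so Maurer's vector contraction inequality reduces
everything to maxima of operator norms of independent copies of sum_i e_i X_i X_i^T. These are
controlled by trace moments (noncommutative Khintchine), which give E <= C sqrt(r^2 S ln n) with
S = sup_v sum_i <X_i,v>^2; the maximum over the quantized functions of level l costs a
factor sqrt(l 2^l), which the weight 2^-l of that level absorbs. The case f(y) = -y yields
E S <= C (n |Sigma| + r^2 ln n).
*)
theory Submission
  imports Defs
begin

section \<open>Rademacher averages and vector contraction\<close>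

text \<open>The bound must be free of \<open>d\<close>, so chaining over the unit sphere is
  excluded: its covering numbers grow with the dimension. Directions are therefore never counted.
  For fixed signs the maximum over all \<open>v\<close> is an operator norm, and the trace moments
  that control it can be arranged to carry the factor \<open>n\<close> in place of \<open>d\<close>.
  Only test functions are counted. Relative precision is the right one for them because an error of
  size \<open>y / 2 ^ l\<close> at the square \<open>y\<close> of a projection is again a multiple
  of a quadratic form in \<open>v\<close>; a geometric grid with about \<open>2 ^ l * k\<close>
  points, where \<open>2 ^ k\<close> exceeds \<open>n\<close>, then suffices, and this
  \<open>k\<close> is the source of the logarithm. Signed squares are preferred to duality for the
  quadratic cost because they yield Lipschitz functions of squared projections. The finite nets make
  every maximum finite and measurable; the size of the net of directions enters no estimate. The
  random quantity S also bounds the fluctuation of S itself, so a weighted arithmetic-geometric mean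
  inequality is used to absorb half of its expectation.\<close>

definition rad :: "'j set \<Rightarrow> (('j \<Rightarrow> real) \<Rightarrow> real) \<Rightarrow> real" where
  "rad J F = (\<Sum>S\<in>Pow J. F (\<lambda>j. if j \<in> S then 1 else -1)) / 2 ^ card J"

definition signs :: "('j \<Rightarrow> real) \<Rightarrow> bool" where
  "signs e \<longleftrightarrow> (\<forall>j. e j = 1 \<or> e j = -1)"

lemma rad_empty: "rad {} F = F (\<lambda>_. -1)"
  by (simp add: rad_def)

lemma rad_insert:
  assumes "finite J" "j \<notin> J"
  shows "rad (insert j J) F = rad J (\<lambda>e. (F (e(j := 1)) + F (e(j := -1))) / 2)"
proof -
  let ?s = "\<lambda>S j. if j \<in> S then 1 else (-1::real)"
  have inj: "inj_on (insert j) (Pow J)"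
    using assms(2) by (auto simp: inj_on_def)
  have dis: "Pow J \<inter> insert j ` Pow J = {}"
    using assms(2) by auto
  have "(\<Sum>S\<in>Pow (insert j J). F (?s S))
      = (\<Sum>S\<in>Pow J. F (?s S)) + (\<Sum>S\<in>Pow J. F (?s (insert j S)))"
    unfolding Pow_insert using assms inj dis
    by (subst sum.union_disjoint) (auto simp: sum.reindex)
  also have "\<dots> = (\<Sum>S\<in>Pow J. F ((?s S)(j := -1)) + F ((?s S)(j := 1)))"
    unfolding sum.distrib using assms(2)
    by (intro arg_cong2[where f="(+)"] sum.cong arg_cong[where f=F]) (auto simp: fun_eq_iff)
  finally show ?thesis
    using assms by (simp add: rad_def sum_divide_distrib[symmetric] field_simps)
qed

lemma sum_upd: "i \<notin> I \<Longrightarrow> (\<Sum>l\<in>I. (e(i := a)) l * f l) = (\<Sum>l\<in>I. e l * f l :: real)"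
  by (intro sum.cong) auto

lemma rad_mono:
  assumes "\<And>e. signs e \<Longrightarrow> F e \<le> G e"
  shows "rad J F \<le> rad J G"
  unfolding rad_def by (intro divide_right_mono sum_mono assms) (auto simp: signs_def)

lemma rad_cong:
  assumes "\<And>e. signs e \<Longrightarrow> F e = G e"
  shows "rad J F = rad J G"
  by (intro antisym rad_mono) (simp_all add: assms)

lemma rad_add: "rad J (\<lambda>e. F e + G e) = rad J F + rad J G"
  by (simp add: rad_def sum.distrib add_divide_distrib)

lemma rad_cmult: "rad J (\<lambda>e. c * F e) = c * rad J F"
  by (simp add: rad_def sum_distrib_left)

lemma rad_sum: "rad J (\<lambda>e. \<Sum>a\<in>A. F a e) = (\<Sum>a\<in>A. rad J (F a))"
  unfolding rad_def sum_divide_distrib[symmetric] by (subst sum.swap) simp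

lemma rad_const: "finite J \<Longrightarrow> rad J (\<lambda>_. c) = c"
  by (simp add: rad_def card_Pow)

lemma rad_swap: "rad J (\<lambda>e. rad K (F e)) = rad K (\<lambda>e'. rad J (\<lambda>e. F e e'))"
  unfolding rad_def sum_divide_distrib by (subst sum.swap) (simp add: mult.commute)

lemma rad_Un:
  assumes "finite K" "finite J" "J \<inter> K = {}"
  shows "rad (J \<union> K) F = rad J (\<lambda>e. rad K (\<lambda>e'. F (\<lambda>j. if j \<in> K then e' j else e j)))"
  using assms
proof (induction K arbitrary: F rule: finite_induct)
  case empty
  then show ?case by (simp add: rad_empty)
next
  case (insert k K)
  have "rad (J \<union> insert k K) F = rad (J \<union> K) (\<lambda>e. (F (e(k := 1)) + F (e(k := -1))) / 2)"
    using insert by (subst rad_insert[symmetric]) auto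
  also have "\<dots> = rad J (\<lambda>e. rad K (\<lambda>e'.
      (F ((\<lambda>j. if j \<in> K then e' j else e j)(k := 1)) + F ((\<lambda>j. if j \<in> K then e' j else e j)(k := -1))) / 2))"
    using insert by simp
  also have "\<dots> = rad J (\<lambda>e. rad (insert k K) (\<lambda>e'. F (\<lambda>j. if j \<in> insert k K then e' j else e j)))"
    using insert.hyps
    by (subst rad_insert) (auto intro!: rad_cong arg_cong2[where f="(+)"] arg_cong[where f=F] simp: fun_eq_iff)
  finally show ?case .
qed

text \<open>\<open>rad\<close> freezes every sign outside \<open>J\<close> at -1, and negation would
  move these frozen values; hence the locality hypothesis on \<open>F\<close>. Inside
  \<open>J\<close>, negation is complementation of the set of positive signs.\<close>

lemma rad_uminus:
  assumes "finite J" and "\<And>e e'. (\<And>j. j \<in> J \<Longrightarrow> e j = e' j) \<Longrightarrow> F e = F e'"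
  shows "rad J (\<lambda>e. F (\<lambda>j. - e j)) = rad J F"
proof -
  have "(\<Sum>S\<in>Pow J. F (\<lambda>j. - (if j \<in> S then 1 else -1)))
      = (\<Sum>S\<in>Pow J. F (\<lambda>j. if j \<in> S then 1 else -1))"
    by (rule sum.reindex_bij_witness[of _ "\<lambda>S. J - S" "\<lambda>S. J - S"]) (auto intro!: assms(2))
  then show ?thesis by (simp add: rad_def)
qed

text \<open>A subfamily of independent signs is a family of independent signs, since the indices
  missed by \<open>g\<close> are averaged out one by one. For a fixed feature
  \<open>\<kappa>\<close> this turns the signs \<open>e (i, \<kappa>)\<close> into an ordinary sign
  sequence.\<close>

lemma rad_reindex:
  assumes "finite J" "inj_on g I" "g ` I \<subseteq> J"
    and "\<And>e e'. (\<And>i. i \<in> I \<Longrightarrow> e i = e' i) \<Longrightarrow> G e = G e'"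
  shows "rad J (\<lambda>e. G (\<lambda>i. e (g i))) = rad I G"
  using assms
proof (induction J arbitrary: I G rule: finite_induct)
  case empty
  then show ?case by (simp add: rad_empty)
next
  case (insert j J)
  show ?case
  proof (cases "j \<in> g ` I")
    case False
    have eq: "G (\<lambda>i. (e(j := a)) (g i)) = G (\<lambda>i. e (g i))" for e a
      using False by (intro insert.prems(3)) auto
    have "rad (insert j J) (\<lambda>e. G (\<lambda>i. e (g i))) = rad J (\<lambda>e. G (\<lambda>i. e (g i)))"
      using insert.hyps unfolding rad_insert[OF insert.hyps] eq by simp
    also have "\<dots> = rad I G"
    proof (rule insert.IH)
      show "inj_on g I" "g ` I \<subseteq> J" using False insert.prems(1,2) by auto
    qed (rule insert.prems(3))
    finally show ?thesis .
  next
    case True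
    then obtain i where i: "i \<in> I" "j = g i" by auto
    define I' where "I' = I - {i}"
    have I: "I = insert i I'" "i \<notin> I'" using i by (auto simp: I'_def)
    have sub: "inj_on g I'" "g ` I' \<subseteq> J"
      using insert.prems(1,2) i by (auto simp: I'_def inj_on_def)
    have finI': "finite I'" using sub insert.hyps(1)
      by (meson finite_imageD finite_subset)
    have eq: "G (\<lambda>i'. (e(j := a)) (g i')) = G ((\<lambda>i'. e (g i'))(i := a))" for e a
    proof (rule insert.prems(3))
      fix i' assume "i' \<in> I"
      then show "(e(j := a)) (g i') = ((\<lambda>i'. e (g i'))(i := a)) i'"
        using i insert.prems(1) by (auto simp: inj_on_def)
    qed
    have "rad (insert j J) (\<lambda>e. G (\<lambda>i. e (g i)))
        = rad J (\<lambda>e. (\<lambda>e. (G (e(i := 1)) + G (e(i := -1))) / 2) (\<lambda>i. e (g i)))"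
      unfolding rad_insert[OF insert.hyps] eq by simp
    also have "\<dots> = rad I' (\<lambda>e. (G (e(i := 1)) + G (e(i := -1))) / 2)"
    proof (rule insert.IH[OF sub])
      fix e e' :: "_ \<Rightarrow> real" assume "\<And>i. i \<in> I' \<Longrightarrow> e i = e' i"
      then have "G (e(i := a)) = G (e'(i := a))" for a
        by (intro insert.prems(3)) (auto simp: I)
      then show "(G (e(i := 1)) + G (e(i := -1))) / 2 = (G (e'(i := 1)) + G (e'(i := -1))) / 2"
        by simp
    qed
    also have "\<dots> = rad I G" unfolding I(1) using finI' I(2) by (simp add: rad_insert)
    finally show ?thesis .
  qed
qed

section \<open>Khintchine inequality for scalar sums\<close>

lemma rad_square:
  assumes "finite K"
  shows "rad K (\<lambda>e. (\<Sum>k\<in>K. e k * x k)\<^sup>2) = (\<Sum>k\<in>K. (x k)\<^sup>2)"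
  using assms
proof (induction K rule: finite_induct)
  case empty
  then show ?case by (simp add: rad_empty)
next
  case (insert k K)
  have *: "((x k + y)\<^sup>2 + (y - x k)\<^sup>2) / 2 = y\<^sup>2 + (x k)\<^sup>2" for y
    by (simp add: power2_eq_square algebra_simps)
  show ?case
    using insert by (simp add: rad_insert sum_upd * rad_add rad_const del: fun_upd_apply add: fun_upd_same)
qed

text \<open>The factor 3 is the fourth moment of the standard Gaussian. The new sign cancels the odd
  powers, and enlarging \<open>x k ^ 4\<close> to \<open>3 * x k ^ 4\<close> completes the
  square.\<close>

lemma rad_fourth_power:
  assumes "finite K"
  shows "rad K (\<lambda>e. (\<Sum>k\<in>K. e k * x k) ^ 4) \<le> 3 * (\<Sum>k\<in>K. (x k)\<^sup>2)\<^sup>2"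
  using assms
proof (induction K rule: finite_induct)
  case empty
  then show ?case by (simp add: rad_empty)
next
  case (insert k K)
  have *: "((x k + y) ^ 4 + (y - x k) ^ 4) / 2 = y ^ 4 + 6 * (x k)\<^sup>2 * y\<^sup>2 + (x k) ^ 4" for y
    by (simp add: power4_eq_xxxx power2_eq_square algebra_simps)
  have "rad (insert k K) (\<lambda>e. (\<Sum>l\<in>insert k K. e l * x l) ^ 4)
     = rad K (\<lambda>e. (\<Sum>l\<in>K. e l * x l) ^ 4) + 6 * (x k)\<^sup>2 * (\<Sum>l\<in>K. (x l)\<^sup>2) + (x k) ^ 4"
    using insert by (simp add: rad_insert sum_upd * rad_add rad_const rad_cmult rad_square del: fun_upd_apply add: fun_upd_same)
  also have "\<dots> \<le> 3 * (\<Sum>k\<in>K. (x k)\<^sup>2)\<^sup>2 + 6 * (x k)\<^sup>2 * (\<Sum>l\<in>K. (x l)\<^sup>2) + 3 * (x k) ^ 4"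
  proof -
    have "0 \<le> x k ^ 4" by simp
    then show ?thesis using insert.IH by linarith
  qed
  also have "\<dots> = 3 * (\<Sum>k\<in>insert k K. (x k)\<^sup>2)\<^sup>2"
    using insert.hyps by (simp add: power4_eq_xxxx power2_eq_square algebra_simps)
  finally show ?case .
qed

text \<open>The second and fourth moments bound the first from below through a polynomial minorant
  of \<open>\<bar>y\<bar>\<close>. After averaging, \<open>1 - 3 * (4/27) = 5/9\<close> remains, and
  9/5 is rounded up to 2.\<close>

lemma khintchine:
  assumes "finite K"
  shows "sqrt (\<Sum>k\<in>K. (x k)\<^sup>2) \<le> 2 * rad K (\<lambda>e. \<bar>\<Sum>k\<in>K. e k * x k\<bar>)"
proof -
  define s where "s = sqrt (\<Sum>k\<in>K. (x k)\<^sup>2)"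
  have s2: "s\<^sup>2 = (\<Sum>k\<in>K. (x k)\<^sup>2)" by (simp add: s_def sum_nonneg)
  have s0: "s \<ge> 0" by (simp add: s_def sum_nonneg)
  show ?thesis
  proof (cases "s = 0")
    case True
    have "rad K (\<lambda>e. \<bar>\<Sum>k\<in>K. e k * x k\<bar>) \<ge> rad K (\<lambda>e. 0)" by (intro rad_mono) auto
    then show ?thesis using True assms by (simp add: s_def[symmetric] rad_const)
  next
    case False
    then have pos: "s > 0" using s0 by simp
    \<comment> \<open>multiply \<open>1 \<ge> u - (4/27) u\<^sup>3\<close>, i.e. \<open>(u + 3) (2 u - 3)\<^sup>2 \<ge> 0\<close>, by \<open>u = |y| / s\<close>\<close>
    have pt: "y\<^sup>2 * s\<^sup>2 - 4/27 * y ^ 4 \<le> s ^ 3 * \<bar>y\<bar>" for y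
    proof -
      define u where "u = \<bar>y\<bar>"
      have u: "u \<ge> 0" by (simp add: u_def)
      have "0 \<le> u * ((u + 3 * s) * (2 * u - 3 * s)\<^sup>2)"
        using u s0 by simp
      also have "\<dots> = 27 * (s ^ 3 * u) - 27 * (u\<^sup>2 * s\<^sup>2) + 4 * u ^ 4"
        by (simp add: power2_eq_square power3_eq_cube power4_eq_xxxx algebra_simps)
      finally show ?thesis by (simp add: u_def power2_eq_square power4_eq_xxxx)
    qed
    have "rad K (\<lambda>e. s\<^sup>2 * (\<Sum>k\<in>K. e k * x k)\<^sup>2 + (- 4/27) * (\<Sum>k\<in>K. e k * x k) ^ 4)
        \<le> rad K (\<lambda>e. s ^ 3 * \<bar>\<Sum>k\<in>K. e k * x k\<bar>)"
    proof (rule rad_mono)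
      fix e
      show "s\<^sup>2 * (\<Sum>k\<in>K. e k * x k)\<^sup>2 + (- 4/27) * (\<Sum>k\<in>K. e k * x k) ^ 4
          \<le> s ^ 3 * \<bar>\<Sum>k\<in>K. e k * x k\<bar>"
        using pt[of "\<Sum>k\<in>K. e k * x k"] by (simp add: mult.commute)
    qed
    then have "s\<^sup>2 * s\<^sup>2 - 4/27 * rad K (\<lambda>e. (\<Sum>k\<in>K. e k * x k) ^ 4)
        \<le> s ^ 3 * rad K (\<lambda>e. \<bar>\<Sum>k\<in>K. e k * x k\<bar>)"
      unfolding rad_add rad_cmult rad_square[OF assms] s2[symmetric] by simp
    moreover have "rad K (\<lambda>e. (\<Sum>k\<in>K. e k * x k) ^ 4) \<le> 3 * (s\<^sup>2)\<^sup>2"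
      using rad_fourth_power[OF assms, of x] s2 by simp
    ultimately have "s\<^sup>2 * s\<^sup>2 * (5/9) \<le> s ^ 3 * rad K (\<lambda>e. \<bar>\<Sum>k\<in>K. e k * x k\<bar>)"
      by (simp add: power2_eq_square)
    then have "s ^ 3 * (s * (5/9)) \<le> s ^ 3 * rad K (\<lambda>e. \<bar>\<Sum>k\<in>K. e k * x k\<bar>)"
      by (simp add: power2_eq_square power3_eq_cube mult.assoc)
    then have "s * (5/9) \<le> rad K (\<lambda>e. \<bar>\<Sum>k\<in>K. e k * x k\<bar>)"
      using pos by (simp add: mult_le_cancel_left)
    then show ?thesis using s0 by (simp add: s_def[symmetric])
  qed
qed

text \<open>One coordinate of the contraction: the two maxima are merged into a maximum over pairs
  \<open>(z, z')\<close>, where only the increments of \<open>h\<close> enter.\<close>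

lemma contraction_step:
  fixes h :: "'z \<Rightarrow> real"
  assumes Z: "finite Z" "Z \<noteq> {}" and K: "finite K"
    and inc: "\<And>z z'. z \<in> Z \<Longrightarrow> z' \<in> Z \<Longrightarrow> \<bar>h z - h z'\<bar> \<le> sqrt (\<Sum>k\<in>K. (\<Psi> k z - \<Psi> k z')\<^sup>2)"
  shows "((MAX z\<in>Z. B z + h z) + (MAX z\<in>Z. B z - h z)) / 2
     \<le> rad K (\<lambda>e. MAX z\<in>Z. B z + 2 * (\<Sum>k\<in>K. e k * \<Psi> k z))"
proof -
  define m where "m e = (MAX z\<in>Z. B z + 2 * (\<Sum>k\<in>K. e k * \<Psi> k z))" for e
  obtain z where z: "z \<in> Z" "(MAX z\<in>Z. B z + h z) = B z + h z"
    using Max_in[of "(\<lambda>z. B z + h z) ` Z"] Z by (metis (no_types, lifting) finite_imageI imageE image_is_empty)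
  obtain z' where z': "z' \<in> Z" "(MAX z\<in>Z. B z - h z) = B z' - h z'"
    using Max_in[of "(\<lambda>z. B z - h z) ` Z"] Z by (metis (no_types, lifting) finite_imageI imageE image_is_empty)
  have le: "B w + 2 * (\<Sum>k\<in>K. e k * \<Psi> k w) \<le> m e" if "w \<in> Z" for w e
    unfolding m_def using Z that by (intro Max_ge) auto
  have neg: "B w - 2 * (\<Sum>k\<in>K. e k * \<Psi> k w) \<le> m (\<lambda>k. - e k)" if "w \<in> Z" for w e
    using le[OF that, of "\<lambda>k. - e k"] by (simp add: sum_negf)
  \<comment> \<open>Testing \<open>m e\<close> at \<open>z\<close> and its value at the negated
    signs at \<open>z'\<close>, or the other way round, produces the increment with either sign,
    hence its absolute value.\<close>
  have pt: "B z + B z' + 2 * \<bar>\<Sum>k\<in>K. e k * (\<Psi> k z - \<Psi> k z')\<bar> \<le> m e + m (\<lambda>k. - e k)" for e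
    using le[OF z(1), of e] le[OF z'(1), of e] neg[OF z(1), of e] neg[OF z'(1), of e]
    by (simp add: right_diff_distrib sum_subtractf abs_if)
  have "(B z + h z) + (B z' - h z') \<le> B z + B z' + \<bar>h z - h z'\<bar>" by simp
  also have "\<dots> \<le> B z + B z' + 2 * rad K (\<lambda>e. \<bar>\<Sum>k\<in>K. e k * (\<Psi> k z - \<Psi> k z')\<bar>)"
    using inc[OF z(1) z'(1)] khintchine[OF K, of "\<lambda>k. \<Psi> k z - \<Psi> k z'"] by linarith
  also have "\<dots> = rad K (\<lambda>e. (B z + B z') + 2 * \<bar>\<Sum>k\<in>K. e k * (\<Psi> k z - \<Psi> k z')\<bar>)"
    using K by (simp add: rad_add rad_const rad_cmult)
  also have "\<dots> \<le> rad K (\<lambda>e. m e + m (\<lambda>k. - e k))"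
    using pt by (intro rad_mono) simp
  also have "\<dots> = 2 * rad K m"
  proof -
    have "rad K (\<lambda>e. m (\<lambda>k. - e k)) = rad K m"
    proof (rule rad_uminus[OF K])
      fix e e' :: "_ \<Rightarrow> real" assume "\<And>k. k \<in> K \<Longrightarrow> e k = e' k"
      then have "(\<Sum>k\<in>K. e k * \<Psi> k z) = (\<Sum>k\<in>K. e' k * \<Psi> k z)" for z
        by (intro sum.cong) auto
      then show "m e = m e'" by (simp add: m_def)
    qed
    then show ?thesis by (simp add: rad_add)
  qed
  finally show ?thesis unfolding z z' m_def by simp
qed

text \<open>Maurer's inequality, proved by trading one scalar sign at a time for a block of signs
  indexed by \<open>T\<close>. The shift \<open>A\<close> is arbitrary because the induction parks
  there whatever belongs to the other indices: the new block is held fixed while the hypothesis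
  treats the rest. The factor 2 comes from Khintchine.\<close>

theorem vector_contraction:
  fixes h :: "'i \<Rightarrow> 'z \<Rightarrow> real" and \<Psi> :: "'i \<Rightarrow> 't \<Rightarrow> 'z \<Rightarrow> real"
  assumes I: "finite I" and Z: "finite Z" "Z \<noteq> {}" and T: "finite T"
    and inc: "\<And>i z z'. i \<in> I \<Longrightarrow> z \<in> Z \<Longrightarrow> z' \<in> Z \<Longrightarrow>
      \<bar>h i z - h i z'\<bar> \<le> sqrt (\<Sum>t\<in>T. (\<Psi> i t z - \<Psi> i t z')\<^sup>2)"
  shows "rad I (\<lambda>e. MAX z\<in>Z. A z + (\<Sum>i\<in>I. e i * h i z))
     \<le> rad (I \<times> T) (\<lambda>e. MAX z\<in>Z. A z + 2 * (\<Sum>i\<in>I. \<Sum>t\<in>T. e (i, t) * \<Psi> i t z))"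
  using I inc
proof (induction I arbitrary: A rule: finite_induct)
  case empty
  then show ?case by (simp add: rad_empty)
next
  case (insert i I)
  let ?K = "{i} \<times> T"
  have fK: "finite ?K" using T by simp
  have K: "insert i I \<times> T = I \<times> T \<union> ?K" "(I \<times> T) \<inter> ?K = {}" using insert.hyps by auto
  have sK: "(\<Sum>k\<in>?K. G k) = (\<Sum>t\<in>T. G (i, t))" for G :: "_ \<Rightarrow> real"
    using sum.cartesian_product[of "\<lambda>i t. G (i, t)" T "{i}"] by simp
  have step: "((MAX z\<in>Z. B z + h i z) + (MAX z\<in>Z. B z - h i z)) / 2
     \<le> rad ?K (\<lambda>e. MAX z\<in>Z. B z + 2 * (\<Sum>t\<in>T. e (i, t) * \<Psi> i t z))" for B
    using contraction_step[OF Z fK, of "h i" "\<lambda>k. \<Psi> i (snd k)" B] insert.prems[of i]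
    by (simp add: sK)
  have re: "a + (x + s) = (a + s) + x" "a + (- x + s) = (a + s) - x" for a x s :: real
    by auto
  have "rad (insert i I) (\<lambda>e. MAX z\<in>Z. A z + (\<Sum>i\<in>insert i I. e i * h i z))
    = rad I (\<lambda>e. ((MAX z\<in>Z. (A z + (\<Sum>l\<in>I. e l * h l z)) + h i z)
        + (MAX z\<in>Z. (A z + (\<Sum>l\<in>I. e l * h l z)) - h i z)) / 2)"
    using insert.hyps by (simp add: rad_insert sum_upd re del: fun_upd_apply add: fun_upd_same)
  also have "\<dots> \<le> rad I (\<lambda>e. rad ?K (\<lambda>e'. MAX z\<in>Z. (A z + (\<Sum>l\<in>I. e l * h l z))
      + 2 * (\<Sum>t\<in>T. e' (i, t) * \<Psi> i t z)))"
    by (intro rad_mono step)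
  also have "\<dots> = rad ?K (\<lambda>e'. rad I (\<lambda>e. MAX z\<in>Z. (A z + 2 * (\<Sum>t\<in>T. e' (i, t) * \<Psi> i t z))
      + (\<Sum>l\<in>I. e l * h l z)))"
    by (subst rad_swap) (simp only: add_ac)
  also have "\<dots> \<le> rad ?K (\<lambda>e'. rad (I \<times> T) (\<lambda>e. MAX z\<in>Z. (A z + 2 * (\<Sum>t\<in>T. e' (i, t) * \<Psi> i t z))
      + 2 * (\<Sum>i\<in>I. \<Sum>t\<in>T. e (i, t) * \<Psi> i t z)))"
    by (rule rad_mono, rule insert.IH, rule insert.prems) simp_all
  also have "\<dots> = rad (I \<times> T) (\<lambda>e. rad ?K (\<lambda>e'. MAX z\<in>Z. (A z + 2 * (\<Sum>t\<in>T. e' (i, t) * \<Psi> i t z))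
      + 2 * (\<Sum>i\<in>I. \<Sum>t\<in>T. e (i, t) * \<Psi> i t z)))"
    by (rule rad_swap)
  also have "\<dots> = rad (insert i I \<times> T) (\<lambda>e. MAX z\<in>Z. A z + 2 * (\<Sum>i\<in>insert i I. \<Sum>t\<in>T. e (i, t) * \<Psi> i t z))"
  proof -
    have eq: "(\<Sum>i'\<in>insert i I. \<Sum>t\<in>T. (if (i', t) \<in> ?K then e' (i', t) else e (i', t)) * \<Psi> i' t z)
      = (\<Sum>t\<in>T. e' (i, t) * \<Psi> i t z) + (\<Sum>i\<in>I. \<Sum>t\<in>T. e (i, t) * \<Psi> i t z)" for e e' z
    proof -
      have "(\<Sum>i'\<in>I. \<Sum>t\<in>T. (if (i', t) \<in> ?K then e' (i', t) else e (i', t)) * \<Psi> i' t z)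
        = (\<Sum>i\<in>I. \<Sum>t\<in>T. e (i, t) * \<Psi> i t z)"
        using insert.hyps by (intro sum.cong) auto
      then show ?thesis using insert.hyps by simp
    qed
    show ?thesis
      unfolding K(1) using K(2) insert.hyps(1) T
      by (subst rad_Un) (simp_all only: eq finite_insert finite_SigmaI finite.emptyI distrib_left add_ac)
  qed
  finally show ?case .
qed

section \<open>Trace moments of random sums of rank one operators\<close>

lemma ip_commute: "ip d x y = ip d y x"
  by (simp add: ip_def mult.commute)

lemma ip_self_nonneg: "ip d x x \<ge> 0"
  by (simp add: ip_def sum_nonneg)

lemma enorm2_nonneg: "enorm2 d x \<ge> 0"
  by (simp add: enorm2_def ip_self_nonneg)

lemma enorm2_square: "(enorm2 d x)\<^sup>2 = ip d x x"
  by (simp add: enorm2_def ip_self_nonneg)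

lemma ip_self_eq_1: "enorm2 d v = 1 \<Longrightarrow> ip d v v = 1"
  using enorm2_square[of d v] by simp

lemma ip_cauchy_schwarz: "(ip d x y)\<^sup>2 \<le> ip d x x * ip d y y"
  using Cauchy_Schwarz_ineq_sum[of x y "{..<d}"] by (simp add: ip_def power2_eq_square)

lemma abs_ip_le: "\<bar>ip d x y\<bar> \<le> enorm2 d x * enorm2 d y"
proof -
  have "\<bar>ip d x y\<bar>\<^sup>2 \<le> (enorm2 d x * enorm2 d y)\<^sup>2"
    using ip_cauchy_schwarz[of d x y] by (simp add: power_mult_distrib enorm2_square)
  then show ?thesis
    by (rule power2_le_imp_le) (simp add: enorm2_nonneg)
qed

lemma component_square_le: "i < d \<Longrightarrow> (x i)\<^sup>2 \<le> ip d x x"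
  using member_le_sum[of i "{..<d}" "\<lambda>l. x l * x l"] by (simp add: ip_def power2_eq_square)

lemma ip_sum_left: "ip d (\<lambda>k. \<Sum>i\<in>I. c i * x i k) w = (\<Sum>i\<in>I. c i * ip d (x i) w)"
  unfolding ip_def sum_distrib_left sum_distrib_right
  by (subst sum.swap) (simp add: mult.assoc)

text \<open>Up to the normalization \<open>a 0 = 1\<close>, the sequence \<open>a\<^sub>j\<^sup>1\<^sup>/\<^sup>j\<close> is nondecreasing; the statement avoids roots.\<close>

lemma log_convex_power_le:
  fixes a :: "nat \<Rightarrow> real"
  assumes nn: "\<And>j. a j \<ge> 0" and lc: "\<And>j. (a (Suc j))\<^sup>2 \<le> a j * a (Suc (Suc j))"
  shows "a j ^ Suc j \<le> a 0 * a (Suc j) ^ j"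
proof (induction j)
  case 0
  then show ?case by simp
next
  case (Suc j)
  show ?case
  proof (cases "a (Suc j) = 0")
    case True
    then show ?thesis using nn by simp
  next
    case False
    then have pos: "a (Suc j) > 0" using nn[of "Suc j"] by simp
    have "a (Suc j) ^ j * a (Suc j) ^ Suc (Suc j) = ((a (Suc j))\<^sup>2) ^ Suc j"
      by (simp only: power_mult[symmetric] power_add[symmetric]) (simp add: mult_2)
    also have "\<dots> \<le> (a j * a (Suc (Suc j))) ^ Suc j"
      by (rule power_mono[OF lc]) simp
    also have "\<dots> = a j ^ Suc j * a (Suc (Suc j)) ^ Suc j"
      by (rule power_mult_distrib)
    also have "\<dots> \<le> (a 0 * a (Suc j) ^ j) * a (Suc (Suc j)) ^ Suc j"
      using Suc nn by (intro mult_right_mono) auto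
    finally have "a (Suc j) ^ j * a (Suc j) ^ Suc (Suc j)
        \<le> a (Suc j) ^ j * (a 0 * a (Suc (Suc j)) ^ Suc j)"
      by (simp only: mult_ac)
    then show ?thesis using pos by (simp only: mult_le_cancel_left_pos zero_less_power)
  qed
qed

text \<open>A bound at the top index \<open>M\<close> descends by monotonicity of the j-th roots;
  \<open>a 0 \<le> 1\<close> plays the part of a total mass of at most one.\<close>

lemma log_convex_le:
  fixes a :: "nat \<Rightarrow> real"
  assumes nn: "\<And>j. a j \<ge> 0" and lc: "\<And>j. (a (Suc j))\<^sup>2 \<le> a j * a (Suc (Suc j))"
    and a0: "a 0 \<le> 1" and \<tau>: "\<tau> \<ge> 0" "a M \<le> \<tau> ^ M" and "j \<le> M"
  shows "a j \<le> \<tau> ^ j"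
  using \<open>j \<le> M\<close>
proof (induction rule: inc_induct)
  case base
  then show ?case by (rule \<tau>(2))
next
  case (step j)
  have "a j ^ Suc j \<le> a 0 * a (Suc j) ^ j"
    by (rule log_convex_power_le[where a=a, OF nn lc])
  also have "\<dots> \<le> 1 * (\<tau> ^ Suc j) ^ j"
    using a0 nn step.IH by (intro mult_mono power_mono) auto
  also have "\<dots> = (\<tau> ^ j) ^ Suc j"
    by (simp only: mult_1_left power_mult[symmetric] mult.commute)
  finally show ?case
    by (rule power_le_imp_le_base) (use \<tau> in auto)
qed

text \<open>Operators are plain functions rather than matrices. The identity already forces
  linearity as far as \<open>ip d\<close> can detect it, and \<open>ip d\<close> ignores coordinates
  beyond \<open>d\<close>.\<close>

definition self_adjoint :: "nat \<Rightarrow> ((nat \<Rightarrow> real) \<Rightarrow> nat \<Rightarrow> real) \<Rightarrow> bool" where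
  "self_adjoint d U \<longleftrightarrow> (\<forall>u w. ip d (U u) w = ip d u (U w))"

lemma self_adjoint_funpow:
  assumes "self_adjoint d U"
  shows "ip d ((U ^^ a) u) w = ip d u ((U ^^ a) w)"
  using assms
  by (induction a arbitrary: u w) (auto simp: self_adjoint_def funpow_swap1)

lemma ip_funpow_add:
  assumes "self_adjoint d U"
  shows "ip d x ((U ^^ (a + b)) x) = ip d ((U ^^ a) x) ((U ^^ b) x)"
  using assms by (simp add: funpow_add self_adjoint_funpow)

lemma even_moment_nonneg:
  assumes "self_adjoint d U"
  shows "ip d x ((U ^^ (2 * j)) x) \<ge> 0"
  using ip_funpow_add[OF assms, of x j j] ip_self_nonneg by (simp add: mult_2)

text \<open>\<open>ip d x ((U ^^ q) x)\<close> is the q-th moment of the spectral measure of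
  \<open>U\<close> at \<open>x\<close>, whose mass is \<open>ip d x x\<close>, so this is the
  comparison of power means. It is obtained without diagonalization: Cauchy-Schwarz makes the even
  moments log-convex, and an odd moment is bounded by its two even neighbours.\<close>

lemma moment_le:
  assumes sa: "self_adjoint d U" and c: "ip d x x \<le> c" "c > 0"
    and \<tau>: "\<tau> \<ge> 0" "ip d x ((U ^^ (2 * M)) x) \<le> c * \<tau> ^ (2 * M)" and q: "q \<le> 2 * M"
  shows "\<bar>ip d x ((U ^^ q) x)\<bar> \<le> c * \<tau> ^ q"
proof -
  define s where "s q = ip d x ((U ^^ q) x)" for q
  have cs: "(s (i + j))\<^sup>2 \<le> s (2 * i) * s (2 * j)" for i j
    unfolding s_def ip_funpow_add[OF sa] mult_2 by (rule ip_cauchy_schwarz)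
  have even: "s (2 * j) \<le> c * \<tau> ^ (2 * j)" if "j \<le> M" for j
  proof -
    have "s (2 * j) / c \<le> (\<tau>\<^sup>2) ^ j"
    proof (rule log_convex_le[where a="\<lambda>j. s (2 * j) / c" and M=M])
      show "0 \<le> s (2 * i) / c" for i
        using even_moment_nonneg[OF sa] c by (simp add: s_def)
      show "(s (2 * Suc i) / c)\<^sup>2 \<le> s (2 * i) / c * (s (2 * Suc (Suc i)) / c)" for i
      proof -
        have "i + Suc (Suc i) = 2 * Suc i" by simp
        then have "(s (2 * Suc i))\<^sup>2 \<le> s (2 * i) * s (2 * Suc (Suc i))"
          using cs[of i "Suc (Suc i)"] by metis
        then show ?thesis
          using c by (simp add: power_divide power2_eq_square divide_right_mono del: mult_Suc_right)
      qed
      show "s (2 * 0) / c \<le> 1" using c by (simp add: s_def)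
      show "s (2 * M) / c \<le> (\<tau>\<^sup>2) ^ M"
        using \<tau>(2) c by (simp add: s_def power_mult[of \<tau> 2 M] pos_divide_le_eq mult.commute[of _ c])
    qed (use that in auto)
    then show ?thesis
      using c by (simp add: power_mult[of \<tau> 2 j] pos_divide_le_eq mult.commute[of _ c])
  qed
  show ?thesis
  proof (cases "even q")
    case True
    then obtain j where j: "q = 2 * j" by auto
    then show ?thesis using even[of j] even_moment_nonneg[OF sa, of x j] q by (simp add: s_def)
  next
    case False
    then obtain j where j: "q = Suc (2 * j)" by (metis oddE Suc_eq_plus1)
    have "\<bar>s q\<bar>\<^sup>2 \<le> s (2 * j) * s (2 * Suc j)"
      using cs[of j "Suc j"] j by (simp add: mult_2)
    also have "\<dots> \<le> (c * \<tau> ^ (2 * j)) * (c * \<tau> ^ (2 * Suc j))"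
      using even[of j] even[of "Suc j"] j q even_moment_nonneg[OF sa, of x "Suc j"] c \<tau>(1)
      by (intro mult_mono) (auto simp: s_def simp del: mult_Suc_right)
    also have "\<dots> = (c * \<tau> ^ q)\<^sup>2"
      unfolding j by (simp add: power2_eq_square power_add[symmetric] mult_2)
    finally have "\<bar>s q\<bar> \<le> c * \<tau> ^ q"
      by (rule power2_le_imp_le) (use c \<tau> in auto)
    then show ?thesis by (simp add: s_def)
  qed
qed

text \<open>\<open>moment_le\<close> replaces the mixed moments by
  \<open>\<tau> ^ q * \<theta> ^ (m - q)\<close>. Pairing \<open>q\<close> with
  \<open>m - q\<close>, the rearrangement inequality bounds each pair by
  \<open>\<tau> ^ m + \<theta> ^ m\<close>, so only the top moments survive, with
  \<open>m + 1\<close> terms.\<close>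

lemma sum_moment_products_le:
  assumes sa: "self_adjoint d U" "self_adjoint d V"
  shows "2 * (\<Sum>q\<le>2 * M. ip d x ((U ^^ q) x) * ip d x ((V ^^ (2 * M - q)) x))
     \<le> real (2 * M + 1) * ip d x x * (ip d x ((U ^^ (2 * M)) x) + ip d x ((V ^^ (2 * M)) x))"
proof (cases "ip d x x = 0")
  case True
  have "ip d x y = 0" for y
    using ip_cauchy_schwarz[of d x y] True by simp
  then show ?thesis by simp
next
  case False
  define c where "c = ip d x x"
  have c: "c > 0" using False ip_self_nonneg[of d x] by (simp add: c_def)
  show ?thesis
  proof (cases "M = 0")
    case True
    then show ?thesis by simp
  next
    case M: False
    define m where "m = 2 * M"
    have m: "m > 0" using M by (simp add: m_def)
    \<comment> \<open>Normalized so that \<open>moment_le\<close> becomes an equality at the top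
      exponent \<open>m\<close>.\<close>
    define \<tau> where "\<tau> = root m (ip d x ((U ^^ m) x) / c)"
    define \<theta> where "\<theta> = root m (ip d x ((V ^^ m) x) / c)"
    have nn: "ip d x ((U ^^ m) x) \<ge> 0" "ip d x ((V ^^ m) x) \<ge> 0"
      using even_moment_nonneg[OF sa(1)] even_moment_nonneg[OF sa(2)] by (auto simp: m_def)
    have \<tau>: "\<tau> \<ge> 0" "\<theta> \<ge> 0"
      using nn c m by (auto simp: \<tau>_def \<theta>_def)
    have pow: "c * \<tau> ^ m = ip d x ((U ^^ m) x)" "c * \<theta> ^ m = ip d x ((V ^^ m) x)"
      using nn c m by (auto simp: \<tau>_def \<theta>_def)
    define S where "S = (\<Sum>q\<le>m. \<tau> ^ q * \<theta> ^ (m - q))"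
    have "(\<Sum>q\<le>m. ip d x ((U ^^ q) x) * ip d x ((V ^^ (m - q)) x))
        \<le> (\<Sum>q\<le>m. (c * \<tau> ^ q) * (c * \<theta> ^ (m - q)))"
    proof (rule sum_mono)
      fix q assume "q \<in> {..m}"
      then have q: "q \<le> 2 * M" "m - q \<le> 2 * M" by (auto simp: m_def)
      have "\<bar>ip d x ((U ^^ q) x)\<bar> \<le> c * \<tau> ^ q"
        using pow \<tau> c q sa by (intro moment_le[where M=M]) (auto simp: m_def c_def)
      moreover have "\<bar>ip d x ((V ^^ (m - q)) x)\<bar> \<le> c * \<theta> ^ (m - q)"
        using pow \<tau> c q sa by (intro moment_le[where M=M]) (auto simp: m_def c_def)
      ultimately have "\<bar>ip d x ((U ^^ q) x)\<bar> * \<bar>ip d x ((V ^^ (m - q)) x)\<bar>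
          \<le> (c * \<tau> ^ q) * (c * \<theta> ^ (m - q))"
        using c \<tau> by (intro mult_mono) auto
      then show "ip d x ((U ^^ q) x) * ip d x ((V ^^ (m - q)) x) \<le> (c * \<tau> ^ q) * (c * \<theta> ^ (m - q))"
        by (simp add: abs_mult[symmetric])
    qed
    also have "\<dots> = c\<^sup>2 * S"
      by (simp add: S_def sum_distrib_left power2_eq_square mult_ac)
    finally have 1: "(\<Sum>q\<le>m. ip d x ((U ^^ q) x) * ip d x ((V ^^ (m - q)) x)) \<le> c\<^sup>2 * S" .
    \<comment> \<open>pair \<open>q\<close> with \<open>m - q\<close>\<close>
    have "S = (\<Sum>q\<le>m. \<tau> ^ (m - q) * \<theta> ^ q)"
      unfolding S_def by (rule sum.reindex_bij_witness[of _ "\<lambda>q. m - q" "\<lambda>q. m - q"]) auto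
    then have "2 * S = (\<Sum>q\<le>m. \<tau> ^ q * \<theta> ^ (m - q) + \<tau> ^ (m - q) * \<theta> ^ q)"
      by (simp add: sum.distrib S_def)
    also have "\<dots> \<le> (\<Sum>q\<le>m. \<tau> ^ m + \<theta> ^ m)"
    proof (rule sum_mono)
      fix q assume q: "q \<in> {..m}"
      have "0 \<le> (\<tau> ^ q - \<theta> ^ q) * (\<tau> ^ (m - q) - \<theta> ^ (m - q))"
      proof (cases "\<tau> \<le> \<theta>")
        case True
        then show ?thesis using \<tau> by (intro mult_nonpos_nonpos) (auto intro: power_mono)
      next
        case False
        then show ?thesis using \<tau> by (intro mult_nonneg_nonneg) (auto intro: power_mono)
      qed
      moreover have "\<tau> ^ q * \<tau> ^ (m - q) = \<tau> ^ m" "\<theta> ^ q * \<theta> ^ (m - q) = \<theta> ^ m"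
        using q by (auto simp: power_add[symmetric])
      ultimately show "\<tau> ^ q * \<theta> ^ (m - q) + \<tau> ^ (m - q) * \<theta> ^ q \<le> \<tau> ^ m + \<theta> ^ m"
        by (simp add: algebra_simps)
    qed
    also have "\<dots> = real (m + 1) * (\<tau> ^ m + \<theta> ^ m)" by simp
    finally have "c\<^sup>2 * (2 * S) \<le> c\<^sup>2 * (real (m + 1) * (\<tau> ^ m + \<theta> ^ m))"
      by (rule mult_left_mono) simp
    also have "\<dots> = real (m + 1) * c * (c * \<tau> ^ m + c * \<theta> ^ m)"
      by (simp add: power2_eq_square algebra_simps)
    finally show ?thesis
      using 1 unfolding pow by (simp add: m_def c_def)
  qed
qed

text \<open>The difference of powers telescopes into terms with \<open>q\<close> factors
  \<open>U\<close>, one factor \<open>U - V\<close> and \<open>m - q\<close> factors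
  \<open>V\<close>. Since \<open>U - V\<close> is twice the rank one form of \<open>x\<close>, each
  term splits into a product of two scalar moments at \<open>x\<close>; this is where rank one
  summands spare all noncommutative inequalities.\<close>

lemma moment_difference_le:
  assumes sa: "self_adjoint d U" "self_adjoint d V"
    and UV: "\<And>u w. ip d (U u) w - ip d (V u) w = 2 * ip d x u * ip d x w"
  shows "ip d x ((U ^^ (2 * M + 1)) x) - ip d x ((V ^^ (2 * M + 1)) x)
    \<le> real (2 * M + 1) * ip d x x * (ip d x ((U ^^ (2 * M)) x) + ip d x ((V ^^ (2 * M)) x))"
proof -
  define m where "m = 2 * M"
  define a where "a q = ip d ((U ^^ q) x) ((V ^^ (Suc m - q)) x)" for q
  have step: "a (Suc q) - a q = 2 * (ip d x ((U ^^ q) x) * ip d x ((V ^^ (m - q)) x))" if "q \<le> m" for q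
  proof -
    have "a q = ip d (V ((U ^^ q) x)) ((V ^^ (m - q)) x)"
      using sa(2) that by (simp add: a_def Suc_diff_le self_adjoint_def)
    moreover have "a (Suc q) = ip d (U ((U ^^ q) x)) ((V ^^ (m - q)) x)"
      by (simp add: a_def)
    ultimately show ?thesis using UV by simp
  qed
  have "ip d x ((U ^^ Suc m) x) - ip d x ((V ^^ Suc m) x) = a (Suc m) - a 0"
    using ip_commute by (simp add: a_def)
  also have "\<dots> = (\<Sum>q\<le>m. a (Suc q) - a q)"
    by (subst lessThan_Suc_atMost[symmetric], subst sum_lessThan_telescope) simp
  also have "\<dots> = 2 * (\<Sum>q\<le>m. ip d x ((U ^^ q) x) * ip d x ((V ^^ (m - q)) x))"
    unfolding sum_distrib_left by (intro sum.cong step) auto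
  finally show ?thesis
    using sum_moment_products_le[OF sa, of x M] by (simp add: m_def)
qed

section \<open>Traces of powers of a signed sum of rank one matrices, written as operators\<close>

definition outer_sum :: "nat \<Rightarrow> 'i set \<Rightarrow> ('i \<Rightarrow> nat \<Rightarrow> real) \<Rightarrow> ('i \<Rightarrow> real) \<Rightarrow> (nat \<Rightarrow> real) \<Rightarrow> nat \<Rightarrow> real" where
  "outer_sum d I x e v = (\<lambda>k. \<Sum>i\<in>I. (e i * ip d (x i) v) * x i k)"

definition unit_vec :: "nat \<Rightarrow> nat \<Rightarrow> real" where
  "unit_vec j = (\<lambda>k. if k = j then 1 else 0)"

definition trace_pow :: "nat \<Rightarrow> ((nat \<Rightarrow> real) \<Rightarrow> nat \<Rightarrow> real) \<Rightarrow> nat \<Rightarrow> real" where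
  "trace_pow d U q = (\<Sum>j<d. ip d (unit_vec j) ((U ^^ q) (unit_vec j)))"

lemma ip_unit_vec: "j < d \<Longrightarrow> ip d x (unit_vec j) = x j"
  by (simp add: ip_def unit_vec_def if_distrib[of "\<lambda>t. _ * t"] sum.delta cong: if_cong)

lemma enorm2_unit_vec: "j < d \<Longrightarrow> enorm2 d (unit_vec j) = 1"
  using ip_unit_vec[of j d "unit_vec j"] by (simp add: enorm2_def unit_vec_def)

lemma ip_outer_sum: "ip d (outer_sum d I x e u) w = (\<Sum>i\<in>I. e i * ip d (x i) u * ip d (x i) w)"
  unfolding outer_sum_def by (rule ip_sum_left)

lemma self_adjoint_outer_sum: "self_adjoint d (outer_sum d I x e)"
  unfolding self_adjoint_def
  by (subst (2) ip_commute) (simp add: ip_outer_sum mult_ac)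

lemma trace_pow_even:
  assumes "self_adjoint d U"
  shows "trace_pow d U (2 * p) = (\<Sum>j<d. ip d ((U ^^ p) (unit_vec j)) ((U ^^ p) (unit_vec j)))"
  using ip_funpow_add[OF assms, of _ p p] by (simp add: trace_pow_def mult_2)

text \<open>Expanding one factor of the power under the trace isolates a single sign in front of
  each summand, which is what averaging over that sign requires.\<close>

lemma trace_pow_outer_sum_Suc:
  "trace_pow d (outer_sum d I x e) (Suc q)
    = (\<Sum>i\<in>I. e i * ip d (x i) ((outer_sum d I x e ^^ q) (x i)))"
proof -
  let ?U = "outer_sum d I x e"
  have "trace_pow d ?U (Suc q) = (\<Sum>j<d. \<Sum>i\<in>I. e i * ip d (x i) ((?U ^^ q) (unit_vec j)) * x i j)"
    unfolding trace_pow_def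
    by (intro sum.cong refl) (subst ip_commute, simp add: ip_outer_sum ip_unit_vec)
  also have "\<dots> = (\<Sum>i\<in>I. e i * (\<Sum>j<d. ip d ((?U ^^ q) (x i)) (unit_vec j) * x i j))"
    by (subst sum.swap)
      (simp add: sum_distrib_left mult.assoc self_adjoint_funpow[OF self_adjoint_outer_sum])
  also have "\<dots> = (\<Sum>i\<in>I. e i * ip d (x i) ((?U ^^ q) (x i)))"
    by (subst (2) ip_commute) (simp add: ip_unit_vec, simp add: ip_def)
  finally show ?thesis .
qed

text \<open>\<open>moment_le\<close> at exponent 1 bounds the left side by the squared length of
  \<open>(U ^^ p) v\<close>. For a unit vector this is at most the squared Hilbert-Schmidt norm of
  the p-th power, which is the trace.\<close>

lemma quadratic_form_power_le_trace:
  assumes sa: "self_adjoint d U" and v: "enorm2 d v = 1" and p: "p \<ge> 1"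
  shows "(ip d v (U v)) ^ (2 * p) \<le> trace_pow d U (2 * p)"
proof -
  have vv: "ip d v v = 1" using v by (rule ip_self_eq_1)
  define t where "t = ip d v ((U ^^ (2 * p)) v)"
  define \<tau> where "\<tau> = root (2 * p) t"
  have t: "t \<ge> 0" using even_moment_nonneg[OF sa] by (simp add: t_def)
  have \<tau>: "\<tau> \<ge> 0" "\<tau> ^ (2 * p) = t"
    using t p by (auto simp: \<tau>_def)
  have "\<bar>ip d v ((U ^^ 1) v)\<bar> \<le> 1 * \<tau> ^ 1"
    using vv \<tau> p by (intro moment_le[OF sa, where M=p]) (auto simp: t_def)
  then have "\<bar>ip d v (U v)\<bar> ^ (2 * p) \<le> \<tau> ^ (2 * p)"
    by (intro power_mono) auto
  then have "(ip d v (U v)) ^ (2 * p) \<le> t"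
    using \<tau> by (simp add: power_even_abs)
  also have "t = ip d ((U ^^ p) v) ((U ^^ p) v)"
    using ip_funpow_add[OF sa, of v p p] by (simp add: t_def mult_2)
  also have "\<dots> = (\<Sum>j<d. (ip d ((U ^^ p) v) (unit_vec j))\<^sup>2)"
    by (simp add: ip_unit_vec power2_eq_square) (simp add: ip_def)
  also have "\<dots> = (\<Sum>j<d. (ip d v ((U ^^ p) (unit_vec j)))\<^sup>2)"
    by (simp add: self_adjoint_funpow[OF sa])
  also have "\<dots> \<le> (\<Sum>j<d. ip d ((U ^^ p) (unit_vec j)) ((U ^^ p) (unit_vec j)))"
    using ip_cauchy_schwarz[of d v] vv by (intro sum_mono) simp
  also have "\<dots> = trace_pow d U (2 * p)"
    by (rule trace_pow_even[OF sa, symmetric])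
  finally show ?thesis .
qed

text \<open>A scalar-valued proof of the noncommutative Khintchine inequality for rank one summands:
  averaging over the sign of one summand lowers the power of the random operator by two.\<close>

lemma rad_trace_pow_step:
  assumes I: "finite I" and x: "\<And>i. i \<in> I \<Longrightarrow> ip d (x i) (x i) \<le> R"
  shows "rad I (\<lambda>e. trace_pow d (outer_sum d I x e) (2 * M + 2))
    \<le> real (2 * M + 1) * R * rad I (\<lambda>e. \<Sum>i\<in>I. ip d (x i) ((outer_sum d I x e ^^ (2 * M)) (x i)))"
proof -
  define s where "s i q e = ip d (x i) ((outer_sum d I x e ^^ q) (x i))" for i q e
  have one: "rad I (\<lambda>e. e i * s i (2 * M + 1) e) \<le> rad I (\<lambda>e. real (2 * M + 1) * R * s i (2 * M) e)"
    if i: "i \<in> I" for i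
  proof -
    define J where "J = I - {i}"
    have J: "I = insert i J" "i \<notin> J" "finite J" using I i by (auto simp: J_def)
    have pt: "((e(i := 1)) i * s i (2 * M + 1) (e(i := 1)) + (e(i := -1)) i * s i (2 * M + 1) (e(i := -1))) / 2
      \<le> (real (2 * M + 1) * R * s i (2 * M) (e(i := 1)) + real (2 * M + 1) * R * s i (2 * M) (e(i := -1))) / 2" for e
    proof -
      let ?U = "outer_sum d I x (e(i := 1))" and ?V = "outer_sum d I x (e(i := -1))"
      have UV: "ip d (?U u) w - ip d (?V u) w = 2 * ip d (x i) u * ip d (x i) w" for u w
      proof -
        have "(\<Sum>l\<in>J. (e(i := a)) l * ip d (x l) u * ip d (x l) w)
            = (\<Sum>l\<in>J. e l * (ip d (x l) u * ip d (x l) w))" for a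
          using sum_upd[OF J(2), of e a "\<lambda>l. ip d (x l) u * ip d (x l) w"] by (simp add: mult.assoc)
        then show ?thesis
          unfolding ip_outer_sum using J
          by (simp add: J(1) del: fun_upd_apply add: fun_upd_same)
      qed
      \<comment> \<open>Averaging \<open>e i * s i\<close> over the sign \<open>e i\<close> gives
        half the difference of the odd moments at +1 and -1. The sum of even moments that bounds the
        difference is twice their average over the same sign.\<close>
      have "s i (2 * M + 1) (e(i := 1)) - s i (2 * M + 1) (e(i := -1))
        \<le> real (2 * M + 1) * ip d (x i) (x i) * (s i (2 * M) (e(i := 1)) + s i (2 * M) (e(i := -1)))"
        unfolding s_def
        by (rule moment_difference_le[OF self_adjoint_outer_sum self_adjoint_outer_sum UV])
      also have "\<dots> \<le> real (2 * M + 1) * R * (s i (2 * M) (e(i := 1)) + s i (2 * M) (e(i := -1)))"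
        using x[OF i] even_moment_nonneg[OF self_adjoint_outer_sum]
        by (intro mult_right_mono mult_left_mono add_nonneg_nonneg) (auto simp: s_def)
      finally show ?thesis by (simp add: distrib_left del: of_nat_add of_nat_mult)
    qed
    show ?thesis
      unfolding J(1) rad_insert[OF J(3,2)] unfolding J(1)[symmetric] by (rule rad_mono[OF pt])
  qed
  have "rad I (\<lambda>e. trace_pow d (outer_sum d I x e) (2 * M + 2))
      = (\<Sum>i\<in>I. rad I (\<lambda>e. e i * s i (2 * M + 1) e))"
    using trace_pow_outer_sum_Suc[of d I x _ "2 * M + 1"] by (simp add: s_def rad_sum)
  also have "\<dots> \<le> (\<Sum>i\<in>I. rad I (\<lambda>e. real (2 * M + 1) * R * s i (2 * M) e))"
    by (rule sum_mono[OF one])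
  also have "\<dots> = real (2 * M + 1) * R * rad I (\<lambda>e. \<Sum>i\<in>I. s i (2 * M) e)"
    unfolding rad_cmult rad_sum sum_distrib_left ..
  finally show ?thesis by (simp add: s_def)
qed

text \<open>Expanded in the unit vectors, the left side applies the quadratic form of the points to
  the vectors \<open>(U ^^ M) (unit_vec j)\<close>. The bound \<open>S\<close> on that form leads
  back to a trace and closes the recursion.\<close>

lemma sum_moments_le_trace:
  assumes sa: "self_adjoint d U" and S: "\<And>w. (\<Sum>i\<in>I. (ip d (x i) w)\<^sup>2) \<le> S * ip d w w"
  shows "(\<Sum>i\<in>I. ip d (x i) ((U ^^ (2 * M)) (x i))) \<le> S * trace_pow d U (2 * M)"
proof -
  have "ip d (x i) ((U ^^ (2 * M)) (x i)) = (\<Sum>j<d. (ip d (x i) ((U ^^ M) (unit_vec j)))\<^sup>2)" for i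
  proof -
    have "ip d (x i) ((U ^^ (2 * M)) (x i)) = ip d ((U ^^ M) (x i)) ((U ^^ M) (x i))"
      using ip_funpow_add[OF sa, of "x i" M M] by (simp add: mult_2)
    also have "\<dots> = (\<Sum>j<d. (ip d ((U ^^ M) (x i)) (unit_vec j))\<^sup>2)"
      by (simp add: ip_unit_vec power2_eq_square) (simp add: ip_def)
    finally show ?thesis by (simp add: self_adjoint_funpow[OF sa])
  qed
  then have "(\<Sum>i\<in>I. ip d (x i) ((U ^^ (2 * M)) (x i)))
      = (\<Sum>j<d. \<Sum>i\<in>I. (ip d (x i) ((U ^^ M) (unit_vec j)))\<^sup>2)"
    by (simp add: sum.swap[of _ "{..<d}"])
  also have "\<dots> \<le> (\<Sum>j<d. S * ip d ((U ^^ M) (unit_vec j)) ((U ^^ M) (unit_vec j)))"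
    by (intro sum_mono S)
  also have "\<dots> = S * trace_pow d U (2 * M)"
    by (simp add: trace_pow_even[OF sa] sum_distrib_left)
  finally show ?thesis .
qed

text \<open>The recursion stops at exponent 2 and not at 0, where the trace would be the dimension.
  There the average is at most \<open>R\<close> times the sum of the squared lengths, hence at most
  \<open>card I * R * S\<close>: this replaces \<open>d\<close> by the number of points.\<close>

theorem rad_trace_pow_le:
  assumes I: "finite I" and x: "\<And>i. i \<in> I \<Longrightarrow> ip d (x i) (x i) \<le> R" and R: "R \<ge> 0"
    and S0: "S \<ge> 0" and S: "\<And>w. (\<Sum>i\<in>I. (ip d (x i) w)\<^sup>2) \<le> S * ip d w w"
    and p: "p \<ge> 1"
  shows "rad I (\<lambda>e. trace_pow d (outer_sum d I x e) (2 * p)) \<le> real (card I) * (2 * real p * R * S) ^ p"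
proof -
  \<comment> \<open>The hypothesis \<open>S\<close> is tested at \<open>w = x i\<close>.\<close>
  have xS: "ip d (x i) (x i) \<le> S" if "i \<in> I" for i
  proof -
    have "ip d (x i) (x i) * ip d (x i) (x i) \<le> (\<Sum>l\<in>I. (ip d (x l) (x i))\<^sup>2)"
      using that I by (intro order_trans[OF _ member_le_sum[of i]]) (auto simp: power2_eq_square)
    also have "\<dots> \<le> S * ip d (x i) (x i)" by (rule S)
    finally show ?thesis
      using ip_self_nonneg[of d "x i"] S0 by (metis mult_right_le_imp_le order_le_less)
  qed
  have "rad I (\<lambda>e. trace_pow d (outer_sum d I x e) (2 * q))
    \<le> real (card I) * (2 * real p * R * S) ^ q" if "1 \<le> q" "q \<le> p" for q
    using that
  proof (induction q rule: dec_induct)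
    case base
    have "rad I (\<lambda>e. trace_pow d (outer_sum d I x e) (2 * 1)) \<le> R * (\<Sum>i\<in>I. ip d (x i) (x i))"
      using rad_trace_pow_step[OF I x, where M=0] I x by (simp add: rad_const numeral_2_eq_2)
    also have "\<dots> \<le> R * (real (card I) * S)"
      using R xS sum_bounded_above[of I "\<lambda>i. ip d (x i) (x i)" S] by (intro mult_left_mono) auto
    also have "\<dots> \<le> real (card I) * (2 * real p * R * S) ^ 1"
      using p R S0 mult_right_mono[of 1 "2 * real p" "R * S * real (card I)"] by (simp add: mult_ac)
    finally show ?case .
  next
    case (step q)
    have "rad I (\<lambda>e. trace_pow d (outer_sum d I x e) (2 * Suc q))
      \<le> real (2 * q + 1) * R * rad I (\<lambda>e. \<Sum>i\<in>I. ip d (x i) ((outer_sum d I x e ^^ (2 * q)) (x i)))"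
      using rad_trace_pow_step[OF I x, where M=q] by simp
    also have "\<dots> \<le> real (2 * q + 1) * R * rad I (\<lambda>e. S * trace_pow d (outer_sum d I x e) (2 * q))"
      using R by (intro mult_left_mono rad_mono sum_moments_le_trace self_adjoint_outer_sum S) auto
    also have "\<dots> = real (2 * q + 1) * (R * S) * rad I (\<lambda>e. trace_pow d (outer_sum d I x e) (2 * q))"
      by (simp add: rad_cmult)
    also have "\<dots> \<le> (2 * real p) * (R * S) * (real (card I) * (2 * real p * R * S) ^ q)"
    proof (intro mult_mono)
      show "real (2 * q + 1) \<le> 2 * real p" using step by simp
      have "rad I (\<lambda>_. 0) \<le> rad I (\<lambda>e. trace_pow d (outer_sum d I x e) (2 * q))"
        by (intro rad_mono) (simp add: trace_pow_even[OF self_adjoint_outer_sum] sum_nonneg ip_self_nonneg)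
      then show "0 \<le> rad I (\<lambda>e. trace_pow d (outer_sum d I x e) (2 * q))"
        using I by (simp add: rad_const)
    qed (use step R S0 in auto)
    also have "\<dots> = real (card I) * (2 * real p * R * S) ^ Suc q" by simp
    finally show ?case .
  qed
  from this[of p] show ?thesis using p by simp
qed

section \<open>Rademacher averages over Lipschitz functions of squared projections\<close>

text \<open>Above the threshold \<open>\<tau> = 2 * sqrt B\<close> a value is dominated by its 2q-th
  power divided by \<open>\<tau> ^ (2 * q - 1)\<close>. The factor 2 in the threshold creates a
  slack of \<open>4 ^ q\<close>, which pays for the number of variables and for \<open>N\<close>; a
  larger maximum thus costs only a larger moment order.\<close>

lemma rad_Max_le:
  assumes J: "finite J" and K: "finite K" "K \<noteq> {}" and q: "q \<ge> 1" and B: "B > 0"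
    and mom: "\<And>\<kappa>. \<kappa> \<in> K \<Longrightarrow> rad J (\<lambda>e. Y \<kappa> e ^ (2 * q)) \<le> N * B ^ q"
    and card: "real (card K) * N \<le> 4 ^ q"
  shows "rad J (\<lambda>e. MAX \<kappa>\<in>K. Y \<kappa> e) \<le> 4 * sqrt B"
proof -
  define \<tau> where "\<tau> = 2 * sqrt B"
  have \<tau>: "\<tau> > 0" using B by (simp add: \<tau>_def)
  have \<tau>q: "\<tau> ^ (2 * q) = 4 ^ q * B ^ q"
    using B by (simp add: \<tau>_def power_mult power_mult_distrib)
  have pt: "(MAX \<kappa>\<in>K. Y \<kappa> e) \<le> \<tau> + \<tau> / \<tau> ^ (2 * q) * (\<Sum>\<kappa>\<in>K. Y \<kappa> e ^ (2 * q))" for e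
  proof (rule Max.boundedI)
    fix y assume "y \<in> (\<lambda>\<kappa>. Y \<kappa> e) ` K"
    then obtain \<kappa> where \<kappa>: "\<kappa> \<in> K" "y = Y \<kappa> e" by auto
    have "y ^ (2 * q) \<le> (\<Sum>\<kappa>\<in>K. Y \<kappa> e ^ (2 * q))"
      unfolding \<kappa>(2) using K(1) \<kappa>(1)
      by (intro member_le_sum[of \<kappa> K "\<lambda>\<kappa>. Y \<kappa> e ^ (2 * q)"]) auto
    then have "\<tau> / \<tau> ^ (2 * q) * y ^ (2 * q) \<le> \<tau> / \<tau> ^ (2 * q) * (\<Sum>\<kappa>\<in>K. Y \<kappa> e ^ (2 * q))"
      using \<tau> by (intro mult_left_mono) auto
    moreover have "y \<le> \<tau> + \<tau> / \<tau> ^ (2 * q) * y ^ (2 * q)"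
    proof (cases "y \<le> \<tau>")
      case True
      have "0 \<le> \<tau> / \<tau> ^ (2 * q) * y ^ (2 * q)" using \<tau> by simp
      then show ?thesis using True by linarith
    next
      case False
      then have "1 \<le> y / \<tau>" using \<tau> by simp
      then have "(y / \<tau>) ^ 1 \<le> (y / \<tau>) ^ (2 * q)" using q by (intro power_increasing) auto
      then have "\<tau> * (y / \<tau>) ^ 1 \<le> \<tau> * (y / \<tau>) ^ (2 * q)" using \<tau> by (intro mult_left_mono) auto
      then show ?thesis using \<tau> by (simp add: power_divide)
    qed
    ultimately show "y \<le> \<tau> + \<tau> / \<tau> ^ (2 * q) * (\<Sum>\<kappa>\<in>K. Y \<kappa> e ^ (2 * q))" by linarith
  qed (use K in auto)
  have "rad J (\<lambda>e. MAX \<kappa>\<in>K. Y \<kappa> e)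
      \<le> rad J (\<lambda>e. \<tau> + \<tau> / \<tau> ^ (2 * q) * (\<Sum>\<kappa>\<in>K. Y \<kappa> e ^ (2 * q)))"
    by (rule rad_mono[OF pt])
  also have "\<dots> = \<tau> + \<tau> / \<tau> ^ (2 * q) * (\<Sum>\<kappa>\<in>K. rad J (\<lambda>e. Y \<kappa> e ^ (2 * q)))"
    unfolding rad_add rad_const[OF J] rad_cmult rad_sum ..
  also have "\<dots> \<le> \<tau> + \<tau> / \<tau> ^ (2 * q) * (real (card K) * (N * B ^ q))"
    using \<tau> mom sum_bounded_above[of K "\<lambda>\<kappa>. rad J (\<lambda>e. Y \<kappa> e ^ (2 * q))" "N * B ^ q"]
    by (intro add_left_mono mult_left_mono) auto
  also have "\<dots> = \<tau> + \<tau> * (real (card K) * N / 4 ^ q)"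
    using B unfolding \<tau>q by simp
  also have "\<dots> \<le> \<tau> + \<tau> * 1"
    using \<tau> card by (intro add_left_mono mult_left_mono) auto
  finally show ?thesis by (simp add: \<tau>_def)
qed

lemma outer_sum_cong: "(\<And>i. i \<in> I \<Longrightarrow> e i = e' i) \<Longrightarrow> outer_sum d I x e = outer_sum d I x e'"
  by (auto simp: outer_sum_def intro!: sum.cong)

text \<open>For fixed \<open>\<kappa>\<close> one trace bounds the forms at all \<open>v\<close>
  simultaneously, whatever the size of \<open>V\<close>. Only the number of copies and of points
  dictates the order \<open>q\<close>.\<close>

lemma rad_Max_quadratic_forms_le:
  assumes I: "finite I" and x: "\<And>i. i \<in> I \<Longrightarrow> ip d (x i) (x i) \<le> R" and R: "R > 0"
    and S0: "S > 0" and S: "\<And>w. (\<Sum>i\<in>I. (ip d (x i) w)\<^sup>2) \<le> S * ip d w w"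
    and V: "finite V" "V \<noteq> {}" "\<And>v. v \<in> V \<Longrightarrow> enorm2 d v = 1"
    and T: "finite T" and K: "K \<subseteq> T" "K \<noteq> {}"
    and q: "q \<ge> 1" and card: "card K * card I \<le> 4 ^ q"
  shows "rad (I \<times> T) (\<lambda>e. MAX \<kappa>\<in>K. MAX v\<in>V. \<bar>\<Sum>i\<in>I. e (i, \<kappa>) * (ip d (x i) v)\<^sup>2\<bar>)
    \<le> 4 * sqrt (2 * real q * R * S)"
proof (rule rad_Max_le[where N="real (card I)" and q=q])
  show "finite K" using T K(1) finite_subset by blast
  show "real (card K) * real (card I) \<le> 4 ^ q"
    using card by (metis of_nat_le_iff of_nat_mult of_nat_numeral of_nat_power)
  fix \<kappa> assume \<kappa>: "\<kappa> \<in> K"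
  have "(MAX v\<in>V. \<bar>\<Sum>i\<in>I. e (i, \<kappa>) * (ip d (x i) v)\<^sup>2\<bar>) ^ (2 * q)
      \<le> trace_pow d (outer_sum d I x (\<lambda>i. e (i, \<kappa>))) (2 * q)" for e
  proof -
    obtain v where v: "v \<in> V"
      "(MAX v\<in>V. \<bar>\<Sum>i\<in>I. e (i, \<kappa>) * (ip d (x i) v)\<^sup>2\<bar>) = \<bar>\<Sum>i\<in>I. e (i, \<kappa>) * (ip d (x i) v)\<^sup>2\<bar>"
      using Max_in[of "(\<lambda>v. \<bar>\<Sum>i\<in>I. e (i, \<kappa>) * (ip d (x i) v)\<^sup>2\<bar>) ` V"] V(1,2)
      by (metis (no_types, lifting) finite_imageI imageE image_is_empty)
    have "ip d v (outer_sum d I x (\<lambda>i. e (i, \<kappa>)) v) = (\<Sum>i\<in>I. e (i, \<kappa>) * (ip d (x i) v)\<^sup>2)"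
      by (subst ip_commute) (simp add: ip_outer_sum power2_eq_square mult.assoc)
    then show ?thesis
      using quadratic_form_power_le_trace[OF self_adjoint_outer_sum V(3)[OF v(1)] q, of I x "\<lambda>i. e (i, \<kappa>)"]
      unfolding v(2) by (simp add: power_even_abs)
  qed
  then have "rad (I \<times> T) (\<lambda>e. (MAX v\<in>V. \<bar>\<Sum>i\<in>I. e (i, \<kappa>) * (ip d (x i) v)\<^sup>2\<bar>) ^ (2 * q))
      \<le> rad (I \<times> T) (\<lambda>e. trace_pow d (outer_sum d I x (\<lambda>i. e (i, \<kappa>))) (2 * q))"
    by (intro rad_mono)
  also have "\<dots> = rad I (\<lambda>e. trace_pow d (outer_sum d I x e) (2 * q))"
  proof (rule rad_reindex[where g="\<lambda>i. (i, \<kappa>)"])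
    show "(\<lambda>i. (i, \<kappa>)) ` I \<subseteq> I \<times> T" using \<kappa> K by auto
    show "trace_pow d (outer_sum d I x e) (2 * q) = trace_pow d (outer_sum d I x e') (2 * q)"
      if "\<And>i. i \<in> I \<Longrightarrow> e i = e' i" for e e'
      using outer_sum_cong[of I e e' d x] that by simp
  qed (use I T in \<open>auto simp: inj_on_def\<close>)
  also have "\<dots> \<le> real (card I) * (2 * real q * R * S) ^ q"
    using R S0 by (intro rad_trace_pow_le I x S q) auto
  finally show "rad (I \<times> T) (\<lambda>e. (MAX v\<in>V. \<bar>\<Sum>i\<in>I. e (i, \<kappa>) * (ip d (x i) v)\<^sup>2\<bar>) ^ (2 * q))
      \<le> real (card I) * (2 * real q * R * S) ^ q" .
qed (use I T K q R S0 in auto)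

text \<open>\<open>1\<close>-Lipschitz functions that vanish up to \<open>a\<close>, quantized at relative precision
  \<open>2\<^sup>-\<^sup>l\<close> along the geometric grid \<open>a, a (1 + 2\<^sup>-\<^sup>l), a (1 + 2\<^sup>-\<^sup>l)\<^sup>2, \<dots>\<close> of \<open>[a, 2\<^sup>k a]\<close>.\<close>

definition Lip1 :: "real \<Rightarrow> (real \<Rightarrow> real) set" where
  "Lip1 a = {f. (\<forall>x y. \<bar>f x - f y\<bar> \<le> \<bar>x - y\<bar>) \<and> (\<forall>x\<le>a. f x = 0)}"

definition gridpt :: "real \<Rightarrow> nat \<Rightarrow> nat \<Rightarrow> real" where
  "gridpt a l j = a * (1 + 1 / 2 ^ l) ^ j"

definition quant :: "real \<Rightarrow> nat \<Rightarrow> nat \<Rightarrow> (real \<Rightarrow> real) \<Rightarrow> nat \<Rightarrow> int" where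
  "quant a k l f = (\<lambda>j\<in>{..2 ^ l * k}. \<lfloor>2 ^ l * f (gridpt a l j) / gridpt a l j\<rfloor>)"

lemma Lip1_abs_le:
  assumes "f \<in> Lip1 a" "a \<ge> 0" "y \<ge> 0"
  shows "\<bar>f y\<bar> \<le> y"
proof -
  have "f 0 = 0" "\<bar>f y - f 0\<bar> \<le> \<bar>y - 0\<bar>" using assms unfolding Lip1_def by blast+
  then show ?thesis using assms by simp
qed

lemma gridpt_pos: "a > 0 \<Longrightarrow> gridpt a l j > 0"
  by (auto simp: gridpt_def intro!: mult_pos_pos zero_less_power add_pos_pos)

text \<open>By Bernoulli, \<open>2 ^ l\<close> steps of the grid at least double the point, so
  \<open>2 ^ l * k\<close> steps suffice for \<open>k\<close> doublings.\<close>

lemma gridpt_last: 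
  assumes "a > 0"
  shows "2 ^ k * a \<le> gridpt a l (2 ^ l * k)"
proof -
  have "1 + real (2 ^ l) * (1 / 2 ^ l) \<le> (1 + 1 / 2 ^ l :: real) ^ (2 ^ l)"
    by (rule Bernoulli_inequality) (simp add: order_trans[of _ 0])
  then have "(2::real) \<le> (1 + 1 / 2 ^ l) ^ (2 ^ l)" by simp
  then have "(2::real) ^ k \<le> ((1 + 1 / 2 ^ l) ^ (2 ^ l)) ^ k" by (rule power_mono) simp
  then show ?thesis
    unfolding gridpt_def power_mult using assms by (simp add: mult.commute[of a])
qed

text \<open>With the last grid point strictly below \<open>y\<close> as reference there are three
  errors of size \<open>y / 2 ^ l\<close>: moving \<open>f\<close> there, moving \<open>g\<close>
  there, and the common floor of the two ratios. Up to \<open>a\<close>, where no grid point lies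
  below, both functions vanish.\<close>

lemma quant_eq_imp_close:
  assumes a: "a > 0" and f: "f \<in> Lip1 a" and g: "g \<in> Lip1 a"
    and eq: "quant a k l f = quant a k l g" and y: "0 \<le> y" "y \<le> 2 ^ k * a"
  shows "\<bar>f y - g y\<bar> \<le> 3 * y / 2 ^ l"
proof (cases "y \<le> a")
  case True
  then have "f y = 0" "g y = 0" using f g by (auto simp: Lip1_def)
  then show ?thesis using y by simp
next
  case False
  define i where "i = (LEAST i. y \<le> gridpt a l i)"
  have last: "y \<le> gridpt a l (2 ^ l * k)" using gridpt_last[OF a, of k l] y by linarith
  have i: "y \<le> gridpt a l i" unfolding i_def using last by (rule LeastI)
  have i_le: "i \<le> 2 ^ l * k" unfolding i_def using last by (rule Least_le)
  have "i \<noteq> 0" using i False by (auto simp: gridpt_def intro: ccontr)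
  then obtain j where j: "i = Suc j" by (cases i) auto
  have yj: "gridpt a l j < y"
    using not_less_Least[of j "\<lambda>i. y \<le> gridpt a l i"] j by (simp add: i_def)
  have pos: "gridpt a l j > 0" by (rule gridpt_pos[OF a])
  have "gridpt a l (Suc j) = gridpt a l j + gridpt a l j / 2 ^ l"
    by (simp add: gridpt_def field_simps)
  then have d: "\<bar>y - gridpt a l j\<bar> \<le> y / 2 ^ l"
    using i j yj divide_right_mono[of "gridpt a l j" y "2 ^ l"] by simp
  have "quant a k l f j = quant a k l g j" using eq by simp
  then have "\<lfloor>2 ^ l * f (gridpt a l j) / gridpt a l j\<rfloor> = \<lfloor>2 ^ l * g (gridpt a l j) / gridpt a l j\<rfloor>"
    using i_le j by (simp add: quant_def)
  then have "\<bar>2 ^ l * f (gridpt a l j) / gridpt a l j - 2 ^ l * g (gridpt a l j) / gridpt a l j\<bar> < 1"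
    by linarith
  also have "2 ^ l * f (gridpt a l j) / gridpt a l j - 2 ^ l * g (gridpt a l j) / gridpt a l j
      = 2 ^ l * (f (gridpt a l j) - g (gridpt a l j)) / gridpt a l j"
    by (simp add: right_diff_distrib diff_divide_distrib)
  finally have "\<bar>f (gridpt a l j) - g (gridpt a l j)\<bar> * 2 ^ l \<le> gridpt a l j"
    using pos by (simp add: abs_mult mult.commute)
  then have "\<bar>f (gridpt a l j) - g (gridpt a l j)\<bar> \<le> gridpt a l j / 2 ^ l"
    by (simp add: pos_le_divide_eq)
  also have "\<dots> \<le> y / 2 ^ l" using yj by (simp add: divide_right_mono)
  finally have "\<bar>f (gridpt a l j) - g (gridpt a l j)\<bar> \<le> y / 2 ^ l" .
  moreover have "\<bar>f y - f (gridpt a l j)\<bar> \<le> \<bar>y - gridpt a l j\<bar>"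
    "\<bar>g y - g (gridpt a l j)\<bar> \<le> \<bar>y - gridpt a l j\<bar>"
    using f g unfolding Lip1_def by blast+
  moreover have "3 * y / 2 ^ l = y / 2 ^ l + y / 2 ^ l + y / 2 ^ l" by simp
  ultimately show ?thesis using d by linarith
qed

lemma quant_range:
  assumes a: "a > 0" and f: "f \<in> Lip1 a"
  shows "quant a k l f \<in> {..2 ^ l * k} \<rightarrow>\<^sub>E {- (2 ^ l)..2 ^ l}"
proof -
  have "\<lfloor>2 ^ l * f (gridpt a l j) / gridpt a l j\<rfloor> \<in> {- (2 ^ l)..2 ^ l}" for j
  proof -
    define t where "t = f (gridpt a l j) / gridpt a l j"
    have "\<bar>t\<bar> \<le> 1"
      using Lip1_abs_le[OF f, of "gridpt a l j"] a gridpt_pos[OF a, of l j] by (simp add: t_def abs_divide)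
    then have "\<bar>2 ^ l * t\<bar> \<le> 2 ^ l * 1" unfolding abs_mult by (intro mult_mono) auto
    then have "- (2 ^ l) \<le> 2 ^ l * t" "2 ^ l * t \<le> 2 ^ l" by linarith+
    then have "- (2 ^ l) \<le> \<lfloor>2 ^ l * t\<rfloor>" "\<lfloor>2 ^ l * t\<rfloor> \<le> \<lfloor>(2::real) ^ l\<rfloor>"
      by (simp add: le_floor_iff, intro floor_mono)
    moreover have "\<lfloor>(2::real) ^ l\<rfloor> = 2 ^ l"
      by (metis floor_of_int of_int_numeral of_int_power)
    ultimately have "- (2 ^ l) \<le> \<lfloor>2 ^ l * t\<rfloor>" "\<lfloor>2 ^ l * t\<rfloor> \<le> 2 ^ l"
      by simp_all
    then show ?thesis by (simp add: t_def)
  qed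
  then show ?thesis by (auto simp: quant_def)
qed

text \<open>A level has \<open>2 ^ l * k + 1\<close> grid points with at most
  \<open>2 ^ (l + 2)\<close> values each. The factor \<open>2 ^ k\<close> reserves room for the
  sample size, and the power of 4 is the slack granted by \<open>rad_Max_le\<close>, so
  \<open>(l + 3) * 2 ^ l * k\<close> is a valid moment order.\<close>

lemma finite_quant_image:
  assumes "a > 0" "\<Phi> \<subseteq> Lip1 a"
  shows "finite (quant a k l ` \<Phi>)"
    and "k \<ge> 1 \<Longrightarrow> card (quant a k l ` \<Phi>) * 2 ^ k \<le> 4 ^ ((l + 3) * 2 ^ l * k)"
proof -
  let ?P = "{..2 ^ l * k} \<rightarrow>\<^sub>E {- (2 ^ l)..(2 ^ l :: int)}"
  have fP: "finite ?P" by (intro finite_PiE) auto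
  have sub: "quant a k l ` \<Phi> \<subseteq> ?P" using quant_range[OF assms(1)] assms(2) by auto
  then show "finite (quant a k l ` \<Phi>)" using fP finite_subset by blast
  assume k: "k \<ge> 1"
  have "card (quant a k l ` \<Phi>) \<le> card ?P" by (rule card_mono[OF fP sub])
  also have "\<dots> = nat (2 * 2 ^ l + 1) ^ (2 ^ l * k + 1)"
    by (simp add: card_PiE)
  also have "\<dots> \<le> (2 ^ (l + 2)) ^ (2 ^ l * k + 1)"
  proof (rule power_mono)
    have "(1::int) \<le> 2 ^ l" "(2::int) ^ (l + 2) = 4 * 2 ^ l" by (simp_all add: power_add)
    then show "nat (2 * 2 ^ l + 1) \<le> 2 ^ (l + 2)"
      unfolding nat_le_iff of_nat_power of_nat_numeral by linarith
  qed simp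
  finally have "card (quant a k l ` \<Phi>) * 2 ^ k \<le> (2 ^ (l + 2)) ^ (2 ^ l * k + 1) * 2 ^ k"
    by (rule mult_right_mono) simp
  also have "\<dots> = 2 ^ ((l + 2) * (2 ^ l * k + 1) + k)"
    by (simp only: power_mult power_add)
  also have "\<dots> \<le> 2 ^ (2 * ((l + 3) * 2 ^ l * k))"
  proof (rule power_increasing)
    define m where "m = 2 ^ l * k"
    have m: "1 \<le> m" "k \<le> m" using k by (auto simp: m_def)
    have "(l + 2) * (m + 1) + k \<le> (l + 2) * (m + m) + m"
      using m by (intro add_mono mult_mono) auto
    also have "\<dots> \<le> 2 * ((l + 3) * m)" by (simp add: algebra_simps)
    finally show "(l + 2) * (2 ^ l * k + 1) + k \<le> 2 * ((l + 3) * 2 ^ l * k)"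
      by (simp add: m_def mult.assoc)
  qed simp
  also have "\<dots> = 4 ^ ((l + 3) * 2 ^ l * k)" by (simp only: power_mult) simp
  finally show "card (quant a k l ` \<Phi>) * 2 ^ k \<le> 4 ^ ((l + 3) * 2 ^ l * k)" .
qed

text \<open>Spending \<open>(9/8) ^ l\<close> on the linear factor makes the base a perfect square:
  \<open>2 * (9/8)\<close> is the square of 3/2, so the root is explicit and the series
  geometric.\<close>

lemma sqrt_level_weight_le: "sqrt (real (l + 3) * 2 ^ l) / 2 ^ l \<le> 5 * (3 / 4) ^ l"
proof -
  have "1 + real l * (1/8) \<le> (1 + 1/8) ^ l" by (rule Bernoulli_inequality) simp
  then have "real (l + 3) \<le> 25 * (9/8) ^ l" by simp
  then have "real (l + 3) * 2 ^ l \<le> 25 * (9/8) ^ l * 2 ^ l" by (rule mult_right_mono) simp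
  also have "\<dots> = 25 * ((9/8) * 2) ^ l" by (simp only: power_mult_distrib mult.assoc)
  also have "(9/8) * 2 = ((3/2)\<^sup>2 :: real)" by (simp add: power2_eq_square)
  also have "25 * ((3/2)\<^sup>2) ^ l = (5 * (3/2) ^ l :: real)\<^sup>2"
    by (simp add: power_mult_distrib power_mult[symmetric] mult.commute)
  finally have "sqrt (real (l + 3) * 2 ^ l) \<le> 5 * (3/2) ^ l"
    by (simp add: real_le_lsqrt)
  then have "sqrt (real (l + 3) * 2 ^ l) / 2 ^ l \<le> 5 * (3/2) ^ l / 2 ^ l"
    by (rule divide_right_mono) simp
  also have "\<dots> = 5 * (3 / 2 / 2) ^ l" by (simp only: power_divide times_divide_eq_right)
  also have "\<dots> = 5 * (3 / 4) ^ l" by simp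
  finally show ?thesis .
qed

lemma sum_level_weights_le: "(\<Sum>l\<le>L. sqrt (real (l + 3) * 2 ^ l) / 2 ^ l) \<le> 20"
proof -
  have "(\<Sum>l\<le>L. sqrt (real (l + 3) * 2 ^ l) / 2 ^ l) \<le> (\<Sum>l\<le>L. 5 * (3 / 4) ^ l)"
    by (intro sum_mono sqrt_level_weight_le)
  also have "\<dots> = 5 * (\<Sum>l<Suc L. (3 / 4) ^ l)"
    by (simp add: sum_distrib_left lessThan_Suc_atMost)
  also have "\<dots> = 5 * ((1 - (3 / 4) ^ Suc L) / (1 - 3 / 4))"
    by (subst sum_gp_strict) simp
  also have "\<dots> \<le> 20" by simp
  finally show ?thesis .
qed

text \<open>The increments of \<open>(v, f) \<mapsto> f (\<langle>x, v\<rangle>\<^sup>2)\<close> are dominated by those of the Hilbert space valued map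
  with one coordinate \<open>\<langle>x, v\<rangle>\<^sup>2\<close> and, for every level \<open>l\<close> and every quantized function \<open>p\<close> of that level,
  one coordinate \<open>2\<^sup>-\<^sup>l \<langle>x, v\<rangle>\<^sup>2\<close> that is switched on when \<open>f\<close> is quantized to \<open>p\<close>.
  All coordinates are quadratic in \<open>v\<close>.\<close>

definition feature :: "real \<Rightarrow> nat \<Rightarrow> (nat \<times> (nat \<Rightarrow> int)) option \<Rightarrow> (real \<Rightarrow> real) \<Rightarrow> real" where
  "feature a k t f = (case t of None \<Rightarrow> 1
     | Some (l, p) \<Rightarrow> if quant a k l f = p then 1 / 2 ^ l else 0)"

definition features :: "real \<Rightarrow> nat \<Rightarrow> nat \<Rightarrow> (real \<Rightarrow> real) set \<Rightarrow> (nat \<times> (nat \<Rightarrow> int)) option set" where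
  "features a k L \<Phi> = insert None (Some ` (SIGMA l:{..L}. quant a k l ` \<Phi>))"

text \<open>Insert \<open>f t\<close>. The step from \<open>f s\<close> to \<open>f t\<close> is
  paid by the coordinate \<open>None\<close>. For the step from \<open>f t\<close> to
  \<open>g t\<close>, take the first level \<open>l\<close> that separates \<open>f\<close> from
  \<open>g\<close>, which exists by injectivity at level \<open>L\<close>: agreement on the previous
  level makes the step at most \<open>6 * t / 2 ^ l\<close>, and the coordinate of \<open>g\<close>
  on level \<open>l\<close> is on for \<open>g\<close> and off for \<open>f\<close>. The scaling 9
  covers both contributions, as \<open>2 * 6 * 6 = 72\<close> is below 81.\<close>

lemma feature_increments:
  assumes a: "a > 0" and \<Phi>: "\<Phi> \<subseteq> Lip1 a" and inj: "inj_on (quant a k L) \<Phi>"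
    and fg: "f \<in> \<Phi>" "g \<in> \<Phi>" and s: "0 \<le> s" and t: "0 \<le> t" "t \<le> 2 ^ k * a"
  shows "\<bar>f s - g t\<bar> \<le> sqrt (\<Sum>\<kappa>\<in>features a k L \<Phi>. (9 * (feature a k \<kappa> f * s) - 9 * (feature a k \<kappa> g * t))\<^sup>2)"
proof -
  let ?d = "\<lambda>\<kappa>. (9 * (feature a k \<kappa> f * s) - 9 * (feature a k \<kappa> g * t))\<^sup>2"
  have fin: "finite (features a k L \<Phi>)"
    using finite_quant_image(1)[OF a \<Phi>] by (simp add: features_def)
  have sub: "sum ?d A \<le> sum ?d (features a k L \<Phi>)" if "A \<subseteq> features a k L \<Phi>" for A
    using fin that by (intro sum_mono2) auto
  have fst: "\<bar>f s - f t\<bar> \<le> \<bar>s - t\<bar>" using fg \<Phi> by (auto simp: Lip1_def)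
  have "(f s - g t)\<^sup>2 \<le> sum ?d (features a k L \<Phi>)"
  proof (cases "f = g")
    case True
    have "(f s - g t)\<^sup>2 \<le> (s - t)\<^sup>2"
      using fst True by (simp add: abs_le_square_iff)
    also have "\<dots> \<le> 81 * (s - t)\<^sup>2" by simp
    also have "\<dots> = sum ?d {None}"
      by (simp add: feature_def power2_eq_square algebra_simps)
    also have "\<dots> \<le> sum ?d (features a k L \<Phi>)" by (rule sub) (simp add: features_def)
    finally show ?thesis .
  next
    case False
    have ex: "quant a k L f \<noteq> quant a k L g" using False fg inj by (auto simp: inj_on_def)
    define l where "l = (LEAST l. quant a k l f \<noteq> quant a k l g)"
    have l: "quant a k l f \<noteq> quant a k l g" unfolding l_def using ex by (rule LeastI)
    have lL: "l \<le> L" unfolding l_def using ex by (rule Least_le)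
    define c where "c = t / 2 ^ l"
    have fgt: "\<bar>f t - g t\<bar> \<le> 6 * c"
    proof (cases l)
      case 0
      \<comment> \<open>Level 0 has no coarser level of agreement; linear growth gives
        \<open>2 * t\<close> instead.\<close>
      have "\<bar>f t\<bar> \<le> t" "\<bar>g t\<bar> \<le> t" using fg \<Phi> a t Lip1_abs_le by auto
      then show ?thesis using 0 t by (simp add: c_def)
    next
      case (Suc l')
      then have "quant a k l' f = quant a k l' g"
        using not_less_Least[of l' "\<lambda>l. quant a k l f \<noteq> quant a k l g"] by (simp add: l_def)
      then have "\<bar>f t - g t\<bar> \<le> 3 * t / 2 ^ l'"
        using fg \<Phi> t by (intro quant_eq_imp_close[OF a]) auto
      then show ?thesis using Suc by (simp add: c_def)
    qed
    have "\<bar>f s - g t\<bar> \<le> \<bar>s - t\<bar> + 6 * c" using fst fgt by linarith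
    then have "\<bar>f s - g t\<bar>\<^sup>2 \<le> (\<bar>s - t\<bar> + 6 * c)\<^sup>2" by (rule power_mono) simp
    also have "\<dots> \<le> 2 * (s - t)\<^sup>2 + 72 * c\<^sup>2"
      using sum_squares_ge_zero[of 0 "\<bar>s - t\<bar> - 6 * c"] by (simp add: power2_eq_square algebra_simps)
    also have "\<dots> \<le> 81 * (s - t)\<^sup>2 + 81 * c\<^sup>2"
      by (intro add_mono mult_right_mono) auto
    also have "\<dots> = sum ?d {None, Some (l, quant a k l g)}"
      using l by (simp add: feature_def c_def power2_eq_square algebra_simps)
    also have "\<dots> \<le> sum ?d (features a k L \<Phi>)"
      using fg lL by (intro sub) (auto simp: features_def)
    finally show ?thesis by simp
  qed
  then show ?thesis by (simp add: real_le_rsqrt)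
qed

text \<open>A given \<open>f\<close> switches on exactly one quantized function per level, so the
  sum over all features collapses to one term per level and the number of features matters only
  inside maxima.\<close>

lemma sum_features:
  assumes a: "a > 0" and \<Phi>: "\<Phi> \<subseteq> Lip1 a" and f: "f \<in> \<Phi>"
  shows "(\<Sum>\<kappa>\<in>features a k L \<Phi>. feature a k \<kappa> f * G \<kappa>)
    = G None + (\<Sum>l\<le>L. G (Some (l, quant a k l f)) / 2 ^ l)"
proof -
  have fin: "finite (quant a k l ` \<Phi>)" for l by (rule finite_quant_image(1)[OF a \<Phi>])
  have "(\<Sum>\<kappa>\<in>features a k L \<Phi>. feature a k \<kappa> f * G \<kappa>)
    = G None + (\<Sum>\<kappa>\<in>(SIGMA l:{..L}. quant a k l ` \<Phi>). feature a k (Some \<kappa>) f * G (Some \<kappa>))"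
    unfolding features_def using fin
    by (subst sum.insert) (auto simp: sum.reindex feature_def)
  also have "(\<Sum>\<kappa>\<in>(SIGMA l:{..L}. quant a k l ` \<Phi>). feature a k (Some \<kappa>) f * G (Some \<kappa>))
    = (\<Sum>l\<le>L. \<Sum>p\<in>quant a k l ` \<Phi>. feature a k (Some (l, p)) f * G (Some (l, p)))"
    using fin by (subst sum.Sigma) (auto simp: case_prod_beta)
  also have "\<dots> = (\<Sum>l\<le>L. \<Sum>p\<in>quant a k l ` \<Phi>. if quant a k l f = p then G (Some (l, p)) / 2 ^ l else 0)"
    by (intro sum.cong) (auto simp: feature_def)
  also have "\<dots> = (\<Sum>l\<le>L. G (Some (l, quant a k l f)) / 2 ^ l)"
    using fin f by (intro sum.cong refl) (subst sum.delta', auto)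
  finally show ?thesis .
qed

text \<open>Here \<open>18 = 2 * 9\<close> joins the contraction factor to the scaling of the
  features, and \<open>1512 = 18 * 4 * (1 + 20)\<close>, with 1 for the common coordinate and 20 for
  the series of level weights. The moment order is \<open>k\<close> for the former and
  \<open>(l + 3) * 2 ^ l * k\<close> on level \<open>l\<close>.\<close>

theorem rad_Max_Lipschitz_squares_le:
  assumes I: "finite I" and x: "\<And>i. i \<in> I \<Longrightarrow> ip d (x i) (x i) \<le> R" and R: "R > 0"
    and S0: "S > 0" and S: "\<And>w. (\<Sum>i\<in>I. (ip d (x i) w)\<^sup>2) \<le> S * ip d w w"
    and V: "finite V" "V \<noteq> {}" "\<And>v. v \<in> V \<Longrightarrow> enorm2 d v = 1"
    and a: "a > 0" and \<Phi>: "finite \<Phi>" "\<Phi> \<noteq> {}" "\<Phi> \<subseteq> Lip1 a" and inj: "inj_on (quant a k L) \<Phi>"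
    and Ra: "R \<le> 2 ^ k * a" and k: "k \<ge> 1" and card: "card I \<le> 2 ^ k"
  shows "rad I (\<lambda>e. MAX z\<in>V \<times> \<Phi>. \<Sum>i\<in>I. e i * snd z ((ip d (x i) (fst z))\<^sup>2))
     \<le> 1512 * sqrt (2 * real k * R * S)"
proof -
  define T where "T = features a k L \<Phi>"
  have finq: "finite (quant a k l ` \<Phi>)" for l by (rule finite_quant_image(1)[OF a \<Phi>(3)])
  have T: "finite T" using finq by (simp add: T_def features_def)
  define Q where "Q t e = (MAX v\<in>V. \<bar>\<Sum>i\<in>I. e (i, t) * (ip d (x i) v)\<^sup>2\<bar>)"
    for t :: "(nat \<times> (nat \<Rightarrow> int)) option" and e :: "'a \<times> (nat \<times> (nat \<Rightarrow> int)) option \<Rightarrow> real"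
  define K where "K l = (\<lambda>p. Some (l, p)) ` quant a k l ` \<Phi>" for l
  have K: "K l \<subseteq> T" "K l \<noteq> {}" "finite (K l)" if "l \<le> L" for l
    using that \<Phi>(2) finq by (auto simp: K_def T_def features_def)
  have sq: "0 \<le> (ip d (x i) v)\<^sup>2" "(ip d (x i) v)\<^sup>2 \<le> 2 ^ k * a" if "i \<in> I" "v \<in> V" for i v
    using ip_cauchy_schwarz[of d "x i" v] ip_self_eq_1[OF V(3)[OF that(2)]] x[OF that(1)] Ra by auto
  have "rad I (\<lambda>e. MAX z\<in>V \<times> \<Phi>. \<Sum>i\<in>I. e i * snd z ((ip d (x i) (fst z))\<^sup>2))
    \<le> rad (I \<times> T) (\<lambda>e. MAX z\<in>V \<times> \<Phi>. 0 + 2 * (\<Sum>i\<in>I. \<Sum>t\<in>T. e (i, t) * (9 * (feature a k t (snd z) * (ip d (x i) (fst z))\<^sup>2))))"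
  proof -
    have "rad I (\<lambda>e. MAX z\<in>V \<times> \<Phi>. 0 + (\<Sum>i\<in>I. e i * snd z ((ip d (x i) (fst z))\<^sup>2)))
      \<le> rad (I \<times> T) (\<lambda>e. MAX z\<in>V \<times> \<Phi>. 0 + 2 * (\<Sum>i\<in>I. \<Sum>t\<in>T. e (i, t) * (9 * (feature a k t (snd z) * (ip d (x i) (fst z))\<^sup>2))))"
    proof (rule vector_contraction[OF I _ _ T])
      fix i z z' assume z: "i \<in> I" "z \<in> V \<times> \<Phi>" "z' \<in> V \<times> \<Phi>"
      show "\<bar>snd z ((ip d (x i) (fst z))\<^sup>2) - snd z' ((ip d (x i) (fst z'))\<^sup>2)\<bar>
        \<le> sqrt (\<Sum>t\<in>T. (9 * (feature a k t (snd z) * (ip d (x i) (fst z))\<^sup>2)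
            - 9 * (feature a k t (snd z') * (ip d (x i) (fst z'))\<^sup>2))\<^sup>2)"
        unfolding T_def using z sq by (intro feature_increments[OF a \<Phi>(3) inj]) auto
    qed (use V \<Phi> in auto)
    then show ?thesis by simp
  qed
  also have "\<dots> \<le> rad (I \<times> T) (\<lambda>e. 18 * ((MAX t\<in>{None}. Q t e) + (\<Sum>l\<le>L. (1 / 2 ^ l) * (MAX t\<in>K l. Q t e))))"
  proof (rule rad_mono, rule Max.boundedI)
    fix e y
    assume "y \<in> (\<lambda>z. 0 + 2 * (\<Sum>i\<in>I. \<Sum>t\<in>T. e (i, t) * (9 * (feature a k t (snd z) * (ip d (x i) (fst z))\<^sup>2)))) ` (V \<times> \<Phi>)"
    then obtain v f where z: "v \<in> V" "f \<in> \<Phi>"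
      and y: "y = 2 * (\<Sum>i\<in>I. \<Sum>t\<in>T. e (i, t) * (9 * (feature a k t f * (ip d (x i) v)\<^sup>2)))"
      by auto
    define G where "G t = (\<Sum>i\<in>I. e (i, t) * (ip d (x i) v)\<^sup>2)" for t
    have GQ: "G t \<le> Q t e" for t
    proof -
      have "\<bar>G t\<bar> \<le> Q t e" unfolding G_def Q_def using V z by (intro Max_ge) auto
      then show ?thesis by linarith
    qed
    have "y = 18 * (\<Sum>t\<in>T. feature a k t f * G t)"
      unfolding y G_def sum_distrib_left by (subst sum.swap) (simp add: mult_ac)
    also have "\<dots> = 18 * (G None + (\<Sum>l\<le>L. G (Some (l, quant a k l f)) / 2 ^ l))"
      unfolding T_def by (subst sum_features[OF a \<Phi>(3) z(2)]) simp
    also have "\<dots> \<le> 18 * ((MAX t\<in>{None}. Q t e) + (\<Sum>l\<le>L. (1 / 2 ^ l) * (MAX t\<in>K l. Q t e)))"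
    proof (intro mult_left_mono add_mono sum_mono)
      fix l assume "l \<in> {..L}"
      then have "Q (Some (l, quant a k l f)) e \<le> (MAX t\<in>K l. Q t e)"
        using K z by (intro Max_ge) (auto simp: K_def)
      then have "G (Some (l, quant a k l f)) \<le> (MAX t\<in>K l. Q t e)"
        using GQ order_trans by blast
      then show "G (Some (l, quant a k l f)) / 2 ^ l \<le> 1 / 2 ^ l * (MAX t\<in>K l. Q t e)"
        by (simp add: divide_right_mono)
    qed (use GQ in auto)
    finally show "y \<le> 18 * ((MAX t\<in>{None}. Q t e) + (\<Sum>l\<le>L. (1 / 2 ^ l) * (MAX t\<in>K l. Q t e)))" .
  qed (use V \<Phi> in auto)
  also have "\<dots> = 18 * (rad (I \<times> T) (\<lambda>e. MAX t\<in>{None}. Q t e)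
      + (\<Sum>l\<le>L. (1 / 2 ^ l) * rad (I \<times> T) (\<lambda>e. MAX t\<in>K l. Q t e)))"
    unfolding rad_cmult rad_add rad_sum ..
  also have "\<dots> \<le> 18 * (4 * sqrt (2 * real k * R * S)
      + (\<Sum>l\<le>L. (1 / 2 ^ l) * (4 * sqrt (2 * real ((l + 3) * 2 ^ l * k) * R * S))))"
  proof (intro mult_left_mono add_mono sum_mono)
    have "card {None :: (nat \<times> (nat \<Rightarrow> int)) option} * card I \<le> 4 ^ k"
      using card power_mono[of 2 "4::nat" k] by simp
    then show "rad (I \<times> T) (\<lambda>e. MAX t\<in>{None}. Q t e) \<le> 4 * sqrt (2 * real k * R * S)"
      unfolding Q_def
      by (intro rad_Max_quadratic_forms_le I x R S0 S V T k) (auto simp: T_def features_def)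
  next
    fix l assume l: "l \<in> {..L}"
    have "card (K l) * card I \<le> card (quant a k l ` \<Phi>) * 2 ^ k"
      unfolding K_def using card by (intro mult_mono card_image_le finq) auto
    also have "\<dots> \<le> 4 ^ ((l + 3) * 2 ^ l * k)"
      by (rule finite_quant_image(2)[OF a \<Phi>(3) k])
    finally show "rad (I \<times> T) (\<lambda>e. MAX t\<in>K l. Q t e) \<le> 4 * sqrt (2 * real ((l + 3) * 2 ^ l * k) * R * S)"
      unfolding Q_def using K l k
      by (intro rad_Max_quadratic_forms_le I x R S0 S V T) auto
  qed auto
  also have "\<dots> = 18 * (4 * sqrt (2 * real k * R * S) * (1 + (\<Sum>l\<le>L. sqrt (real (l + 3) * 2 ^ l) / 2 ^ l)))"
  proof -
    have "2 * real ((l + 3) * 2 ^ l * k) * R * S = (2 * real k * R * S) * (real (l + 3) * 2 ^ l)" for l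
      by (simp only: of_nat_mult of_nat_power of_nat_numeral mult_ac)
    then have "sqrt (2 * real ((l + 3) * 2 ^ l * k) * R * S) = sqrt (2 * real k * R * S) * sqrt (real (l + 3) * 2 ^ l)" for l
      by (simp only: real_sqrt_mult)
    then show ?thesis
      by (simp add: sum_distrib_left distrib_left mult_ac del: of_nat_add of_nat_mult)
  qed
  also have "\<dots> \<le> 18 * (4 * sqrt (2 * real k * R * S) * (1 + 20))"
    using R S0 by (intro mult_left_mono add_left_mono sum_level_weights_le) auto
  finally show ?thesis by simp
qed

section \<open>Symmetrization\<close>

text \<open>Bounded at every point and not just almost everywhere, so that compositions with
  measurable maps, such as fixing some sample points and varying one, remain integrable.\<close>

definition bounded_measurable :: "'a measure \<Rightarrow> ('a \<Rightarrow> real) \<Rightarrow> bool" where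
  "bounded_measurable M f \<longleftrightarrow> f \<in> borel_measurable M \<and> (\<exists>C. \<forall>x\<in>space M. \<bar>f x\<bar> \<le> C)"

lemma bounded_measurableI:
  "f \<in> borel_measurable M \<Longrightarrow> (\<And>x. x \<in> space M \<Longrightarrow> \<bar>f x\<bar> \<le> C) \<Longrightarrow> bounded_measurable M f"
  by (auto simp: bounded_measurable_def)

lemma bounded_measurable_const: "bounded_measurable M (\<lambda>_. c)"
  by (rule bounded_measurableI[where C="\<bar>c\<bar>"]) auto

lemma bounded_measurable_add:
  assumes "bounded_measurable M f" "bounded_measurable M g"
  shows "bounded_measurable M (\<lambda>x. f x + g x)"
proof -
  obtain C D where "\<forall>x\<in>space M. \<bar>f x\<bar> \<le> C" "\<forall>x\<in>space M. \<bar>g x\<bar> \<le> D"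
    using assms by (auto simp: bounded_measurable_def)
  then have "\<bar>f x + g x\<bar> \<le> C + D" if "x \<in> space M" for x
    using that abs_triangle_ineq[of "f x" "g x"] by fastforce
  then show ?thesis
    using assms by (intro bounded_measurableI) (auto simp: bounded_measurable_def)
qed

lemma bounded_measurable_cmult:
  assumes "bounded_measurable M f"
  shows "bounded_measurable M (\<lambda>x. c * f x)"
proof -
  obtain C where "\<forall>x\<in>space M. \<bar>f x\<bar> \<le> C" using assms by (auto simp: bounded_measurable_def)
  then have "\<bar>c * f x\<bar> \<le> \<bar>c\<bar> * C" if "x \<in> space M" for x
    using that by (auto simp: abs_mult intro: mult_left_mono)
  then show ?thesis
    using assms by (intro bounded_measurableI) (auto simp: bounded_measurable_def)
qed

lemma bounded_measurable_diff:
  "bounded_measurable M f \<Longrightarrow> bounded_measurable M g \<Longrightarrow> bounded_measurable M (\<lambda>x. f x - g x)"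
  using bounded_measurable_add[OF _ bounded_measurable_cmult[of M g "-1"], of f] by simp

lemma bounded_measurable_sum:
  assumes "\<And>i. i \<in> I \<Longrightarrow> bounded_measurable M (f i)"
  shows "bounded_measurable M (\<lambda>x. \<Sum>i\<in>I. f i x)"
  using assms
  by (induction I rule: infinite_finite_induct)
    (auto intro: bounded_measurable_const bounded_measurable_add)

lemma bounded_measurable_Max:
  assumes Z: "finite Z" "Z \<noteq> {}" and f: "\<And>z. z \<in> Z \<Longrightarrow> bounded_measurable M (f z)"
  shows "bounded_measurable M (\<lambda>x. MAX z\<in>Z. f z x)"
proof -
  have "\<forall>z\<in>Z. \<exists>C. \<forall>x\<in>space M. \<bar>f z x\<bar> \<le> C" using f by (auto simp: bounded_measurable_def)
  then obtain C where C: "\<And>z x. z \<in> Z \<Longrightarrow> x \<in> space M \<Longrightarrow> \<bar>f z x\<bar> \<le> C z"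
    by metis
  show ?thesis
  proof (rule bounded_measurableI)
    show "(\<lambda>x. MAX z\<in>Z. f z x) \<in> borel_measurable M"
      using Z f by (intro borel_measurable_Max) (auto simp: bounded_measurable_def)
    fix x assume x: "x \<in> space M"
    have "(MAX z\<in>Z. f z x) \<in> (\<lambda>z. f z x) ` Z" using Z by (intro Max_in) auto
    then obtain z where z: "z \<in> Z" "(MAX z\<in>Z. f z x) = f z x" by auto
    have "C z' \<ge> 0" if "z' \<in> Z" for z' using C[OF that x] by linarith
    then have "C z \<le> (\<Sum>z\<in>Z. C z)" using Z(1) z(1) by (intro member_le_sum) auto
    then show "\<bar>MAX z\<in>Z. f z x\<bar> \<le> (\<Sum>z\<in>Z. C z)" using C[OF z(1) x] z(2) by linarith
  qed
qed

lemma bounded_measurable_rad: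
  assumes "\<And>e. bounded_measurable M (\<lambda>x. F x e)"
  shows "bounded_measurable M (\<lambda>x. rad J (F x))"
proof -
  have "bounded_measurable M (\<lambda>x. (1 / 2 ^ card J) * (\<Sum>S\<in>Pow J. F x (\<lambda>j. if j \<in> S then 1 else -1)))"
    by (intro bounded_measurable_cmult bounded_measurable_sum assms)
  then show ?thesis by (simp add: rad_def)
qed

lemma bounded_measurable_compose:
  assumes f: "bounded_measurable N f" and g: "g \<in> measurable M N"
  shows "bounded_measurable M (\<lambda>x. f (g x))"
proof -
  obtain C where C: "\<forall>x\<in>space N. \<bar>f x\<bar> \<le> C" and m: "f \<in> borel_measurable N"
    using f by (auto simp: bounded_measurable_def)
  show ?thesis
    using C measurable_space[OF g]
    by (intro bounded_measurableI[where C=C] measurable_compose[OF g m]) auto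
qed

lemma (in prob_space) bounded_measurable_integrable: "bounded_measurable M f \<Longrightarrow> integrable M f"
  unfolding bounded_measurable_def by (metis AE_I2 integrable_const_bound real_norm_def)

lemmas bounded_measurable_intros =
  bounded_measurable_const bounded_measurable_add bounded_measurable_cmult bounded_measurable_diff
  bounded_measurable_sum bounded_measurable_Max bounded_measurable_rad

lemma integral_rad:
  assumes "\<And>e. integrable M (\<lambda>x. F x e)"
  shows "(\<integral>x. rad J (F x) \<partial>M) = rad J (\<lambda>e. \<integral>x. F x e \<partial>M)"
  unfolding rad_def using assms by simp

section \<open>Exchanging one sample point for a random sign\<close>

lemma integral_PiM_insert_swap:
  assumes M: "prob_space M" and f: "bounded_measurable (PiM (insert i I) (\<lambda>_. M)) f"
  shows "integrable M (\<lambda>x. \<integral>X. f (X(i := x)) \<partial>PiM I (\<lambda>_. M))"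
    and "integrable (PiM I (\<lambda>_. M)) (\<lambda>X. \<integral>x. f (X(i := x)) \<partial>M)"
    and "(\<integral>X. f X \<partial>PiM (insert i I) (\<lambda>_. M)) = (\<integral>x. \<integral>X. f (X(i := x)) \<partial>PiM I (\<lambda>_. M) \<partial>M)"
    and "(\<integral>X. f X \<partial>PiM (insert i I) (\<lambda>_. M)) = (\<integral>X. \<integral>x. f (X(i := x)) \<partial>M \<partial>PiM I (\<lambda>_. M))"
proof -
  interpret M: prob_space M by fact
  interpret P: prob_space "PiM I (\<lambda>_. M)" by (intro prob_space_PiM M)
  interpret pair: pair_prob_space M "PiM I (\<lambda>_. M)" ..
  have upd: "(\<lambda>(x, X). X(i := x)) \<in> measurable (M \<Otimes>\<^sub>M PiM I (\<lambda>_. M)) (PiM (insert i I) (\<lambda>_. M))"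
    by measurable
  have int: "integrable (M \<Otimes>\<^sub>M PiM I (\<lambda>_. M)) (\<lambda>(x, X). f (X(i := x)))"
    using bounded_measurable_compose[OF f upd]
    by (intro pair.bounded_measurable_integrable) (simp add: case_prod_unfold)
  show "integrable M (\<lambda>x. \<integral>X. f (X(i := x)) \<partial>PiM I (\<lambda>_. M))"
    using pair.integrable_fst[OF int] by simp
  show "integrable (PiM I (\<lambda>_. M)) (\<lambda>X. \<integral>x. f (X(i := x)) \<partial>M)"
    using pair.integrable_snd[OF int] by simp
  have "(\<integral>X. f X \<partial>PiM (insert i I) (\<lambda>_. M))
      = (\<integral>X. f X \<partial>distr (M \<Otimes>\<^sub>M PiM I (\<lambda>_. M)) (PiM (insert i I) (\<lambda>_. M)) (\<lambda>(x, X). X(i := x)))"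
    using distr_pair_PiM_eq_PiM[of I "\<lambda>_. M" i] M by simp
  also have "\<dots> = (\<integral>p. (case p of (x, X) \<Rightarrow> f (X(i := x))) \<partial>(M \<Otimes>\<^sub>M PiM I (\<lambda>_. M)))"
    using f upd by (subst integral_distr) (auto simp: bounded_measurable_def case_prod_unfold)
  finally have eq: "(\<integral>X. f X \<partial>PiM (insert i I) (\<lambda>_. M))
      = (\<integral>p. (case p of (x, X) \<Rightarrow> f (X(i := x))) \<partial>(M \<Otimes>\<^sub>M PiM I (\<lambda>_. M)))" .
  show "(\<integral>X. f X \<partial>PiM (insert i I) (\<lambda>_. M)) = (\<integral>x. \<integral>X. f (X(i := x)) \<partial>PiM I (\<lambda>_. M) \<partial>M)"
    unfolding eq using pair.integral_fst[OF int] by simp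
  show "(\<integral>X. f X \<partial>PiM (insert i I) (\<lambda>_. M)) = (\<integral>X. \<integral>x. f (X(i := x)) \<partial>M \<partial>PiM I (\<lambda>_. M))"
    unfolding eq using pair.integral_snd[OF int] by simp
qed

text \<open>Each member of the maximum is the average of \<open>B z\<close> plus twice the mean of
  \<open>h z\<close> and of \<open>B z - 2 * h z x\<close>. The maximum splits along the two halves,
  Jensen pulls the mean out of the first, and the result is an average over one sign.\<close>

lemma symmetrization_step:
  assumes M: "prob_space M" and Z: "finite Z" "Z \<noteq> {}" and h: "\<And>z. z \<in> Z \<Longrightarrow> bounded_measurable M (h z)"
  shows "(\<integral>x. (MAX z\<in>Z. B z + ((\<integral>y. h z y \<partial>M) - h z x)) \<partial>M)
    \<le> (\<integral>x. ((MAX z\<in>Z. B z + 2 * h z x) + (MAX z\<in>Z. B z - 2 * h z x)) / 2 \<partial>M)"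
proof -
  interpret M: prob_space M by fact
  define a where "a x = (MAX z\<in>Z. B z + 2 * h z x)" for x
  define b where "b x = (MAX z\<in>Z. B z - 2 * h z x)" for x
  have ab: "bounded_measurable M a" "bounded_measurable M b"
    unfolding a_def b_def by (intro bounded_measurable_intros Z h; assumption)+
  note iab = ab[THEN M.bounded_measurable_integrable]
  have pt: "(MAX z\<in>Z. B z + ((\<integral>y. h z y \<partial>M) - h z x)) \<le> (\<integral>y. a y \<partial>M) / 2 + b x / 2" for x
  proof (rule Max.boundedI)
    fix t assume "t \<in> (\<lambda>z. B z + ((\<integral>y. h z y \<partial>M) - h z x)) ` Z"
    then obtain z where z: "z \<in> Z" "t = B z + ((\<integral>y. h z y \<partial>M) - h z x)" by auto
    have ih: "integrable M (h z)" using h[OF z(1)] by (rule M.bounded_measurable_integrable)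
    have "B z + 2 * h z y \<le> a y" for y
      unfolding a_def using Z z by (intro Max_ge) auto
    then have "(\<integral>y. B z + 2 * h z y \<partial>M) \<le> (\<integral>y. a y \<partial>M)"
      using ih iab by (intro integral_mono) auto
    then have 1: "B z + 2 * (\<integral>y. h z y \<partial>M) \<le> (\<integral>y. a y \<partial>M)"
      using ih by (simp add: M.prob_space)
    have 2: "B z - 2 * h z x \<le> b x"
      unfolding b_def using Z z by (intro Max_ge) auto
    show "t \<le> (\<integral>y. a y \<partial>M) / 2 + b x / 2"
      using 1 2 z(2) by argo
  qed (use Z in auto)
  have "bounded_measurable M (\<lambda>x. MAX z\<in>Z. B z + ((\<integral>y. h z y \<partial>M) - h z x))"
    by (intro bounded_measurable_intros Z h; assumption)
  then have "(\<integral>x. (MAX z\<in>Z. B z + ((\<integral>y. h z y \<partial>M) - h z x)) \<partial>M) \<le> (\<integral>x. (\<integral>y. a y \<partial>M) / 2 + b x / 2 \<partial>M)"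
    using pt iab M.bounded_measurable_integrable by (intro integral_mono) auto
  also have "\<dots> = (\<integral>x. (a x + b x) / 2 \<partial>M)"
    using iab by (simp add: M.prob_space add_divide_distrib)
  finally show ?thesis by (simp add: a_def b_def)
qed

text \<open>One point at a time, with Fubini used in both orders. While the new point is fixed, its
  term is absorbed into \<open>A\<close> and the induction hypothesis treats the others; then the
  other points and their signs are fixed and the new point is treated.\<close>

theorem symmetrization:
  assumes M: "prob_space M" and Z: "finite Z" "Z \<noteq> {}" and h: "\<And>z. z \<in> Z \<Longrightarrow> bounded_measurable M (h z)"
    and I: "finite (I :: 'c set)"
  shows "(\<integral>X. (MAX z\<in>Z. A z + (\<Sum>i\<in>I. (\<integral>y. h z y \<partial>M) - h z (X i))) \<partial>PiM I (\<lambda>_. M))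
    \<le> (\<integral>X. rad I (\<lambda>e. MAX z\<in>Z. A z + (\<Sum>i\<in>I. e i * (2 * h z (X i)))) \<partial>PiM I (\<lambda>_. M))"
  using I
proof (induction I arbitrary: A rule: finite_induct)
  case empty
  then show ?case by (simp add: rad_empty)
next
  case (insert i I)
  let ?P = "PiM I (\<lambda>_. M)" and ?Q = "PiM (insert i I) (\<lambda>_. M)"
  interpret M: prob_space M by fact
  interpret P: prob_space ?P by (intro prob_space_PiM M)
  let ?m = "\<lambda>z. \<integral>y. h z y \<partial>M"
  have hX: "bounded_measurable (PiM J (\<lambda>_. M)) (\<lambda>X. h z (X j))" if "z \<in> Z" "j \<in> J" for z j and J :: "'c set"
    by (rule bounded_measurable_compose[OF h[OF that(1)] measurable_component_singleton[OF that(2)]])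
  have upd: "(\<Sum>j\<in>I. c j * h z ((X(i := x)) j)) = (\<Sum>j\<in>I. c j * h z (X j))" for X x z c
    using insert.hyps by (intro sum.cong) auto
  define B where "B X e z = A z + (\<Sum>j\<in>I. e j * (2 * h z (X j)))" for X e z
  define F where "F X = (MAX z\<in>Z. A z + (\<Sum>j\<in>insert i I. ?m z - h z (X j)))" for X
  define G where "G X e = (MAX z\<in>Z. B X e z + (?m z - h z (X i)))" for X e
  define H where "H X = rad (insert i I) (\<lambda>e. MAX z\<in>Z. A z + (\<Sum>j\<in>insert i I. e j * (2 * h z (X j))))" for X
  have B_upd: "B (X(i := x)) e z = B X e z" for X x e z
    unfolding B_def using upd[of "\<lambda>j. e j * 2" z X x] by (simp add: mult.assoc)
  have bF: "bounded_measurable ?Q F"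
    unfolding F_def by (intro bounded_measurable_intros Z hX; simp)
  have bG: "bounded_measurable ?Q (\<lambda>X. rad I (G X))"
    unfolding G_def B_def by (intro bounded_measurable_intros Z hX; simp)
  have bH: "bounded_measurable ?Q H"
    unfolding H_def by (intro bounded_measurable_intros Z hX; simp)
  have F_upd: "F (X(i := x)) = (MAX z\<in>Z. (A z + (?m z - h z x)) + (\<Sum>j\<in>I. ?m z - h z (X j)))" for X x
  proof -
    have "(\<Sum>j\<in>I. ?m z - h z ((X(i := x)) j)) = (\<Sum>j\<in>I. ?m z - h z (X j))" for z
      using insert.hyps by (intro sum.cong) auto
    then show ?thesis
      unfolding F_def sum.insert[OF insert.hyps] fun_upd_same by (simp only: add.assoc)
  qed
  have G_upd: "G (X(i := x)) = (\<lambda>e. MAX z\<in>Z. B X e z + (?m z - h z x))" for X x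
    by (rule ext) (simp only: G_def B_upd fun_upd_apply refl if_True)
  have H_upd: "H (X(i := x)) = rad I (\<lambda>e. ((MAX z\<in>Z. B X e z + 2 * h z x) + (MAX z\<in>Z. B X e z - 2 * h z x)) / 2)" for X x
  proof -
    have "A z + (\<Sum>j\<in>insert i I. (e(i := a)) j * (2 * h z ((X(i := x)) j))) = B X e z + a * (2 * h z x)" for e a z
      using insert.hyps B_upd[of X x e z] sum_upd[OF insert.hyps(2), of e a "\<lambda>j. 2 * h z ((X(i := x)) j)"]
      by (simp add: B_def del: fun_upd_apply add: fun_upd_same)
    then show ?thesis
      unfolding H_def rad_insert[OF insert.hyps] by simp
  qed
  have "(\<integral>X. F X \<partial>?Q) = (\<integral>x. \<integral>X. F (X(i := x)) \<partial>?P \<partial>M)"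
    by (rule integral_PiM_insert_swap(3)[OF M bF])
  also have "\<dots> \<le> (\<integral>x. \<integral>X. rad I (G (X(i := x))) \<partial>?P \<partial>M)"
  proof (rule integral_mono[OF integral_PiM_insert_swap(1)[OF M bF] integral_PiM_insert_swap(1)[OF M bG]])
    fix x
    have "rad I (G (X(i := x))) = rad I (\<lambda>e. MAX z\<in>Z. (A z + (?m z - h z x)) + (\<Sum>j\<in>I. e j * (2 * h z (X j))))" for X
      unfolding G_upd B_def by (simp only: add_ac)
    then show "(\<integral>X. F (X(i := x)) \<partial>?P) \<le> (\<integral>X. rad I (G (X(i := x))) \<partial>?P)"
      unfolding F_upd using insert.IH by simp
  qed
  also have "\<dots> = (\<integral>X. \<integral>x. rad I (G (X(i := x))) \<partial>M \<partial>?P)"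
    using integral_PiM_insert_swap(3,4)[OF M bG] by simp
  also have "\<dots> \<le> (\<integral>X. \<integral>x. H (X(i := x)) \<partial>M \<partial>?P)"
  proof (rule integral_mono[OF integral_PiM_insert_swap(2)[OF M bG] integral_PiM_insert_swap(2)[OF M bH]])
    fix X
    have int: "integrable M (\<lambda>x. MAX z\<in>Z. B X e z + (?m z - h z x))"
      "integrable M (\<lambda>x. ((MAX z\<in>Z. B X e z + 2 * h z x) + (MAX z\<in>Z. B X e z - 2 * h z x)) / 2)" for e
    proof -
      show "integrable M (\<lambda>x. MAX z\<in>Z. B X e z + (?m z - h z x))"
        by (intro M.bounded_measurable_integrable bounded_measurable_intros Z h; assumption)
      have "integrable M (\<lambda>x. MAX z\<in>Z. B X e z + 2 * h z x)" "integrable M (\<lambda>x. MAX z\<in>Z. B X e z - 2 * h z x)"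
        by (intro M.bounded_measurable_integrable bounded_measurable_intros Z h; assumption)+
      then show "integrable M (\<lambda>x. ((MAX z\<in>Z. B X e z + 2 * h z x) + (MAX z\<in>Z. B X e z - 2 * h z x)) / 2)"
        by simp
    qed
    have "(\<integral>x. rad I (G (X(i := x))) \<partial>M) = rad I (\<lambda>e. \<integral>x. (MAX z\<in>Z. B X e z + (?m z - h z x)) \<partial>M)"
      unfolding G_upd by (rule integral_rad[OF int(1)])
    also have "\<dots> \<le> rad I (\<lambda>e. \<integral>x. ((MAX z\<in>Z. B X e z + 2 * h z x) + (MAX z\<in>Z. B X e z - 2 * h z x)) / 2 \<partial>M)"
      by (intro rad_mono symmetrization_step[OF M Z h])
    also have "\<dots> = (\<integral>x. H (X(i := x)) \<partial>M)"
      unfolding H_upd by (rule integral_rad[OF int(2), symmetric])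
    finally show "(\<integral>x. rad I (G (X(i := x))) \<partial>M) \<le> (\<integral>x. H (X(i := x)) \<partial>M)" .
  qed
  also have "\<dots> = (\<integral>X. H X \<partial>?Q)"
    by (rule integral_PiM_insert_swap(4)[OF M bH, symmetric])
  finally show ?case by (simp only: F_def H_def)
qed

section \<open>Couplings of one-dimensional projections\<close>

definition signed_square :: "real \<Rightarrow> real" where "signed_square x = x * \<bar>x\<bar>"

definition signed_sqrt :: "real \<Rightarrow> real" where "signed_sqrt y = sgn y * sqrt \<bar>y\<bar>"

lemma signed_sqrt_signed_square: "signed_sqrt (signed_square x) = x"
  by (cases x "0::real" rule: linorder_cases)
    (auto simp: signed_sqrt_def signed_square_def sgn_mult abs_mult)

lemma signed_square_signed_sqrt: "signed_square (signed_sqrt x) = x"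
  by (auto simp: signed_sqrt_def signed_square_def sgn_if abs_mult)

lemma signed_square_measurable [measurable]: "signed_square \<in> borel_measurable borel"
  unfolding signed_square_def by measurable

lemma signed_sqrt_measurable [measurable]: "signed_sqrt \<in> borel_measurable borel"
  unfolding signed_sqrt_def by measurable

text \<open>For equal signs \<open>\<bar>x - y\<bar> \<le> \<bar>x + y\<bar>\<close> suffices, even
  with factor 1. For opposite signs the signed squares are \<open>x * x + y * y\<close> apart; the
  factor 2 is attained at \<open>y = - x\<close>.\<close>

lemma square_diff_le_signed_square: "(x - y)\<^sup>2 \<le> 2 * \<bar>signed_square x - signed_square y\<bar>"
proof -
  have same: "(x - y)\<^sup>2 \<le> 2 * \<bar>x * x - y * y\<bar>" if "0 \<le> x" "0 \<le> y" for x y :: real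
  proof -
    have "(x - y)\<^sup>2 = \<bar>x - y\<bar> * \<bar>x - y\<bar>" by (simp add: power2_eq_square)
    also have "\<dots> \<le> \<bar>x - y\<bar> * \<bar>x + y\<bar>" using that by (intro mult_left_mono) auto
    also have "\<dots> = \<bar>x * x - y * y\<bar>" by (simp add: abs_mult[symmetric] algebra_simps)
    also have "\<dots> \<le> 2 * \<bar>x * x - y * y\<bar>" by simp
    finally show ?thesis .
  qed
  have opp: "(x - y)\<^sup>2 \<le> 2 * (x * x + y * y)" for x y :: real
    using zero_le_power2[of "x + y"] by (simp add: power2_eq_square algebra_simps)
  show ?thesis
  proof (cases "x \<ge> 0"; cases "y \<ge> 0")
    assume "x \<ge> 0" "y \<ge> 0"
    then show ?thesis using same[of x y] by (simp add: signed_square_def)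
  next
    assume "x \<ge> 0" "\<not> y \<ge> 0"
    then show ?thesis using opp[of x y] by (simp add: signed_square_def)
  next
    assume a: "\<not> x \<ge> 0" "y \<ge> 0"
    have "\<bar>- (x * x) - y * y\<bar> = x * x + y * y" by (simp add: abs_if) (smt (verit) zero_le_square)
    then show ?thesis using a opp[of x y] by (simp add: signed_square_def)
  next
    assume a: "\<not> x \<ge> 0" "\<not> y \<ge> 0"
    have "\<bar>- (x * x) - - (y * y)\<bar> = \<bar>(- x) * (- x) - (- y) * (- y)\<bar>" by simp
    then show ?thesis using a same[of "- x" "- y"] by (simp add: signed_square_def power2_commute)
  qed
qed

text \<open>The signed integral of \<open>g\<close> from 0 to \<open>y\<close>, in one formula for
  both signs of \<open>y\<close>, so that differences follow from linearity of the integral.\<close>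

definition primitive :: "(real \<Rightarrow> real) \<Rightarrow> real \<Rightarrow> real" where
  "primitive g y = (\<integral>s. g s * (indicator {0..<y} s - indicator {y..<0} s) \<partial>(lborel :: real measure))"

lemma primitive_diff:
  assumes g: "g \<in> borel_measurable borel" "\<And>s. \<bar>g s\<bar> \<le> 1" and "b \<le> a"
  shows "primitive g a - primitive g b = (\<integral>s. g s * indicator {b..<a} s \<partial>(lborel :: real measure))"
proof -
  have int: "integrable lborel (\<lambda>s. g s * indicator {x..<y} s)" for x y
  proof (rule Bochner_Integration.integrable_bound)
    show "integrable lborel (indicator {x..<y} :: real \<Rightarrow> real)"
      by (cases "x \<le> y") (auto intro!: integrable_real_indicator)
    show "(\<lambda>s. g s * indicator {x..<y} s) \<in> borel_measurable lborel"
      using g(1) by simp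
    show "AE s in lborel. norm (g s * indicator {x..<y} s) \<le> norm (indicator {x..<y} s :: real)"
      using g(2) by (intro AE_I2) (simp add: indicator_def)
  qed
  have "primitive g a - primitive g b
    = (\<integral>s. (g s * indicator {0..<a} s - g s * indicator {a..<0} s) - (g s * indicator {0..<b} s - g s * indicator {b..<0} s) \<partial>(lborel :: real measure))"
    unfolding primitive_def right_diff_distrib using int by simp
  also have "\<dots> = (\<integral>s. g s * indicator {b..<a} s \<partial>(lborel :: real measure))"
    using assms(3) by (intro Bochner_Integration.integral_cong) (auto split: split_indicator)
  finally show ?thesis .
qed

lemma primitive_const_on:
  assumes g: "g \<in> borel_measurable borel" "\<And>s. \<bar>g s\<bar> \<le> 1" and ab: "b \<le> a"
    and c: "\<And>s. b \<le> s \<Longrightarrow> s < a \<Longrightarrow> g s = c"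
  shows "primitive g a - primitive g b = c * (a - b)"
proof -
  have "primitive g a - primitive g b = (\<integral>s. c * indicator {b..<a} s \<partial>(lborel :: real measure))"
    unfolding primitive_diff[OF g ab]
    using c by (intro Bochner_Integration.integral_cong) (auto split: split_indicator)
  then show ?thesis using ab by simp
qed

lemma primitive_Lipschitz:
  assumes g: "g \<in> borel_measurable borel" "\<And>s. \<bar>g s\<bar> \<le> 1"
  shows "\<bar>primitive g x - primitive g y\<bar> \<le> \<bar>x - y\<bar>"
proof -
  have *: "\<bar>primitive g a - primitive g b\<bar> \<le> a - b" if "b \<le> a" for a b
  proof -
    have ind: "integrable lborel (indicator {b..<a} :: real \<Rightarrow> real)"
      using that by (intro integrable_real_indicator) auto
    have "norm (\<integral>s. g s * indicator {b..<a} s \<partial>(lborel :: real measure)) \<le> (\<integral>s. indicator {b..<a} s \<partial>(lborel :: real measure))"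
      using g by (intro Bochner_Integration.integral_norm_bound_integral ind Bochner_Integration.integrable_bound[OF ind])
        (auto split: split_indicator)
    then show ?thesis unfolding primitive_diff[OF g that] using that by simp
  qed
  show ?thesis using *[of x y] *[of y x] by linarith
qed

lemma Lipschitz_measurable:
  fixes f :: "real \<Rightarrow> real"
  assumes "\<And>x y. \<bar>f x - f y\<bar> \<le> \<bar>x - y\<bar>"
  shows "f \<in> borel_measurable borel"
proof -
  have "1-lipschitz_on UNIV f"
    using assms by (auto simp: lipschitz_on_def dist_real_def)
  then have "continuous_on UNIV f" by (rule lipschitz_on_continuous_on)
  then show ?thesis by (rule borel_measurable_continuous_onI)
qed

text \<open>The quantile coupling is comonotone, so a single Lipschitz function, with slope
  \<open>sgn (F\<^sub>2 - F\<^sub>1)\<close>, satisfies \<open>f (I\<^sub>1 u) - f (I\<^sub>2 u) = |I\<^sub>1 u - I\<^sub>2 u|\<close> for the quantile functions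
  \<open>I\<^sub>1, I\<^sub>2\<close> at every \<open>u\<close>.\<close>

lemma quantile_coupling:
  assumes N: "real_distribution N1" "real_distribution N2"
  obtains A B :: "real \<Rightarrow> real" and f :: "real \<Rightarrow> real"
  where "A \<in> borel_measurable (restrict_space lborel {0<..<1})"
    "B \<in> borel_measurable (restrict_space lborel {0<..<1})"
    "distr (restrict_space lborel {0<..<1}) borel A = N1"
    "distr (restrict_space lborel {0<..<1}) borel B = N2"
    "\<And>x y. \<bar>f x - f y\<bar> \<le> \<bar>x - y\<bar>" "f 0 = 0"
    "\<And>u. u \<in> {0<..<1} \<Longrightarrow> f (A u) - f (B u) = \<bar>A u - B u\<bar>"
proof -
  interpret N1: cdf_distribution N1 unfolding cdf_distribution_def by fact
  interpret N2: cdf_distribution N2 unfolding cdf_distribution_def by fact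
  define g where "g s = sgn (cdf N2 s - cdf N1 s)" for s
  have g: "g \<in> borel_measurable borel" "\<And>s. \<bar>g s\<bar> \<le> 1"
    unfolding g_def using N1.measurable_C N2.measurable_C by (auto simp: abs_sgn_eq)
  have sets: "sets (restrict_space lborel {0<..<1::real}) = sets (restrict_space borel {0<..<1})"
    by (rule sets_restrict_space_cong) simp
  show ?thesis
  proof (rule that)
    show "N1.I \<in> borel_measurable (restrict_space lborel {0<..<1})"
      using N1.measurable_CI measurable_cong_sets[OF sets refl] by blast
    show "N2.I \<in> borel_measurable (restrict_space lborel {0<..<1})"
      using N2.measurable_CI measurable_cong_sets[OF sets refl] by blast
    show "distr (restrict_space lborel {0<..<1}) borel N1.I = N1" by (rule N1.distr_I_eq_M)
    show "distr (restrict_space lborel {0<..<1}) borel N2.I = N2" by (rule N2.distr_I_eq_M)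
    show "\<bar>primitive g x - primitive g y\<bar> \<le> \<bar>x - y\<bar>" for x y
      by (rule primitive_Lipschitz[OF g])
    show "primitive g 0 = 0" by (simp add: primitive_def)
    fix u :: real assume u: "u \<in> {0<..<1}"
    have inv1: "u \<le> cdf N1 s \<longleftrightarrow> N1.I u \<le> s" for s using u by (intro N1.pseudoinverse) auto
    have inv2: "u \<le> cdf N2 s \<longleftrightarrow> N2.I u \<le> s" for s using u by (intro N2.pseudoinverse) auto
    show "primitive g (N1.I u) - primitive g (N2.I u) = \<bar>N1.I u - N2.I u\<bar>"
    proof (cases "N2.I u \<le> N1.I u")
      case True
      \<comment> \<open>For such \<open>s\<close> the Galois connection between distribution and
        quantile functions gives \<open>cdf N1 s < u \<le> cdf N2 s\<close>; the half-open interval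
        matches it exactly.\<close>
      have "g s = 1" if "N2.I u \<le> s" "s < N1.I u" for s
        using that inv1[of s] inv2[of s] by (simp add: g_def)
      then show ?thesis using primitive_const_on[OF g True, of 1] True by simp
    next
      case False
      have "g s = - 1" if "N1.I u \<le> s" "s < N2.I u" for s
        using that inv1[of s] inv2[of s] by (simp add: g_def)
      then show ?thesis using primitive_const_on[OF g, of "N1.I u" "N2.I u" "- 1"] False by simp
    qed
  qed
qed

text \<open>The images under \<open>signed_square\<close> are coupled by quantiles and pulled back
  with \<open>signed_sqrt\<close>, its inverse, which restores the marginals. Bounded supports make
  \<open>f (A u)\<close> and \<open>f (B u)\<close> integrable, and hence the cost, which is the
  difference of the two.\<close>

lemma W2_le_Lipschitz:
  assumes N: "real_distribution N1" "real_distribution N2"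
    and bd: "AE x in N1. \<bar>x\<bar> \<le> r" "AE x in N2. \<bar>x\<bar> \<le> r"
  obtains f :: "real \<Rightarrow> real" where "\<And>x y. \<bar>f x - f y\<bar> \<le> \<bar>x - y\<bar>" "f 0 = 0"
    "(W2 N1 N2)\<^sup>2 \<le> 2 * ((\<integral>x. f (signed_square x) \<partial>N1) - (\<integral>x. f (signed_square x) \<partial>N2))"
proof -
  interpret N1: real_distribution N1 by fact
  interpret N2: real_distribution N2 by fact
  let ?U = "restrict_space lborel {0<..<1::real}"
  interpret U: prob_space ?U
    by (auto simp: emeasure_restrict_space space_restrict_space intro!: prob_spaceI)
  have M: "real_distribution (distr N1 borel signed_square)" "real_distribution (distr N2 borel signed_square)"
    by (auto intro!: N1.real_distribution_distr N2.real_distribution_distr)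
  obtain A B f where A [measurable]: "A \<in> borel_measurable ?U" and B [measurable]: "B \<in> borel_measurable ?U"
    and dA: "distr ?U borel A = distr N1 borel signed_square"
    and dB: "distr ?U borel B = distr N2 borel signed_square"
    and lip: "\<And>x y. \<bar>f x - f y\<bar> \<le> \<bar>x - y\<bar>" and f0: "f 0 = 0"
    and eq: "\<And>u. u \<in> {0<..<1} \<Longrightarrow> f (A u) - f (B u) = \<bar>A u - B u\<bar>"
    using quantile_coupling[OF M] by blast
  have f [measurable]: "f \<in> borel_measurable borel" by (rule Lipschitz_measurable[OF lip])
  have bd2: "AE u in ?U. \<bar>A u\<bar> \<le> r\<^sup>2" "AE u in ?U. \<bar>B u\<bar> \<le> r\<^sup>2"
  proof -
    have sq: "\<bar>signed_square x\<bar> \<le> r\<^sup>2" if "\<bar>x\<bar> \<le> r" for x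
      using power_mono[OF that, of 2] by (simp add: signed_square_def abs_mult power2_eq_square)
    have "AE x in N1. \<bar>signed_square x\<bar> \<le> r\<^sup>2" "AE x in N2. \<bar>signed_square x\<bar> \<le> r\<^sup>2"
      using bd sq by auto
    then have "AE y in distr N1 borel signed_square. \<bar>y\<bar> \<le> r\<^sup>2"
      "AE y in distr N2 borel signed_square. \<bar>y\<bar> \<le> r\<^sup>2"
      by (simp_all add: AE_distr_iff)
    then show "AE u in ?U. \<bar>A u\<bar> \<le> r\<^sup>2" "AE u in ?U. \<bar>B u\<bar> \<le> r\<^sup>2"
      unfolding dA[symmetric] dB[symmetric] by (auto dest: AE_distrD[OF A] AE_distrD[OF B])
  qed
  have absf: "\<bar>f x\<bar> \<le> \<bar>x\<bar>" for x using lip[of x 0] f0 by simp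
  have int: "integrable ?U (\<lambda>u. f (A u))" "integrable ?U (\<lambda>u. f (B u))"
  proof -
    have "AE u in ?U. norm (f (A u)) \<le> r\<^sup>2" "AE u in ?U. norm (f (B u)) \<le> r\<^sup>2"
      using bd2 order_trans[OF absf] by auto
    then show "integrable ?U (\<lambda>u. f (A u))" "integrable ?U (\<lambda>u. f (B u))"
      by - (erule U.integrable_const_bound, measurable)+
  qed
  have int2: "integrable ?U (\<lambda>u. 2 * \<bar>A u - B u\<bar>)"
  proof -
    have "integrable ?U (\<lambda>u. 2 * (f (A u) - f (B u)))" using int by simp
    then show ?thesis
      by (rule Bochner_Integration.integrable_cong[THEN iffD1, rotated -1])
        (auto simp: eq space_restrict_space)
  qed
  define \<gamma> where "\<gamma> = distr ?U borel (\<lambda>u. (signed_sqrt (A u), signed_sqrt (B u)))"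
  have comp: "distr (distr N borel signed_square) borel signed_sqrt = N" if "real_distribution N" for N
  proof -
    interpret N: real_distribution N by fact
    show ?thesis by (subst distr_distr) (auto simp: o_def signed_sqrt_signed_square distr_id2)
  qed
  have meas: "(\<lambda>u. (signed_sqrt (A u), signed_sqrt (B u))) \<in> measurable ?U borel"
    by (simp add: borel_prod[symmetric])
  have fs: "fst \<in> borel_measurable (borel :: (real \<times> real) measure)"
    "snd \<in> borel_measurable (borel :: (real \<times> real) measure)"
    by (simp_all add: borel_prod[symmetric])
  have \<gamma>: "\<gamma> \<in> couplings N1 N2"
  proof -
    have "distr \<gamma> borel fst = distr (distr ?U borel A) borel signed_sqrt"
      unfolding \<gamma>_def using meas fs by (simp add: distr_distr o_def)
    moreover have "distr \<gamma> borel snd = distr (distr ?U borel B) borel signed_sqrt"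
      unfolding \<gamma>_def using meas fs by (simp add: distr_distr o_def)
    ultimately show ?thesis
      unfolding couplings_def dA dB comp[OF N(1)] comp[OF N(2)] \<gamma>_def
      using U.prob_space_distr[OF meas] by simp
  qed
  have "(INF \<gamma>\<in>couplings N1 N2. \<integral>\<^sup>+ p. ennreal ((fst p - snd p)\<^sup>2) \<partial>\<gamma>)
      \<le> (\<integral>\<^sup>+ p. ennreal ((fst p - snd p)\<^sup>2) \<partial>\<gamma>)"
    by (rule INF_lower[OF \<gamma>])
  also have "\<dots> = (\<integral>\<^sup>+ u. ennreal ((signed_sqrt (A u) - signed_sqrt (B u))\<^sup>2) \<partial>?U)"
    unfolding \<gamma>_def using meas by (subst nn_integral_distr) (auto simp: borel_prod[symmetric])
  also have "\<dots> \<le> (\<integral>\<^sup>+ u. ennreal (2 * \<bar>A u - B u\<bar>) \<partial>?U)"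
    using square_diff_le_signed_square[of "signed_sqrt (A u)" "signed_sqrt (B u)" for u]
    by (intro nn_integral_mono ennreal_leI) (simp add: signed_square_signed_sqrt)
  also have "\<dots> = ennreal (\<integral>u. 2 * \<bar>A u - B u\<bar> \<partial>?U)"
    using int2 by (intro nn_integral_eq_integral) auto
  finally have "enn2real (INF \<gamma>\<in>couplings N1 N2. \<integral>\<^sup>+ p. ennreal ((fst p - snd p)\<^sup>2) \<partial>\<gamma>)
      \<le> (\<integral>u. 2 * \<bar>A u - B u\<bar> \<partial>?U)"
    by (intro enn2real_leI) (auto intro!: integral_nonneg_AE)
  then have "(W2 N1 N2)\<^sup>2 \<le> (\<integral>u. 2 * \<bar>A u - B u\<bar> \<partial>?U)"
    by (simp add: W2_def)
  also have "\<dots> = (\<integral>u. 2 * (f (A u) - f (B u)) \<partial>?U)"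
    by (intro Bochner_Integration.integral_cong) (auto simp: eq space_restrict_space)
  also have "\<dots> = 2 * ((\<integral>u. f (A u) \<partial>?U) - (\<integral>u. f (B u) \<partial>?U))"
    using int by simp
  also have "(\<integral>u. f (A u) \<partial>?U) = (\<integral>y. f y \<partial>distr ?U borel A)"
    by (subst integral_distr) auto
  also have "\<dots> = (\<integral>x. f (signed_square x) \<partial>N1)"
    unfolding dA by (subst integral_distr) auto
  also have "(\<integral>u. f (B u) \<partial>?U) = (\<integral>y. f y \<partial>distr ?U borel B)"
    by (subst integral_distr) auto
  also have "\<dots> = (\<integral>x. f (signed_square x) \<partial>N2)"
    unfolding dB by (subst integral_distr) auto
  finally show ?thesis using that lip f0 by blast
qed

section \<open>Projections of the measure and of the symmetrized sample\<close>

lemma ip_measurable [measurable]: "(\<lambda>x. ip d x v) \<in> borel_measurable (Rd d)"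
  unfolding ip_def Rd_def by measurable

lemma enorm2_measurable [measurable]: "enorm2 d \<in> borel_measurable (Rd d)"
  unfolding enorm2_def[abs_def] ip_def Rd_def by measurable

lemma space_Rd: "space (Rd d) = extensional {..<d}"
  by (simp add: Rd_def space_PiM PiE_def)

lemma ip_vneg: "ip d (vneg d x) v = - ip d x v"
  by (simp add: ip_def vneg_def sum_negf)

lemma vneg_measurable: "vneg d \<in> measurable (Rd d) (Rd d)"
  unfolding vneg_def Rd_def by measurable

text \<open>Symmetry is stated with images while \<open>distr\<close> works with preimages. The two
  agree because \<open>vneg d\<close> is an involution on the extensional functions, the carrier of
  \<open>Rd d\<close>.\<close>

lemma distr_vneg:
  assumes sets: "sets \<mu> = sets (Rd d)" and sym: "symmetric_measure d \<mu>"
  shows "distr \<mu> (Rd d) (vneg d) = \<mu>"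
proof (rule measure_eqI)
  note sp = sets_eq_imp_space_eq[OF sets]
  fix A assume "A \<in> sets (distr \<mu> (Rd d) (vneg d))"
  then have A: "A \<in> sets (Rd d)" by simp
  have inv: "vneg d (vneg d x) = x" if "x \<in> space (Rd d)" for x
    using that by (auto simp: space_Rd vneg_def extensional_def fun_eq_iff)
  have "vneg d -` A \<inter> space \<mu> = vneg d ` A"
  proof (intro subset_antisym subsetI)
    fix x assume "x \<in> vneg d -` A \<inter> space \<mu>"
    then show "x \<in> vneg d ` A" using inv[of x] sp by (metis IntE image_eqI vimageE)
  next
    fix y assume "y \<in> vneg d ` A"
    then obtain x where x: "x \<in> A" "y = vneg d x" by auto
    then have "x \<in> space (Rd d)" using sets.sets_into_space[OF A] by auto
    then show "y \<in> vneg d -` A \<inter> space \<mu>" using x inv[of x] by (simp add: sp space_Rd vneg_def)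
  qed
  moreover have "vneg d \<in> measurable \<mu> (Rd d)"
    using vneg_measurable measurable_cong_sets[OF sets refl] by blast
  ultimately show "emeasure (distr \<mu> (Rd d) (vneg d)) A = emeasure \<mu> A"
    using sym A by (simp add: emeasure_distr symmetric_measure_def)
qed (simp add: sets)

lemma emp_measurable:
  "(\<lambda>(i, b). restrict (\<lambda>j. (if b then 1 else -1) * X i j) {..<d})
    \<in> measurable (measure_pmf p) (Rd d)"
  by (auto simp: space_Rd)

lemma integral_proj_emp:
  assumes n: "n \<ge> 1" and \<phi>: "\<phi> \<in> borel_measurable borel"
  shows "(\<integral>y. \<phi> y \<partial>proj d v (emp d X n))
    = (\<Sum>i<n. \<phi> (ip d (X i) v) + \<phi> (- ip d (X i) v)) / (2 * real n)"
proof -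
  let ?p = "pmf_of_set ({..<n} \<times> (UNIV :: bool set))"
  have ne: "{..<n} \<times> (UNIV :: bool set) \<noteq> {}" using n by (auto simp: lessThan_empty_iff)
  have ipr: "ip d (restrict (\<lambda>j. (if b then 1 else -1) * X i j) {..<d}) v
      = (if b then ip d (X i) v else - ip d (X i) v)" for b i
    by (simp add: ip_def sum_negf)
  have "(\<integral>y. \<phi> y \<partial>proj d v (emp d X n)) = (\<integral>x. \<phi> (ip d x v) \<partial>emp d X n)"
    unfolding proj_def using \<phi> by (subst integral_distr) (auto simp: emp_def)
  also have "\<dots> = (\<integral>p. \<phi> (if snd p then ip d (X (fst p)) v else - ip d (X (fst p)) v) \<partial>measure_pmf ?p)"
    unfolding emp_def using \<phi>
    by (subst integral_distr[OF emp_measurable]) (auto simp: case_prod_unfold ipr)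
  also have "\<dots> = (\<Sum>p\<in>{..<n} \<times> UNIV. \<phi> (if snd p then ip d (X (fst p)) v else - ip d (X (fst p)) v)) / real (n * 2)"
    using ne by (subst integral_pmf_of_set) (auto simp: card_cartesian_product)
  also have "(\<Sum>p\<in>{..<n} \<times> (UNIV::bool set). \<phi> (if snd p then ip d (X (fst p)) v else - ip d (X (fst p)) v))
    = (\<Sum>i<n. \<phi> (ip d (X i) v) + \<phi> (- ip d (X i) v))"
    using sum.cartesian_product[of "\<lambda>i b. \<phi> (if b then ip d (X i) v else - ip d (X i) v)" "UNIV :: bool set" "{..<n}"]
    by (simp add: UNIV_bool add.commute case_prod_unfold)
  finally show ?thesis by (simp add: mult.commute)
qed

lemma real_distribution_proj:
  assumes "prob_space \<mu>" "sets \<mu> = sets (Rd d)"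
  shows "real_distribution (proj d v \<mu>)"
proof -
  interpret prob_space \<mu> by fact
  have [measurable]: "(\<lambda>x. ip d x v) \<in> borel_measurable \<mu>"
    using ip_measurable measurable_cong_sets[OF assms(2) refl] by blast
  show ?thesis unfolding proj_def by (rule real_distribution_distr) measurable
qed

lemma W2_proj_le:
  assumes sets: "sets \<mu> = sets (Rd d)" and prob: "prob_space \<mu>" and sym: "symmetric_measure d \<mu>"
    and bd: "AE x in \<mu>. enorm2 d x \<le> r" and n: "n \<ge> 1"
    and X: "\<And>i. i < n \<Longrightarrow> enorm2 d (X i) \<le> r" and v: "enorm2 d v = 1"
  obtains f :: "real \<Rightarrow> real" where "\<And>x y. \<bar>f x - f y\<bar> \<le> \<bar>x - y\<bar>" "f 0 = 0"
    "(W2 (proj d v \<mu>) (proj d v (emp d X n)))\<^sup>2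
      \<le> 2 * ((\<integral>x. f ((ip d x v)\<^sup>2) \<partial>\<mu>) - (\<Sum>i<n. f ((ip d (X i) v)\<^sup>2)) / real n)"
proof -
  interpret prob_space \<mu> by fact
  have [measurable]: "(\<lambda>x. ip d x v) \<in> borel_measurable \<mu>"
    using ip_measurable measurable_cong_sets[OF sets refl] by blast
  have emp: "prob_space (emp d X n)" "sets (emp d X n) = sets (Rd d)"
    unfolding emp_def by (auto intro!: measure_pmf.prob_space_distr simp: space_Rd)
  have ipr: "\<bar>ip d x v\<bar> \<le> enorm2 d x" for x
    using abs_ip_le[of d x v] v by simp
  have bd1: "AE y in proj d v \<mu>. \<bar>y\<bar> \<le> r"
    unfolding proj_def
    by (subst AE_distr_iff) (use bd in \<open>auto elim!: eventually_mono intro: order_trans[OF ipr]\<close>)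
  have bd2: "AE y in proj d v (emp d X n). \<bar>y\<bar> \<le> r"
  proof -
    have "AE x in emp d X n. \<bar>ip d x v\<bar> \<le> r"
      unfolding emp_def
    proof (subst AE_distr_iff[OF emp_measurable])
      have "\<bar>ip d (restrict (\<lambda>j. (if b then 1 else -1) * X i j) {..<d}) v\<bar> \<le> r" if "i < n" for i b
      proof -
        have "ip d (restrict (\<lambda>j. (if b then 1 else -1) * X i j) {..<d}) v
          = (if b then ip d (X i) v else - ip d (X i) v)"
          by (simp add: ip_def sum_negf)
        then show ?thesis using X[OF that] ipr[of "X i"] by auto
      qed
      moreover have "set_pmf (pmf_of_set ({..<n} \<times> (UNIV :: bool set))) = {..<n} \<times> UNIV"
        using n by (intro set_pmf_of_set) (auto simp: lessThan_empty_iff)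
      ultimately show "AE p in measure_pmf (pmf_of_set ({..<n} \<times> UNIV)).
          \<bar>ip d (case p of (i, b) \<Rightarrow> restrict (\<lambda>j. (if b then 1 else -1) * X i j) {..<d}) v\<bar> \<le> r"
        by (auto simp: AE_measure_pmf_iff)
    qed measurable
    then show ?thesis
      unfolding proj_def using emp(2) by (subst AE_distr_iff) (auto cong: measurable_cong_sets)
  qed
  obtain f where lip: "\<And>x y. \<bar>f x - f y\<bar> \<le> \<bar>x - y\<bar>" and f0: "f 0 = 0"
    and W: "(W2 (proj d v \<mu>) (proj d v (emp d X n)))\<^sup>2
      \<le> 2 * ((\<integral>x. f (signed_square x) \<partial>proj d v \<mu>) - (\<integral>x. f (signed_square x) \<partial>proj d v (emp d X n)))"
    using W2_le_Lipschitz[OF real_distribution_proj[OF prob sets] real_distribution_proj[OF emp] bd1 bd2]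
    by blast
  have f [measurable]: "f \<in> borel_measurable borel" by (rule Lipschitz_measurable[OF lip])
  \<comment> \<open>Both measures are invariant under reflection, and averaging over
    \<open>t\<close> and \<open>- t\<close> turns the two signed squares into arguments of opposite
    sign; hence the even part of \<open>f\<close>, which is again 1-Lipschitz and vanishes at
    0.\<close>
  define g where "g y = (f y + f (- y)) / 2" for y
  have g: "(f (signed_square t) + f (signed_square (- t))) / 2 = g (t\<^sup>2)" for t
    by (cases "t \<ge> 0") (auto simp: g_def signed_square_def power2_eq_square)
  have absf: "\<bar>f x\<bar> \<le> \<bar>x\<bar>" for x using lip[of x 0] f0 by simp
  have int: "integrable \<mu> (\<lambda>x. f (signed_square (c * ip d x v)))" if "\<bar>c\<bar> = 1" for c
  proof (rule integrable_const_bound[where B="r\<^sup>2"])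
    have "\<bar>f (signed_square (c * ip d x v))\<bar> \<le> r\<^sup>2" if "enorm2 d x \<le> r" for x
    proof -
      have "\<bar>f (signed_square (c * ip d x v))\<bar> \<le> \<bar>signed_square (c * ip d x v)\<bar>" by (rule absf)
      also have "\<dots> = \<bar>ip d x v\<bar>\<^sup>2"
        using \<open>\<bar>c\<bar> = 1\<close> by (simp add: signed_square_def abs_mult power2_eq_square)
      also have "\<dots> \<le> r\<^sup>2" using ipr[of x] that by (intro power_mono) auto
      finally show ?thesis .
    qed
    then show "AE x in \<mu>. norm (f (signed_square (c * ip d x v))) \<le> r\<^sup>2" using bd by auto
  qed measurable
  have "(\<integral>x. f (signed_square (ip d x v)) \<partial>\<mu>) = (\<integral>x. f (signed_square (ip d x v)) \<partial>distr \<mu> (Rd d) (vneg d))"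
    by (simp add: distr_vneg[OF sets sym])
  also have "\<dots> = (\<integral>x. f (signed_square (- ip d x v)) \<partial>\<mu>)"
    using vneg_measurable measurable_cong_sets[OF sets refl]
    by (subst integral_distr) (auto simp: ip_vneg)
  finally have "(\<integral>x. f (signed_square (ip d x v)) \<partial>\<mu>)
      = ((\<integral>x. f (signed_square (ip d x v)) \<partial>\<mu>) + (\<integral>x. f (signed_square (- ip d x v)) \<partial>\<mu>)) / 2"
    by simp
  also have "\<dots> = (\<integral>x. (f (signed_square (ip d x v)) + f (signed_square (- ip d x v))) / 2 \<partial>\<mu>)"
    using int[of 1] int[of "-1"] by simp
  also have "\<dots> = (\<integral>x. g ((ip d x v)\<^sup>2) \<partial>\<mu>)"
    by (simp only: g)
  finally have 1: "(\<integral>x. f (signed_square x) \<partial>proj d v \<mu>) = (\<integral>x. g ((ip d x v)\<^sup>2) \<partial>\<mu>)"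
    unfolding proj_def by (subst integral_distr) auto
  have "(\<integral>x. f (signed_square x) \<partial>proj d v (emp d X n))
    = (\<Sum>i<n. (f (signed_square (ip d (X i) v)) + f (signed_square (- ip d (X i) v))) / 2) / real n"
    using n by (subst integral_proj_emp) (auto simp: sum_divide_distrib[symmetric])
  then have 2: "(\<integral>x. f (signed_square x) \<partial>proj d v (emp d X n)) = (\<Sum>i<n. g ((ip d (X i) v)\<^sup>2)) / real n"
    by (simp only: g)
  have "\<bar>g x - g y\<bar> \<le> \<bar>x - y\<bar>" for x y
    using lip[of x y] lip[of "- x" "- y"] unfolding g_def by argo
  moreover have "g 0 = 0" using f0 by (simp add: g_def)
  ultimately show ?thesis using that[of g] W unfolding 1 2 by blast
qed

text \<open>A real \<open>Sup\<close> dominates its members only when the set is bounded; the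
  Hilbert-Schmidt norm provides the bound.\<close>

lemma opnorm_bdd: "bdd_above {enorm2 d (\<lambda>i. \<Sum>j<d. S i j * v j) | v. enorm2 d v = 1}"
proof (rule bdd_aboveI)
  fix y assume "y \<in> {enorm2 d (\<lambda>i. \<Sum>j<d. S i j * v j) | v. enorm2 d v = 1}"
  then obtain v where v: "enorm2 d v = 1" and y: "y = enorm2 d (\<lambda>i. \<Sum>j<d. S i j * v j)" by auto
  have "(\<Sum>j<d. S i j * v j)\<^sup>2 \<le> (\<Sum>j<d. (S i j)\<^sup>2)" for i
    using ip_cauchy_schwarz[of d "S i" v] ip_self_eq_1[OF v] by (simp add: ip_def power2_eq_square)
  then have "(\<Sum>i<d. (\<Sum>j<d. S i j * v j)\<^sup>2) \<le> (\<Sum>i<d. \<Sum>j<d. (S i j)\<^sup>2)"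
    by (intro sum_mono) simp
  then show "y \<le> sqrt (\<Sum>i<d. \<Sum>j<d. (S i j)\<^sup>2)"
    unfolding y enorm2_def ip_def by (simp add: power2_eq_square)
qed

lemma second_moment_le_opnorm:
  assumes sets: "sets \<mu> = sets (Rd d)" and prob: "prob_space \<mu>"
    and bd: "AE x in \<mu>. enorm2 d x \<le> r" and v: "enorm2 d v = 1"
  shows "(\<integral>x. (ip d x v)\<^sup>2 \<partial>\<mu>) \<le> opnorm d (cov d \<mu>)"
proof -
  interpret prob_space \<mu> by fact
  have m: "(\<lambda>x. x i) \<in> borel_measurable \<mu>" if "i < d" for i
  proof -
    have "(\<lambda>x. x i) \<in> borel_measurable (Rd d)" unfolding Rd_def
      by (rule measurable_component_singleton) (use that in simp)
    then show ?thesis using measurable_cong_sets[OF sets refl] by blast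
  qed
  have int: "integrable \<mu> (\<lambda>x. x i * x j)" if ij: "i < d" "j < d" for i j
  proof (rule integrable_const_bound[where B="r * r"])
    have "\<bar>x i * x j\<bar> \<le> r * r" if "enorm2 d x \<le> r" for x
    proof -
      have "\<bar>x l\<bar> \<le> r" if "l < d" for l
      proof -
        have "(x l)\<^sup>2 \<le> (enorm2 d x)\<^sup>2"
          using that by (simp add: enorm2_square component_square_le)
        then have "\<bar>x l\<bar> \<le> enorm2 d x"
          using enorm2_nonneg[of d x] by (metis abs_le_square_iff abs_of_nonneg)
        then show ?thesis using \<open>enorm2 d x \<le> r\<close> by linarith
      qed
      then show ?thesis using ij unfolding abs_mult by (intro mult_mono') auto
    qed
    then show "AE x in \<mu>. norm (x i * x j) \<le> r * r" using bd by auto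
    show "(\<lambda>x. x i * x j) \<in> borel_measurable \<mu>" using m ij by auto
  qed
  have "(\<integral>x. (ip d x v)\<^sup>2 \<partial>\<mu>) = (\<integral>x. (\<Sum>i<d. \<Sum>j<d. v i * v j * (x i * x j)) \<partial>\<mu>)"
    unfolding ip_def power2_eq_square sum_product by (simp add: mult_ac)
  also have "\<dots> = (\<Sum>i<d. \<Sum>j<d. v i * v j * cov d \<mu> i j)"
    using int by (subst Bochner_Integration.integral_sum) (auto simp: cov_def)
  also have "\<dots> = ip d v (\<lambda>i. \<Sum>j<d. cov d \<mu> i j * v j)"
    by (simp add: ip_def sum_distrib_left mult_ac)
  also have "\<dots> \<le> enorm2 d (\<lambda>i. \<Sum>j<d. cov d \<mu> i j * v j)"
    using abs_ip_le[of d v "\<lambda>i. \<Sum>j<d. cov d \<mu> i j * v j"] v by simp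
  also have "\<dots> \<le> opnorm d (cov d \<mu>)"
    unfolding opnorm_def using v by (intro cSup_upper opnorm_bdd) auto
  finally show ?thesis .
qed

section \<open>Nets for directions and test functions\<close>

text \<open>One element is kept from each fibre of \<open>g\<close>. If elements of a fibre are
  close, this is a net inside \<open>A\<close> itself, and the injectivity of \<open>g\<close> on it
  is what \<open>feature_increments\<close> asks of the test functions.\<close>

lemma finite_representatives:
  assumes "finite (g ` A)"
  obtains V where "V \<subseteq> A" "finite V" "inj_on g V" "\<And>a. a \<in> A \<Longrightarrow> \<exists>v\<in>V. g v = g a"
proof -
  obtain V where "V \<subseteq> A" "inj_on g V" "g ` V = g ` A"
    using subset_image_inj[of "g ` A" g A] by auto
  moreover have "finite V" using assms calculation by (metis finite_imageD)
  ultimately show ?thesis using that by (metis (no_types, opaque_lifting) imageE imageI)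
qed

text \<open>Directions are grouped by the floors of their scaled coordinates, and representatives
  are taken on the sphere, so the net consists of unit vectors. Its size, which may grow with
  \<open>d\<close>, is left unspecified.\<close>

lemma unit_sphere_net:
  assumes d: "d \<ge> 1" and \<epsilon>: "\<epsilon> > 0"
  obtains V where "finite V" "V \<noteq> {}" "\<And>v. v \<in> V \<Longrightarrow> enorm2 d v = 1"
    "\<And>v. enorm2 d v = 1 \<Longrightarrow> \<exists>v'\<in>V. enorm2 d (\<lambda>i. v i - v' i) \<le> \<epsilon>"
proof -
  obtain N :: nat where N: "real d / \<epsilon> < real N" using reals_Archimedean2 by blast
  have "0 \<le> real d / \<epsilon>" using \<epsilon> by simp
  then have N0: "N > 0" using N by linarith
  define g where "g v = (\<lambda>i\<in>{..<d}. \<lfloor>real N * v i\<rfloor>)" for v :: "nat \<Rightarrow> real"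
  have "g v \<in> {..<d} \<rightarrow>\<^sub>E {- int N..int N}" if v: "enorm2 d v = 1" for v
  proof -
    have "\<lfloor>real N * v i\<rfloor> \<in> {- int N..int N}" if "i < d" for i
    proof -
      have "(v i)\<^sup>2 \<le> ip d v v"
        using that by (rule component_square_le)
      then have "\<bar>v i\<bar> \<le> 1" using ip_self_eq_1[OF v] by (simp add: abs_square_le_1)
      then have "\<bar>real N * v i\<bar> \<le> real N * 1" unfolding abs_mult by (intro mult_mono) auto
      then have "- real N \<le> real N * v i" "real N * v i \<le> real N" by linarith+
      then show ?thesis by (simp add: le_floor_iff floor_le_iff)
    qed
    then show ?thesis by (auto simp: g_def)
  qed
  then have "g ` {v. enorm2 d v = 1} \<subseteq> {..<d} \<rightarrow>\<^sub>E {- int N..int N}" by auto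
  then have "finite (g ` {v. enorm2 d v = 1})"
    by (rule finite_subset) (intro finite_PiE; simp)
  then obtain V where V: "V \<subseteq> {v. enorm2 d v = 1}" "finite V"
    and rep: "\<And>v. v \<in> {v. enorm2 d v = 1} \<Longrightarrow> \<exists>v'\<in>V. g v' = g v"
    by (rule finite_representatives) blast
  have net: "\<exists>v'\<in>V. enorm2 d (\<lambda>i. v i - v' i) \<le> \<epsilon>" if v: "enorm2 d v = 1" for v
  proof -
    obtain v' where v': "v' \<in> V" "g v' = g v" using rep v by auto
    have close: "(v i - v' i) * (v i - v' i) \<le> 1 / real N * (1 / real N)" if "i < d" for i
    proof -
      have "g v' i = g v i" using v' by simp
      then have "\<bar>real N * v i - real N * v' i\<bar> < 1" using that unfolding g_def by (simp, linarith)
      then have "\<bar>v i - v' i\<bar> * real N \<le> 1"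
        by (simp add: right_diff_distrib[symmetric] abs_mult mult.commute)
      then have "\<bar>v i - v' i\<bar> \<le> 1 / real N" using N0 by (simp add: pos_le_divide_eq)
      then have "\<bar>v i - v' i\<bar> * \<bar>v i - v' i\<bar> \<le> 1 / real N * (1 / real N)" by (intro mult_mono) auto
      then show ?thesis by simp
    qed
    have "ip d (\<lambda>i. v i - v' i) (\<lambda>i. v i - v' i) \<le> (\<Sum>i<d. 1 / real N * (1 / real N))"
      unfolding ip_def using close by (intro sum_mono) auto
    also have "\<dots> = real d * (1 / real N)\<^sup>2" by (simp add: power2_eq_square)
    also have "\<dots> \<le> (real d)\<^sup>2 * (1 / real N)\<^sup>2"
      using d by (intro mult_right_mono) (auto simp: power2_eq_square)
    also have "\<dots> = (real d / real N)\<^sup>2" by (simp add: power_divide)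
    also have "\<dots> \<le> \<epsilon>\<^sup>2"
    proof (rule power_mono)
      have "real d < real N * \<epsilon>" using N \<epsilon> by (simp add: pos_divide_less_eq)
      then show "real d / real N \<le> \<epsilon>" using N0 by (simp add: pos_divide_le_eq mult.commute)
    qed simp
    finally have "(enorm2 d (\<lambda>i. v i - v' i))\<^sup>2 \<le> \<epsilon>\<^sup>2" by (simp add: enorm2_square)
    then have "enorm2 d (\<lambda>i. v i - v' i) \<le> \<epsilon>" by (rule power2_le_imp_le) (use \<epsilon> in simp)
    then show ?thesis using v'(1) by blast
  qed
  moreover have "enorm2 d (unit_vec 0) = 1" using d by (simp add: enorm2_unit_vec)
  ultimately show ?thesis using V that[of V] by blast
qed

lemma ip_diff_right: "ip d x v - ip d x w = ip d x (\<lambda>i. v i - w i)"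
  by (simp add: ip_def sum_subtractf right_diff_distrib)

lemma ip_square_diff_le:
  assumes v: "enorm2 d v = 1" and w: "enorm2 d w = 1" and x: "ip d x x \<le> R"
    and vw: "enorm2 d (\<lambda>i. v i - w i) \<le> \<epsilon>"
  shows "\<bar>(ip d x v)\<^sup>2 - (ip d x w)\<^sup>2\<bar> \<le> 2 * R * \<epsilon>"
proof -
  define n where "n = enorm2 d x"
  have n: "n \<ge> 0" "n * n \<le> R" using x enorm2_square[of d x] by (auto simp: n_def enorm2_nonneg power2_eq_square)
  have 1: "\<bar>ip d x v\<bar> \<le> n" "\<bar>ip d x w\<bar> \<le> n"
    using abs_ip_le[of d x v] abs_ip_le[of d x w] v w by (auto simp: n_def)
  have \<epsilon>: "\<epsilon> \<ge> 0" using vw enorm2_nonneg order_trans by blast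
  have 2: "\<bar>ip d x v - ip d x w\<bar> \<le> n * \<epsilon>"
    unfolding ip_diff_right using abs_ip_le[of d x "\<lambda>i. v i - w i"] vw n(1)
    by (metis mult_left_mono n_def order_trans)
  have "\<bar>(ip d x v)\<^sup>2 - (ip d x w)\<^sup>2\<bar> = \<bar>ip d x v - ip d x w\<bar> * \<bar>ip d x v + ip d x w\<bar>"
    by (simp add: abs_mult[symmetric] power2_eq_square algebra_simps)
  also have "\<dots> \<le> (n * \<epsilon>) * (2 * n)"
    using 1 2 n \<epsilon> by (intro mult_mono) auto
  also have "\<dots> = 2 * (n * n) * \<epsilon>" by simp
  also have "\<dots> \<le> 2 * R * \<epsilon>" using n \<epsilon> by (intro mult_right_mono mult_left_mono) auto
  finally show ?thesis .
qed

text \<open>Flattening \<open>f\<close> below \<open>a\<close> costs at most \<open>a\<close>, as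
  \<open>f\<close> vanishes at 0. Agreement of the quantizations at level \<open>k\<close> costs
  \<open>3 * y / 2 ^ k\<close>, at most \<open>3 * a\<close> on the range considered.\<close>

lemma Lip1_net:
  assumes a: "a > 0"
  obtains \<Phi> where "finite \<Phi>" "\<Phi> \<noteq> {}" "\<Phi> \<subseteq> Lip1 a" "inj_on (quant a k k) \<Phi>"
    "\<forall>f :: real \<Rightarrow> real. (\<forall>x y. \<bar>f x - f y\<bar> \<le> \<bar>x - y\<bar>) \<and> f 0 = 0 \<longrightarrow>
      (\<exists>g\<in>\<Phi>. \<forall>y. 0 \<le> y \<longrightarrow> y \<le> 2 ^ k * a \<longrightarrow> \<bar>f y - g y\<bar> \<le> 4 * a)"
proof -
  obtain \<Phi> where \<Phi>: "\<Phi> \<subseteq> Lip1 a" "finite \<Phi>" "inj_on (quant a k k) \<Phi>"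
    and rep: "\<And>f. f \<in> Lip1 a \<Longrightarrow> \<exists>g\<in>\<Phi>. quant a k k g = quant a k k f"
    using finite_representatives[OF finite_quant_image(1)[OF a subset_refl]] by blast
  have "(\<lambda>_. 0) \<in> Lip1 a" by (simp add: Lip1_def)
  then have "\<Phi> \<noteq> {}" using rep by blast
  moreover have "\<exists>g\<in>\<Phi>. \<forall>y. 0 \<le> y \<longrightarrow> y \<le> 2 ^ k * a \<longrightarrow> \<bar>f y - g y\<bar> \<le> 4 * a"
    if lip: "\<And>x y. \<bar>f x - f y\<bar> \<le> \<bar>x - y\<bar>" and f0: "f 0 = 0" for f :: "real \<Rightarrow> real"
  proof -
    define h where "h y = f (max y a) - f a" for y
    have h: "h \<in> Lip1 a"
      unfolding Lip1_def h_def using lip[of "max x a" "max y a" for x y]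
      by (auto simp: max_def) (smt (verit))+
    obtain g where g: "g \<in> \<Phi>" "quant a k k g = quant a k k h" using rep[OF h] by blast
    have "\<bar>f y - g y\<bar> \<le> 4 * a" if y: "0 \<le> y" "y \<le> 2 ^ k * a" for y
    proof -
      have "\<bar>h y - g y\<bar> \<le> 3 * y / 2 ^ k"
        using g \<Phi>(1) h y by (intro quant_eq_imp_close[OF a]) auto
      also have "\<dots> \<le> 3 * a" using y by (simp add: pos_divide_le_eq mult.commute)
      finally have "\<bar>h y - g y\<bar> \<le> 3 * a" .
      moreover have "\<bar>f y - h y\<bar> \<le> a"
        using lip[of a 0] lip[of y 0] f0 y a by (auto simp: h_def max_def)
      ultimately show ?thesis by linarith
    qed
    then show ?thesis using g(1) by blast
  qed
  ultimately show ?thesis using that[OF \<Phi>(2) _ \<Phi>(1) \<Phi>(3)] by blast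
qed

section \<open>The sliced Wasserstein distance of the sample\<close>

text \<open>The integer \<open>k\<close> stands in for the binary logarithm of \<open>n\<close>.
  Flattening test functions below the scale \<open>a\<close>, at most \<open>R / n\<close>, costs no
  more than the target rate allows.\<close>

locale symmetric_sample = prob_space \<mu> for \<mu> :: "(nat \<Rightarrow> real) measure" +
  fixes d :: nat and r :: real and n k :: nat and R a :: real
  assumes d: "d \<ge> 1" and r: "r > 0"
    and sets_\<mu>: "sets \<mu> = sets (Rd d)" and symmetric: "symmetric_measure d \<mu>"
    and norm_le: "AE x in \<mu>. enorm2 d x \<le> r"
    and n: "n \<ge> 1" and k: "k \<ge> 1" and nk: "n \<le> 2 ^ k"
    and R_def: "R = r\<^sup>2" and a_def: "a = R / 2 ^ k"
begin

lemma R: "R > 0" using r by (simp add: R_def)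

lemma a: "a > 0" using R by (simp add: a_def)

lemma Ra: "2 ^ k * a = R" by (simp add: a_def)

lemma a_le: "a \<le> R / real n"
proof -
  have "real n \<le> real (2 ^ k)" using nk by (rule of_nat_mono)
  then show ?thesis unfolding a_def using R n by (intro frac_le) auto
qed

lemma ip_self_le: "enorm2 d x \<le> r \<Longrightarrow> ip d x x \<le> R"
  using power_mono[of "enorm2 d x" r 2] by (simp add: enorm2_square R_def enorm2_nonneg)

text \<open>Truncation changes \<open>x\<close> on a null set only and makes every integrand below bounded everywhere.\<close>

definition clip :: "(nat \<Rightarrow> real) \<Rightarrow> nat \<Rightarrow> real" where
  "clip x = (if enorm2 d x \<le> r then x else (\<lambda>_. 0))"

definition sq :: "(nat \<Rightarrow> real) \<Rightarrow> (nat \<Rightarrow> real) \<Rightarrow> real" where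
  "sq v x = (ip d (clip x) v)\<^sup>2"

lemma ip_clip_le: "ip d (clip x) (clip x) \<le> R"
  using ip_self_le[of x] R by (auto simp: clip_def ip_def)

lemma clip_eq: "enorm2 d x \<le> r \<Longrightarrow> clip x = x"
  by (simp add: clip_def)

lemma sq_bounds:
  assumes "enorm2 d v = 1"
  shows "0 \<le> sq v x" "sq v x \<le> R"
  using ip_cauchy_schwarz[of d "clip x" v] ip_self_eq_1[OF assms] ip_clip_le[of x]
  by (auto simp: sq_def)

lemma sq_measurable [measurable]: "sq v \<in> borel_measurable \<mu>"
proof -
  have "sq v \<in> borel_measurable (Rd d)"
  proof -
    have eq: "sq v = (\<lambda>x. (if enorm2 d x \<le> r then ip d x v else 0)\<^sup>2)"
      by (auto simp: sq_def clip_def fun_eq_iff ip_def)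
    show ?thesis unfolding eq by measurable
  qed
  then show ?thesis using measurable_cong_sets[OF sets_\<mu> refl] by blast
qed

lemma bounded_measurable_sq: "enorm2 d v = 1 \<Longrightarrow> bounded_measurable \<mu> (sq v)"
  using sq_bounds[of v] by (intro bounded_measurableI[where C=R]) auto

lemma expectation_sq_le:
  assumes "enorm2 d v = 1"
  shows "expectation (sq v) \<le> opnorm d (cov d \<mu>)"
proof -
  have "(\<lambda>x. ip d x v) \<in> borel_measurable \<mu>"
    using ip_measurable measurable_cong_sets[OF sets_\<mu> refl] by blast
  then have "expectation (sq v) = expectation (\<lambda>x. (ip d x v)\<^sup>2)"
    using norm_le by (intro integral_cong_AE) (auto simp: sq_def clip_eq)
  then show ?thesis
    using second_moment_le_opnorm[OF sets_\<mu> prob_space_axioms norm_le assms] by simp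
qed

lemma AE_norm_le: "AE X in PiM {..<n} (\<lambda>_. \<mu>). \<forall>i<n. enorm2 d (X i) \<le> r"
proof -
  have "AE X in PiM {..<n} (\<lambda>_. \<mu>). enorm2 d (X i) \<le> r" if "i \<in> {..<n}" for i
    using that norm_le by (intro AE_PiM_component prob_space_axioms)
  then have "AE X in PiM {..<n} (\<lambda>_. \<mu>). \<forall>i\<in>{..<n}. enorm2 d (X i) \<le> r"
    by (intro AE_finite_allI) auto
  then show ?thesis by (rule eventually_mono) auto
qed

end

text \<open>The accuracy of \<open>V\<close> is stated for squared projections, the only way
  directions enter, and at scale \<open>R / n\<close> so that the error summed over the sample is at
  most \<open>R\<close>.\<close>

locale symmetric_sample_net = symmetric_sample +
  fixes V :: "(nat \<Rightarrow> real) set" and \<Phi> :: "(real \<Rightarrow> real) set"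
  assumes V: "finite V" "V \<noteq> {}" "\<And>v. v \<in> V \<Longrightarrow> enorm2 d v = 1"
    and V_net: "\<And>v. enorm2 d v = 1 \<Longrightarrow>
      \<exists>w\<in>V. \<forall>x. ip d x x \<le> R \<longrightarrow> \<bar>(ip d x v)\<^sup>2 - (ip d x w)\<^sup>2\<bar> \<le> R / real n"
    and \<Phi>: "finite \<Phi>" "\<Phi> \<noteq> {}" "\<Phi> \<subseteq> Lip1 a" "inj_on (quant a k k) \<Phi>"
    and \<Phi>_net: "\<And>f :: real \<Rightarrow> real. (\<And>x y. \<bar>f x - f y\<bar> \<le> \<bar>x - y\<bar>) \<Longrightarrow> f 0 = 0 \<Longrightarrow>
      \<exists>g\<in>\<Phi>. \<forall>y. 0 \<le> y \<longrightarrow> y \<le> 2 ^ k * a \<longrightarrow> \<bar>f y - g y\<bar> \<le> 4 * a"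
begin

text \<open>\<open>R\<close> absorbs the error of replacing the unit sphere by the net \<open>V\<close>.\<close>

definition S :: "(nat \<Rightarrow> nat \<Rightarrow> real) \<Rightarrow> real" where
  "S X = (MAX v\<in>V. \<Sum>i<n. sq v (X i)) + R"

lemma S_pos: "S X > 0"
proof -
  obtain v where v: "v \<in> V" using V by auto
  have "0 \<le> (\<Sum>i<n. sq v (X i))" using sq_bounds[OF V(3)[OF v]] by (intro sum_nonneg) auto
  also have "\<dots> \<le> (MAX v\<in>V. \<Sum>i<n. sq v (X i))" using V v by (intro Max_ge) auto
  finally show ?thesis using R by (simp add: S_def)
qed

text \<open>By homogeneity \<open>w\<close> may be normalized and then moved to the net. Each of the
  \<open>n\<close> points loses at most \<open>R / n\<close>, which the summand \<open>R\<close> in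
  \<open>S\<close> repays.\<close>

lemma sum_squares_le_S: "(\<Sum>i<n. (ip d (clip (X i)) w)\<^sup>2) \<le> S X * ip d w w"
proof (cases "ip d w w = 0")
  case True
  have "(ip d x w)\<^sup>2 = 0" for x using ip_cauchy_schwarz[of d x w] True by simp
  then show ?thesis using True by simp
next
  case False
  define c where "c = enorm2 d w"
  have c: "c > 0" "c\<^sup>2 = ip d w w"
    using False enorm2_square[of d w] enorm2_nonneg[of d w] by (auto simp: c_def less_le)
  define u where "u = (\<lambda>i. w i / c)"
  have ipu: "ip d x u = ip d x w / c" for x by (simp add: ip_def u_def sum_divide_distrib)
  have "ip d u u = 1"
    using c False ipu[of u] ipu[of w] ip_commute[of d u w] by (simp add: power2_eq_square)
  then have u: "enorm2 d u = 1" by (simp add: enorm2_def)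
  obtain v where v: "v \<in> V" and vu: "\<And>x. ip d x x \<le> R \<Longrightarrow> \<bar>(ip d x u)\<^sup>2 - (ip d x v)\<^sup>2\<bar> \<le> R / real n"
    using V_net[OF u] by blast
  have "(\<Sum>i<n. (ip d (clip (X i)) u)\<^sup>2) \<le> (\<Sum>i<n. sq v (X i) + R / real n)"
  proof (rule sum_mono)
    fix i
    show "(ip d (clip (X i)) u)\<^sup>2 \<le> sq v (X i) + R / real n"
      using vu[OF ip_clip_le, of "X i"] unfolding sq_def by linarith
  qed
  also have "\<dots> = (\<Sum>i<n. sq v (X i)) + R" using n by (simp add: sum.distrib)
  also have "\<dots> \<le> S X" unfolding S_def using V v by (intro add_right_mono Max_ge) auto
  finally have "(\<Sum>i<n. (ip d (clip (X i)) w)\<^sup>2) / c\<^sup>2 \<le> S X"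
    by (simp add: ipu power_divide sum_divide_distrib)
  moreover have "c\<^sup>2 > 0" using c(1) by simp
  ultimately show ?thesis unfolding c(2)[symmetric] by (simp only: pos_divide_le_eq)
qed

text \<open>The case of a single copy of the signs, with the one-point type as index set and moment
  order \<open>k\<close>.\<close>

lemma rad_Max_sq_le: "rad {..<n} (\<lambda>e. MAX v\<in>V. \<bar>\<Sum>i<n. e i * sq v (X i)\<bar>) \<le> 4 * sqrt (2 * real k * R * S X)"
proof -
  have "rad {..<n} (\<lambda>e. MAX v\<in>V. \<bar>\<Sum>i<n. e i * sq v (X i)\<bar>)
      = rad ({..<n} \<times> {()}) (\<lambda>e. MAX v\<in>V. \<bar>\<Sum>i<n. e (i, ()) * sq v (X i)\<bar>)"
  proof (rule rad_reindex[symmetric, where g="\<lambda>i. (i, ())"])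
    fix e e' :: "nat \<Rightarrow> real" assume "\<And>i. i \<in> {..<n} \<Longrightarrow> e i = e' i"
    then have "(\<Sum>i<n. e i * sq v (X i)) = (\<Sum>i<n. e' i * sq v (X i))" for v
      by (intro sum.cong) auto
    then show "(MAX v\<in>V. \<bar>\<Sum>i<n. e i * sq v (X i)\<bar>) = (MAX v\<in>V. \<bar>\<Sum>i<n. e' i * sq v (X i)\<bar>)"
      by simp
  qed (auto simp: inj_on_def)
  also have "\<dots> = rad ({..<n} \<times> {()}) (\<lambda>e. MAX \<kappa>\<in>{()}. MAX v\<in>V. \<bar>\<Sum>i<n. e (i, \<kappa>) * (ip d (clip (X i)) v)\<^sup>2\<bar>)"
    by (simp add: sq_def)
  also have "\<dots> \<le> 4 * sqrt (2 * real k * R * S X)"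
  proof (rule rad_Max_quadratic_forms_le)
    have "n \<le> 4 ^ k" using nk power_mono[of 2 "4::nat" k] by linarith
    then show "card {()} * card {..<n} \<le> 4 ^ k" by simp
  qed (use ip_clip_le R S_pos sum_squares_le_S V k in auto)
  finally show ?thesis .
qed

section \<open>Expected deviation over the nets\<close>

definition h :: "(nat \<Rightarrow> real) \<times> (real \<Rightarrow> real) \<Rightarrow> (nat \<Rightarrow> real) \<Rightarrow> real" where
  "h z x = snd z (sq (fst z) x)"

lemma rad_Max_h_le:
  "rad {..<n} (\<lambda>e. MAX z\<in>V \<times> \<Phi>. \<Sum>i<n. e i * h z (X i)) \<le> 1512 * sqrt (2 * real k * R * S X)"
  unfolding h_def sq_def
  by (rule rad_Max_Lipschitz_squares_le[where a=a and L=k])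
    (use ip_clip_le R S_pos sum_squares_le_S V a \<Phi> k nk Ra in auto)

lemma bounded_measurable_h: "z \<in> V \<times> \<Phi> \<Longrightarrow> bounded_measurable \<mu> (h z)"
proof -
  assume z: "z \<in> V \<times> \<Phi>"
  then have f: "snd z \<in> Lip1 a" and v: "enorm2 d (fst z) = 1" using \<Phi> V by auto
  have "snd z \<in> borel_measurable borel"
    using f by (intro Lipschitz_measurable) (auto simp: Lip1_def)
  moreover have "\<bar>snd z (sq (fst z) x)\<bar> \<le> R" for x
    using Lip1_abs_le[OF f _ sq_bounds(1)[OF v]] sq_bounds(2)[OF v] a order_trans by (metis less_imp_le)
  ultimately show ?thesis
    unfolding h_def by (intro bounded_measurableI[where C=R]) auto
qed

abbreviation "P \<equiv> PiM {..<n} (\<lambda>_. \<mu>)"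

lemma prob_space_P: "prob_space P"
  by (intro prob_space_PiM prob_space_axioms)

lemma bounded_measurable_component:
  "bounded_measurable \<mu> f \<Longrightarrow> i < n \<Longrightarrow> bounded_measurable P (\<lambda>X. f (X i))"
  by (rule bounded_measurable_compose[where N=\<mu>]) (auto intro: measurable_component_singleton)

lemma bounded_measurable_S: "bounded_measurable P S"
  unfolding S_def[abs_def]
  by (intro bounded_measurable_intros V bounded_measurable_component bounded_measurable_sq; simp)

text \<open>Linearizes the root of the random \<open>S\<close>, so that only its expectation
  matters. The free weight serves two purposes: a fixed value absorbs \<open>S\<close> into itself,
  a balanced one gives the rate.\<close>

lemma sqrt_le_weighted:
  assumes "x \<ge> 0" "y > 0" "\<beta> > 0"
  shows "sqrt (x * y) \<le> (\<beta> * y + x / \<beta>) / 2"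
proof -
  have "sqrt (x * y) = sqrt ((\<beta> * y) * (x / \<beta>))" using assms by simp
  also have "\<dots> \<le> (\<beta> * y + x / \<beta>) / 2"
    using assms by (intro arith_geo_mean_sqrt) auto
  finally show ?thesis .
qed

text \<open>The factor 2 of symmetrization cancels the 1/2 of the arithmetic-geometric mean.\<close>

lemma expectation_Max_le:
  assumes Z: "finite Z" "Z \<noteq> {}" and g: "\<And>z. z \<in> Z \<Longrightarrow> bounded_measurable \<mu> (g z)"
    and rad: "\<And>X. rad {..<n} (\<lambda>e. MAX z\<in>Z. \<Sum>i<n. e i * g z (X i)) \<le> c * sqrt (2 * real k * R * S X)"
    and c: "c \<ge> 0" and \<beta>: "\<beta> > 0"
  shows "(\<integral>X. (MAX z\<in>Z. \<Sum>i<n. expectation (g z) - g z (X i)) \<partial>P)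
    \<le> c * (\<beta> * (\<integral>X. S X \<partial>P) + 2 * real k * R / \<beta>)"
proof -
  interpret P: prob_space P by (rule prob_space_P)
  have bm: "bounded_measurable P (\<lambda>X. rad {..<n} (\<lambda>e. MAX z\<in>Z. 0 + (\<Sum>i<n. e i * (2 * g z (X i)))))"
    by (intro bounded_measurable_intros Z bounded_measurable_component g; simp)
  have iS: "integrable P S" by (rule P.bounded_measurable_integrable[OF bounded_measurable_S])
  have pt: "rad {..<n} (\<lambda>e. MAX z\<in>Z. 0 + (\<Sum>i<n. e i * (2 * g z (X i)))) \<le> c * (\<beta> * S X + 2 * real k * R / \<beta>)" for X
  proof -
    have Max2: "(MAX z\<in>Z. 2 * f z) = 2 * (MAX z\<in>Z. f z)" for f :: "_ \<Rightarrow> real"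
    proof -
      have "2 * Max (f ` Z) = Max ((*) 2 ` f ` Z)"
        using Z by (intro mono_Max_commute) (auto intro!: monoI)
      then show ?thesis by (simp add: image_image)
    qed
    have "(\<Sum>i<n. e i * (2 * g z (X i))) = 2 * (\<Sum>i<n. e i * g z (X i))" for e z
      by (simp add: sum_distrib_left mult_ac)
    then have "rad {..<n} (\<lambda>e. MAX z\<in>Z. 0 + (\<Sum>i<n. e i * (2 * g z (X i))))
        = 2 * rad {..<n} (\<lambda>e. MAX z\<in>Z. \<Sum>i<n. e i * g z (X i))"
      by (simp add: Max2 rad_cmult)
    also have "\<dots> \<le> 2 * (c * sqrt (2 * real k * R * S X))" using rad by simp
    also have "\<dots> \<le> 2 * (c * ((\<beta> * S X + 2 * real k * R / \<beta>) / 2))"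
      using sqrt_le_weighted[of "2 * real k * R" "S X" \<beta>] R S_pos \<beta> c
      by (intro mult_left_mono) auto
    finally show ?thesis by simp
  qed
  have "(\<integral>X. (MAX z\<in>Z. \<Sum>i<n. expectation (g z) - g z (X i)) \<partial>P)
      \<le> (\<integral>X. rad {..<n} (\<lambda>e. MAX z\<in>Z. 0 + (\<Sum>i<n. e i * (2 * g z (X i)))) \<partial>P)"
    using symmetrization[OF prob_space_axioms Z g, where I="{..<n}" and A="\<lambda>_. 0"] by simp
  also have "\<dots> \<le> (\<integral>X. c * (\<beta> * S X + 2 * real k * R / \<beta>) \<partial>P)"
    using iS by (intro integral_mono P.bounded_measurable_integrable[OF bm] pt) auto
  also have "\<dots> = c * (\<beta> * (\<integral>X. S X \<partial>P) + 2 * real k * R / \<beta>)"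
    using iS by (simp add: P.prob_space)
  finally show ?thesis .
qed

text \<open>With \<open>c = 4\<close> and weight 1/8 the deviation of \<open>S\<close> is at most
  half its own expectation plus \<open>64 * k * R\<close>, and the half is absorbed because the
  expectation is finite. Doubling gives 128, and \<open>2 * R \<le> 2 * k * R\<close> makes it
  130.\<close>

lemma expectation_S_le:
  assumes \<sigma>: "\<And>v. v \<in> V \<Longrightarrow> expectation (sq v) \<le> \<sigma>"
  shows "(\<integral>X. S X \<partial>P) \<le> 2 * real n * \<sigma> + 130 * real k * R"
proof -
  interpret P: prob_space P by (rule prob_space_P)
  define g where "g v x = - sq v x" for v x
  have bg: "bounded_measurable \<mu> (g v)" if "v \<in> V" for v
    using bounded_measurable_cmult[OF bounded_measurable_sq[OF V(3)[OF that]], of "-1"]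
    by (simp add: g_def[abs_def])
  have rad: "rad {..<n} (\<lambda>e. MAX v\<in>V. \<Sum>i<n. e i * g v (X i)) \<le> 4 * sqrt (2 * real k * R * S X)" for X
  proof -
    have "rad {..<n} (\<lambda>e. MAX v\<in>V. \<Sum>i<n. e i * g v (X i))
      \<le> rad {..<n} (\<lambda>e. MAX v\<in>V. \<bar>\<Sum>i<n. e i * sq v (X i)\<bar>)"
    proof (rule rad_mono, rule Max.boundedI)
      fix e y assume "y \<in> (\<lambda>v. \<Sum>i<n. e i * g v (X i)) ` V"
      then obtain v where v: "v \<in> V" "y = - (\<Sum>i<n. e i * sq v (X i))"
        by (auto simp: g_def sum_negf)
      have "\<bar>\<Sum>i<n. e i * sq v (X i)\<bar> \<le> (MAX v\<in>V. \<bar>\<Sum>i<n. e i * sq v (X i)\<bar>)"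
        using V v by (intro Max_ge) auto
      then show "y \<le> (MAX v\<in>V. \<bar>\<Sum>i<n. e i * sq v (X i)\<bar>)" using v by linarith
    qed (use V in auto)
    then show ?thesis using rad_Max_sq_le[of X] by linarith
  qed
  have main: "(\<integral>X. (MAX v\<in>V. \<Sum>i<n. expectation (g v) - g v (X i)) \<partial>P)
      \<le> 4 * (1 / 8 * (\<integral>X. S X \<partial>P) + 2 * real k * R / (1 / 8))"
    by (rule expectation_Max_le[OF V(1,2) bg rad]) auto
  have bm: "bounded_measurable P (\<lambda>X. MAX v\<in>V. \<Sum>i<n. expectation (g v) - g v (X i))"
    by (intro bounded_measurable_intros V bounded_measurable_component bg; simp)
  have "S X \<le> (MAX v\<in>V. \<Sum>i<n. expectation (g v) - g v (X i)) + (real n * \<sigma> + R)" for X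
  proof -
    have "(MAX v\<in>V. \<Sum>i<n. sq v (X i)) \<le> (MAX v\<in>V. \<Sum>i<n. expectation (g v) - g v (X i)) + real n * \<sigma>"
    proof (rule Max.boundedI)
      fix y assume "y \<in> (\<lambda>v. \<Sum>i<n. sq v (X i)) ` V"
      then obtain v where v: "v \<in> V" "y = (\<Sum>i<n. sq v (X i))" by auto
      have "(\<Sum>i<n. expectation (g v) - g v (X i)) \<le> (MAX v\<in>V. \<Sum>i<n. expectation (g v) - g v (X i))"
        using V v by (intro Max_ge) auto
      moreover have "(\<Sum>i<n. expectation (g v) - g v (X i)) = y - real n * expectation (sq v)"
        by (simp add: g_def[abs_def] v(2) sum.distrib sum_subtractf)
      moreover have "real n * expectation (sq v) \<le> real n * \<sigma>"
        using \<sigma>[OF v(1)] by (intro mult_left_mono) auto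
      ultimately show "y \<le> (MAX v\<in>V. \<Sum>i<n. expectation (g v) - g v (X i)) + real n * \<sigma>" by linarith
    qed (use V in auto)
    then show ?thesis by (simp add: S_def)
  qed
  then have "(\<integral>X. S X \<partial>P) \<le> (\<integral>X. (MAX v\<in>V. \<Sum>i<n. expectation (g v) - g v (X i)) + (real n * \<sigma> + R) \<partial>P)"
    using P.bounded_measurable_integrable[OF bounded_measurable_S] P.bounded_measurable_integrable[OF bm]
    by (intro integral_mono) auto
  also have "\<dots> = (\<integral>X. (MAX v\<in>V. \<Sum>i<n. expectation (g v) - g v (X i)) \<partial>P) + (real n * \<sigma> + R)"
    using P.bounded_measurable_integrable[OF bm] by (simp add: P.prob_space)
  finally have "(\<integral>X. S X \<partial>P) \<le> 2 * real n * \<sigma> + 2 * R + 128 * (real k * R)"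
    using main by argo
  moreover have "R \<le> real k * R" using k R by simp
  ultimately show ?thesis by linarith
qed

definition D :: "(nat \<Rightarrow> nat \<Rightarrow> real) \<Rightarrow> real" where
  "D X = (MAX z\<in>V \<times> \<Phi>. \<Sum>i<n. expectation (h z) - h z (X i))"

lemma bounded_measurable_D: "bounded_measurable P D"
  unfolding D_def[abs_def]
  by (intro bounded_measurable_intros bounded_measurable_component bounded_measurable_h finite_cartesian_product V \<Phi>)
    (use V \<Phi> in auto)

lemma expectation_D_le:
  assumes \<sigma>: "\<And>v. v \<in> V \<Longrightarrow> expectation (sq v) \<le> \<sigma>" "\<sigma> \<ge> 0"
  shows "(\<integral>X. D X \<partial>P) \<le> 3024 * sqrt (2 * real k * R * (2 * real n * \<sigma> + 130 * real k * R))"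
proof -
  define A where "A = 2 * real k * R"
  define B where "B = 2 * real n * \<sigma> + 130 * real k * R"
  have AB: "A > 0" "B > 0" using R k \<sigma> by (auto simp: A_def B_def intro: add_nonneg_pos)
  \<comment> \<open>This weight balances the two terms: both become \<open>sqrt (A * B)\<close>,
    whence \<open>3024 = 2 * 1512\<close>.\<close>
  define \<beta> where "\<beta> = sqrt (A / B)"
  have \<beta>: "\<beta> > 0" using AB by (simp add: \<beta>_def)
  have "(\<integral>X. D X \<partial>P) \<le> 1512 * (\<beta> * (\<integral>X. S X \<partial>P) + 2 * real k * R / \<beta>)"
    unfolding D_def using V \<Phi> \<beta>
    by (intro expectation_Max_le bounded_measurable_h rad_Max_h_le) auto
  also have "\<dots> \<le> 1512 * (\<beta> * B + A / \<beta>)"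
    using expectation_S_le[OF \<sigma>(1)] \<beta> by (intro mult_left_mono add_mono) (auto simp: A_def B_def)
  also have "\<beta> * B = sqrt (A * B)"
    using AB by (simp add: \<beta>_def real_sqrt_divide real_sqrt_mult real_div_sqrt field_simps)
  also have "A / \<beta> = sqrt (A * B)"
    using AB by (simp add: \<beta>_def real_sqrt_divide real_sqrt_mult real_div_sqrt field_simps)
  finally show ?thesis by (simp add: A_def B_def)
qed

text \<open>Replacing \<open>f\<close> by a net function costs \<open>4 * a\<close>, replacing
  \<open>v\<close> by a net direction costs \<open>R / n\<close>, together at most
  \<open>\<delta>\<close>. This is paid once under the expectation and once in the sample mean, and
  doubled by \<open>W2_proj_le\<close>, so \<open>4 * \<delta> = 20 * R / n\<close>.\<close>

lemma W21_square_le: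
  assumes X: "\<And>i. i < n \<Longrightarrow> enorm2 d (X i) \<le> r"
  shows "(W21 d \<mu> (emp d X n))\<^sup>2 \<le> 2 * D X / real n + 20 * R / real n"
proof -
  define \<delta> where "\<delta> = 5 * R / real n"
  have W2: "(W2 (proj d v \<mu>) (proj d v (emp d X n)))\<^sup>2 \<le> 2 * D X / real n + 20 * R / real n"
    if v: "enorm2 d v = 1" for v
  proof -
    obtain f :: "real \<Rightarrow> real" where lip: "\<And>x y. \<bar>f x - f y\<bar> \<le> \<bar>x - y\<bar>" and f0: "f 0 = 0"
      and W: "(W2 (proj d v \<mu>) (proj d v (emp d X n)))\<^sup>2
        \<le> 2 * (expectation (\<lambda>x. f ((ip d x v)\<^sup>2)) - (\<Sum>i<n. f ((ip d (X i) v)\<^sup>2)) / real n)"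
      using W2_proj_le[where X=X, OF sets_\<mu> prob_space_axioms symmetric norm_le n X v] by blast
    obtain w where w: "w \<in> V" and vw: "\<And>x. ip d x x \<le> R \<Longrightarrow> \<bar>(ip d x v)\<^sup>2 - (ip d x w)\<^sup>2\<bar> \<le> R / real n"
      using V_net[OF v] by blast
    obtain g where g: "g \<in> \<Phi>" and fg: "\<And>y. 0 \<le> y \<Longrightarrow> y \<le> R \<Longrightarrow> \<bar>f y - g y\<bar> \<le> 4 * a"
      using \<Phi>_net[OF lip f0] unfolding Ra by blast
    have close: "\<bar>f ((ip d x v)\<^sup>2) - h (w, g) x\<bar> \<le> \<delta>" if x: "enorm2 d x \<le> r" for x
    proof -
      have "\<bar>f (sq v x) - g (sq v x)\<bar> \<le> 4 * a" using sq_bounds[OF v] by (intro fg)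
      moreover have "\<bar>g (sq v x) - g (sq w x)\<bar> \<le> \<bar>sq v x - sq w x\<bar>"
        using g \<Phi> by (auto simp: Lip1_def)
      moreover have "\<bar>sq v x - sq w x\<bar> \<le> R / real n"
        unfolding sq_def by (rule vw[OF ip_clip_le])
      ultimately show ?thesis
        using a_le x by (simp add: h_def \<delta>_def sq_def clip_eq)
    qed
    have "f \<in> borel_measurable borel" by (rule Lipschitz_measurable[OF lip])
    moreover have "(\<lambda>x. ip d x v) \<in> borel_measurable \<mu>"
      using ip_measurable measurable_cong_sets[OF sets_\<mu> refl] by blast
    ultimately have fm: "(\<lambda>x. f ((ip d x v)\<^sup>2)) \<in> borel_measurable \<mu>" by measurable
    have ih: "integrable \<mu> (h (w, g))"
      using w g by (intro bounded_measurable_integrable bounded_measurable_h) auto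
    have "AE x in \<mu>. f ((ip d x v)\<^sup>2) \<le> h (w, g) x + \<delta>"
      using norm_le close by (auto simp: abs_le_iff algebra_simps)
    moreover have "integrable \<mu> (\<lambda>x. f ((ip d x v)\<^sup>2))"
    proof (rule Bochner_Integration.integrable_bound[OF _ fm])
      show "integrable \<mu> (\<lambda>x. \<bar>h (w, g) x\<bar> + \<delta>)" using ih by auto
      have "\<bar>f ((ip d x v)\<^sup>2)\<bar> \<le> \<bar>\<bar>h (w, g) x\<bar> + \<delta>\<bar>" if "enorm2 d x \<le> r" for x
        using close[OF that] by linarith
      then show "AE x in \<mu>. norm (f ((ip d x v)\<^sup>2)) \<le> norm (\<bar>h (w, g) x\<bar> + \<delta>)"
        using norm_le by auto
    qed
    ultimately have "expectation (\<lambda>x. f ((ip d x v)\<^sup>2)) \<le> expectation (\<lambda>x. h (w, g) x + \<delta>)"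
      using ih by (intro integral_mono_AE) auto
    then have 1: "expectation (\<lambda>x. f ((ip d x v)\<^sup>2)) \<le> expectation (h (w, g)) + \<delta>"
      using ih by (simp add: prob_space)
    have "(\<Sum>i<n. h (w, g) (X i) - \<delta>) \<le> (\<Sum>i<n. f ((ip d (X i) v)\<^sup>2))"
      using close[OF X] by (intro sum_mono) (force simp: abs_le_iff)
    then have "(\<Sum>i<n. h (w, g) (X i) - \<delta>) / real n \<le> (\<Sum>i<n. f ((ip d (X i) v)\<^sup>2)) / real n"
      by (rule divide_right_mono) simp
    then have 2: "(\<Sum>i<n. h (w, g) (X i)) / real n - \<delta> \<le> (\<Sum>i<n. f ((ip d (X i) v)\<^sup>2)) / real n"
      using n by (simp add: sum_subtractf diff_divide_distrib)
    have "(\<Sum>i<n. expectation (h (w, g)) - h (w, g) (X i)) \<le> D X"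
      unfolding D_def using w g V \<Phi> by (intro Max_ge) auto
    then have "(\<Sum>i<n. expectation (h (w, g)) - h (w, g) (X i)) / real n \<le> D X / real n"
      by (rule divide_right_mono) simp
    then have "expectation (h (w, g)) - (\<Sum>i<n. h (w, g) (X i)) / real n \<le> D X / real n"
      using n by (simp add: sum_subtractf diff_divide_distrib)
    with W 1 2 have "(W2 (proj d v \<mu>) (proj d v (emp d X n)))\<^sup>2 \<le> 2 * (D X / real n + 2 * \<delta>)"
      by argo
    then show ?thesis by (simp add: \<delta>_def)
  qed
  define B where "B = 2 * D X / real n + 20 * R / real n"
  obtain v0 where v0: "enorm2 d v0 = 1" using V by auto
  have B0: "B \<ge> 0" using W2[OF v0] zero_le_power2 order_trans unfolding B_def by blast
  have nn: "W2 N1 N2 \<ge> 0" for N1 N2 by (simp add: W2_def)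
  have le: "W2 (proj d v \<mu>) (proj d v (emp d X n)) \<le> sqrt B" if "enorm2 d v = 1" for v
    using W2[OF that] by (simp add: real_le_rsqrt B_def)
  have "W21 d \<mu> (emp d X n) \<le> sqrt B"
    unfolding W21_def using v0 le by (intro cSup_least) auto
  \<comment> \<open>Squaring the bound requires a nonnegative supremum, hence one of a nonempty set
    that is bounded above.\<close>
  moreover have "0 \<le> W21 d \<mu> (emp d X n)"
  proof -
    have "W2 (proj d v0 \<mu>) (proj d v0 (emp d X n)) \<le> W21 d \<mu> (emp d X n)"
      unfolding W21_def using v0 le by (intro cSup_upper bdd_aboveI[of _ "sqrt B"]) auto
    then show ?thesis using nn order_trans by blast
  qed
  ultimately have "(W21 d \<mu> (emp d X n))\<^sup>2 \<le> (sqrt B)\<^sup>2" by (rule power_mono)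
  then show ?thesis using B0 by (simp add: B_def)
qed

lemma nn_integral_W21_le:
  assumes \<sigma>: "\<And>v. v \<in> V \<Longrightarrow> expectation (sq v) \<le> \<sigma>" "\<sigma> \<ge> 0"
  shows "(\<integral>\<^sup>+ X. ennreal ((W21 d \<mu> (emp d X n))\<^sup>2) \<partial>P)
    \<le> ennreal (6048 * sqrt (2 * real k * R * (2 * real n * \<sigma> + 130 * real k * R)) / real n + 20 * R / real n)"
proof -
  interpret P: prob_space P by (rule prob_space_P)
  have iD: "integrable P D" by (rule P.bounded_measurable_integrable[OF bounded_measurable_D])
  have ae: "AE X in P. (W21 d \<mu> (emp d X n))\<^sup>2 \<le> 2 * D X / real n + 20 * R / real n"
    using AE_norm_le by (rule eventually_mono) (auto intro: W21_square_le)
  then have nonneg: "AE X in P. 0 \<le> 2 * D X / real n + 20 * R / real n"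
    by (rule eventually_mono) (meson order_trans zero_le_power2)
  have "(\<integral>\<^sup>+ X. ennreal ((W21 d \<mu> (emp d X n))\<^sup>2) \<partial>P)
      \<le> (\<integral>\<^sup>+ X. ennreal (2 * D X / real n + 20 * R / real n) \<partial>P)"
    by (rule nn_integral_mono_AE, rule eventually_mono[OF ae]) (rule ennreal_leI)
  also have "\<dots> = ennreal (\<integral>X. 2 * D X / real n + 20 * R / real n \<partial>P)"
    using iD nonneg by (intro nn_integral_eq_integral) auto
  also have "(\<integral>X. 2 * D X / real n + 20 * R / real n \<partial>P) = 2 * (\<integral>X. D X \<partial>P) / real n + 20 * R / real n"
    using iD by (simp add: P.prob_space)
  also have "\<dots> \<le> 2 * (3024 * sqrt (2 * real k * R * (2 * real n * \<sigma> + 130 * real k * R))) / real n + 20 * R / real n"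
    using expectation_D_le[OF \<sigma>] by (intro add_right_mono divide_right_mono) auto
  finally show ?thesis by (simp add: ennreal_leI)
qed

end

section \<open>Existence of the nets, degenerate covariance and constants\<close>

lemma (in symmetric_sample) nets_exist:
  obtains V \<Phi> where "symmetric_sample_net \<mu> d r n k R a V \<Phi>"
proof -
  \<comment> \<open>\<open>ip_square_diff_le\<close> turns the radius \<epsilon> into an error
    \<open>2 * R * \<epsilon>\<close>, so \<open>1 / (2 * n)\<close> gives exactly
    \<open>R / n\<close>.\<close>
  obtain V where V: "finite V" "V \<noteq> {}" "\<And>v. v \<in> V \<Longrightarrow> enorm2 d v = 1"
    and net: "\<And>v. enorm2 d v = 1 \<Longrightarrow> \<exists>w\<in>V. enorm2 d (\<lambda>i. v i - w i) \<le> 1 / (2 * real n)"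
    using unit_sphere_net[OF d, of "1 / (2 * real n)"] n by auto
  obtain \<Phi> where \<Phi>: "finite \<Phi>" "\<Phi> \<noteq> {}" "\<Phi> \<subseteq> Lip1 a" "inj_on (quant a k k) \<Phi>"
    and net\<Phi>: "\<forall>f :: real \<Rightarrow> real. (\<forall>x y. \<bar>f x - f y\<bar> \<le> \<bar>x - y\<bar>) \<and> f 0 = 0 \<longrightarrow>
      (\<exists>g\<in>\<Phi>. \<forall>y. 0 \<le> y \<longrightarrow> y \<le> 2 ^ k * a \<longrightarrow> \<bar>f y - g y\<bar> \<le> 4 * a)"
    by (rule Lip1_net[OF a, where k=k])
  have \<Phi>': "\<exists>g\<in>\<Phi>. \<forall>y. 0 \<le> y \<longrightarrow> y \<le> 2 ^ k * a \<longrightarrow> \<bar>f y - g y\<bar> \<le> 4 * a"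
    if "\<And>x y. \<bar>f x - f y\<bar> \<le> \<bar>x - y\<bar>" "f 0 = 0" for f :: "real \<Rightarrow> real"
    using net\<Phi> that by simp
  have V': "\<exists>w\<in>V. \<forall>x. ip d x x \<le> R \<longrightarrow> \<bar>(ip d x v)\<^sup>2 - (ip d x w)\<^sup>2\<bar> \<le> R / real n" if v: "enorm2 d v = 1" for v
  proof -
    obtain w where w: "w \<in> V" "enorm2 d (\<lambda>i. v i - w i) \<le> 1 / (2 * real n)" using net[OF v] by blast
    have "\<bar>(ip d x v)\<^sup>2 - (ip d x w)\<^sup>2\<bar> \<le> R / real n" if "ip d x x \<le> R" for x
      using ip_square_diff_le[OF v V(3)[OF w(1)] that w(2)] by simp
    then show ?thesis using w(1) by blast
  qed
  have "symmetric_sample_net \<mu> d r n k R a V \<Phi>"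
    by unfold_locales (fact V V' \<Phi> \<Phi>')+
  then show ?thesis by (rule that)
qed

text \<open>Minimality gives \<open>2 ^ (k - 1) < n\<close>, so \<open>k * ln 2\<close> is at most
  \<open>ln n + ln 2\<close>, hence at most \<open>2 * ln n\<close> for \<open>n \<ge> 2\<close>;
  then \<open>ln 2 \<ge> 2/3\<close>.\<close>

lemma dyadic_exponent:
  assumes "n \<ge> 2"
  obtains k :: nat where "k \<ge> 1" "n \<le> 2 ^ k" "real k \<le> 3 * ln (real n)"
proof -
  define k where "k = (LEAST k. n \<le> 2 ^ k)"
  have "n \<le> 2 ^ n" by (rule less_imp_le[OF less_exp])
  then have k: "n \<le> 2 ^ k" unfolding k_def by (rule LeastI)
  have k1: "k \<ge> 1" using k assms by (cases k) auto
  then obtain j where j: "k = Suc j" by (cases k) auto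
  have "2 ^ j < n"
    using not_less_Least[of j "\<lambda>k. n \<le> 2 ^ k"] j by (simp add: k_def)
  then have "real (2 ^ j) \<le> real n" by (intro of_nat_mono) simp
  then have "(2::real) ^ j \<le> real n" by simp
  then have "real j * ln 2 \<le> ln (real n)"
    using ln_mono[of "2 ^ j" "real n"] assms by (simp add: ln_realpow)
  moreover have "ln 2 \<le> ln (real n)" using assms by simp
  moreover have "real k * ln 2 = real j * ln 2 + ln 2" by (simp add: j algebra_simps)
  ultimately have "real k * ln 2 \<le> 2 * ln (real n)" by linarith
  moreover have "real k * (2 / 3) \<le> real k * ln 2"
    using ln2_ge_two_thirds by (intro mult_left_mono) auto
  ultimately have "real k \<le> 3 * ln (real n)" by linarith
  then show ?thesis using that k1 k by blast
qed

text \<open>All projections vanish, so the difference of test integrals in \<open>W2_proj_le\<close>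
  reduces to two copies of \<open>f 0 = 0\<close>.\<close>

lemma (in symmetric_sample) W21_eq_0:
  assumes X: "\<And>i. i < n \<Longrightarrow> ip d (X i) (X i) = 0" and \<mu>0: "AE x in \<mu>. ip d x x = 0"
  shows "W21 d \<mu> (emp d X n) = 0"
proof -
  have ip0: "ip d x v = 0" if "ip d x x = 0" for x v
    using ip_cauchy_schwarz[of d x v] that by simp
  have "W2 (proj d v \<mu>) (proj d v (emp d X n)) = 0" if v: "enorm2 d v = 1" for v
  proof -
    have Xr: "enorm2 d (X i) \<le> r" if "i < n" for i
      using X[OF that] r by (simp add: enorm2_def)
    obtain f :: "real \<Rightarrow> real" where lip: "\<And>x y. \<bar>f x - f y\<bar> \<le> \<bar>x - y\<bar>" and f0: "f 0 = 0"
      and W: "(W2 (proj d v \<mu>) (proj d v (emp d X n)))\<^sup>2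
        \<le> 2 * (expectation (\<lambda>x. f ((ip d x v)\<^sup>2)) - (\<Sum>i<n. f ((ip d (X i) v)\<^sup>2)) / real n)"
      using W2_proj_le[where X=X, OF sets_\<mu> prob_space_axioms symmetric norm_le n Xr v] by blast
    have "f \<in> borel_measurable borel" by (rule Lipschitz_measurable[OF lip])
    moreover have "(\<lambda>x. ip d x v) \<in> borel_measurable \<mu>"
      using ip_measurable measurable_cong_sets[OF sets_\<mu> refl] by blast
    ultimately have "(\<lambda>x. f ((ip d x v)\<^sup>2)) \<in> borel_measurable \<mu>" by measurable
    then have "expectation (\<lambda>x. f ((ip d x v)\<^sup>2)) = expectation (\<lambda>x. 0)"
      using \<mu>0 ip0 f0 by (intro integral_cong_AE) auto
    moreover have "(\<Sum>i<n. f ((ip d (X i) v)\<^sup>2)) = 0"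
      using ip0[OF X] f0 by simp
    ultimately show ?thesis using W by simp
  qed
  moreover have "enorm2 d (unit_vec 0) = 1" using d by (simp add: enorm2_unit_vec)
  ultimately have "{W2 (proj d v \<mu>) (proj d v (emp d X n)) | v. enorm2 d v = 1} = {0}"
    by (auto intro: exI[of _ "unit_vec 0"])
  then show ?thesis by (simp add: W21_def)
qed

lemma (in symmetric_sample) opnorm_nonneg: "opnorm d (cov d \<mu>) \<ge> 0"
proof -
  have "enorm2 d (unit_vec 0) = 1" using d by (simp add: enorm2_unit_vec)
  then have "expectation (sq (unit_vec 0)) \<le> opnorm d (cov d \<mu>)" by (rule expectation_sq_le)
  moreover have "0 \<le> expectation (sq (unit_vec 0))"
    by (intro integral_nonneg_AE) (simp add: sq_def)
  ultimately show ?thesis by linarith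
qed

lemma (in symmetric_sample) AE_eq_0:
  assumes "opnorm d (cov d \<mu>) = 0"
  shows "AE x in \<mu>. ip d x x = 0"
proof -
  have "AE x in \<mu>. x j = 0" if j: "j < d" for j
  proof -
    have u: "enorm2 d (unit_vec j) = 1" using j by (rule enorm2_unit_vec)
    have "expectation (sq (unit_vec j)) = 0"
      using expectation_sq_le[OF u] assms by (intro antisym integral_nonneg_AE) (auto simp: sq_def)
    moreover have "integrable \<mu> (sq (unit_vec j))"
      by (rule bounded_measurable_integrable[OF bounded_measurable_sq[OF u]])
    ultimately have "AE x in \<mu>. sq (unit_vec j) x = 0"
      by (subst (asm) integral_nonneg_eq_0_iff_AE) (auto simp: sq_def)
    then show ?thesis
      using norm_le by eventually_elim (simp add: sq_def clip_eq ip_unit_vec j)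
  qed
  then have "AE x in \<mu>. \<forall>j\<in>{..<d}. x j = 0" by (intro AE_finite_allI) auto
  then show ?thesis by (rule eventually_mono) (simp add: ip_def)
qed

text \<open>With \<open>t = R * l / n\<close> the radicand is at most
  \<open>n * n * (12 * t * \<sigma> + 2340 * t * t)\<close>, and the target is a multiple of
  \<open>t + sqrt (t * \<sigma>)\<close>. The constant 400000 rounds up
  \<open>6048 * 49 + 60\<close>, the larger of the two coefficients.\<close>

lemma W21_rate_le:
  fixes \<sigma> R t k n :: real
  assumes \<sigma>: "\<sigma> > 0" and R: "R > 0" and n: "n > 0" and l: "k \<le> 3 * l" "k \<ge> 1"
  shows "6048 * sqrt (2 * k * R * (2 * n * \<sigma> + 130 * k * R)) / n + 20 * R / n
    \<le> 400000 * \<sigma> * (R * l / (n * \<sigma>) + sqrt (R * l / (n * \<sigma>)))"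
proof -
  define t where "t = R * l / n"
  have l0: "l > 0" using l by linarith
  have t: "t > 0" using R l0 n by (simp add: t_def)
  have kR: "k * R \<le> 3 * (n * t)"
    using mult_right_mono[OF l(1), of R] R n by (simp add: t_def mult_ac)
  have "2 * k * R * (2 * n * \<sigma> + 130 * k * R) = 2 * (k * R) * (2 * n * \<sigma> + 130 * (k * R))"
    by simp
  also have "\<dots> \<le> 2 * (3 * (n * t)) * (2 * n * \<sigma> + 130 * (3 * (n * t)))"
  proof -
    define x where "x = k * R"
    define y where "y = 3 * (n * t)"
    have xy: "0 \<le> x" "x \<le> y" using kR l R by (auto simp: x_def y_def)
    then have "2 * x * (2 * n * \<sigma> + 130 * x) \<le> 2 * y * (2 * n * \<sigma> + 130 * y)"
      using n \<sigma> by (intro mult_mono add_nonneg_nonneg) auto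
    then show ?thesis by (simp only: x_def y_def)
  qed
  also have "\<dots> = n\<^sup>2 * (12 * (t * \<sigma>) + 2340 * t\<^sup>2)"
    by (simp add: power2_eq_square algebra_simps)
  finally have "sqrt (2 * k * R * (2 * n * \<sigma> + 130 * k * R)) \<le> sqrt (n\<^sup>2 * (12 * (t * \<sigma>) + 2340 * t\<^sup>2))"
    by (rule real_sqrt_le_mono)
  also have "\<dots> = n * sqrt (12 * (t * \<sigma>) + 2340 * t\<^sup>2)"
    using n by (simp add: real_sqrt_mult)
  also have "\<dots> \<le> n * (sqrt (12 * (t * \<sigma>)) + sqrt (2340 * t\<^sup>2))"
    using n t \<sigma> by (intro mult_left_mono sqrt_add_le_add_sqrt) auto
  also have "\<dots> \<le> n * (4 * sqrt (t * \<sigma>) + 49 * t)"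
  proof (intro mult_left_mono add_mono)
    have "sqrt 12 \<le> 4" "sqrt 2340 \<le> 49" by (simp_all add: real_le_lsqrt)
    then show "sqrt (12 * (t * \<sigma>)) \<le> 4 * sqrt (t * \<sigma>)" "sqrt (2340 * t\<^sup>2) \<le> 49 * t"
      using t \<sigma> by (auto simp: real_sqrt_mult intro!: mult_right_mono)
  qed (use n in auto)
  finally have "6048 * sqrt (2 * k * R * (2 * n * \<sigma> + 130 * k * R)) / n \<le> 6048 * (n * (4 * sqrt (t * \<sigma>) + 49 * t)) / n"
    using n by (intro divide_right_mono mult_left_mono) auto
  also have "\<dots> = 24192 * sqrt (t * \<sigma>) + 296352 * t" using n by simp
  finally have 1: "6048 * sqrt (2 * k * R * (2 * n * \<sigma> + 130 * k * R)) / n \<le> 24192 * sqrt (t * \<sigma>) + 296352 * t" .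
  have "1 * R \<le> k * R" using l R by (intro mult_right_mono) auto
  then have "R / n \<le> 3 * t" using kR n by (simp add: pos_divide_le_eq mult_ac)
  then have 2: "20 * R / n \<le> 60 * t" by simp
  have "R * l / (n * \<sigma>) = t / \<sigma>" by (simp add: t_def)
  moreover have "\<sigma> * sqrt (t / \<sigma>) = sqrt (t * \<sigma>)"
  proof -
    have "\<sigma> * sqrt (t / \<sigma>) = sqrt (\<sigma>\<^sup>2 * (t / \<sigma>))"
      using \<sigma> by (simp add: real_sqrt_mult del: times_divide_eq_right)
    also have "\<sigma>\<^sup>2 * (t / \<sigma>) = t * \<sigma>" using \<sigma> by (simp add: power2_eq_square)
    finally show ?thesis .
  qed
  ultimately have eq: "400000 * \<sigma> * (R * l / (n * \<sigma>) + sqrt (R * l / (n * \<sigma>))) = 400000 * t + 400000 * sqrt (t * \<sigma>)"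
    using \<sigma> by (simp add: distrib_left)
  have "0 \<le> sqrt (t * \<sigma>)" using t \<sigma> by simp
  then show ?thesis unfolding eq using 1 2 t by linarith
qed

theorem theorem1p7:
  shows "\<exists>C::real\<ge>1. \<forall>(d::nat) (r::real) (\<mu>::(nat \<Rightarrow> real) measure) (n::nat).
    d \<ge> 1 \<and> r > 0 \<and> sets \<mu> = sets (Rd d) \<and> prob_space \<mu> \<and> symmetric_measure d \<mu>
    \<and> (AE x in \<mu>. enorm2 d x \<le> r) \<and> n \<ge> 2 \<longrightarrow>
    (\<integral>\<^sup>+ X. ennreal ((W21 d \<mu> (emp d X n))\<^sup>2) \<partial>(PiM {..<n} (\<lambda>_. \<mu>)))
      \<le> ennreal (C * opnorm d (cov d \<mu>) *
          (r\<^sup>2 * ln (real n) / (real n * opnorm d (cov d \<mu>))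
           + sqrt (r\<^sup>2 * ln (real n) / (real n * opnorm d (cov d \<mu>)))))"
proof (rule exI[of _ 400000], intro conjI allI impI)
  fix d :: nat and r :: real and \<mu> :: "(nat \<Rightarrow> real) measure" and n :: nat
  assume A: "d \<ge> 1 \<and> r > 0 \<and> sets \<mu> = sets (Rd d) \<and> prob_space \<mu> \<and> symmetric_measure d \<mu>
    \<and> (AE x in \<mu>. enorm2 d x \<le> r) \<and> n \<ge> 2"
  then obtain k where exponent: "k \<ge> 1" "n \<le> 2 ^ k" "real k \<le> 3 * ln (real n)"
    using dyadic_exponent[of n] by blast
  interpret prob_space \<mu> using A by simp
  interpret symmetric_sample \<mu> d r n k "r\<^sup>2" "r\<^sup>2 / 2 ^ k"
    using A exponent by unfold_locales auto
  define \<sigma> where "\<sigma> = opnorm d (cov d \<mu>)"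
  have "(\<integral>\<^sup>+ X. ennreal ((W21 d \<mu> (emp d X n))\<^sup>2) \<partial>(PiM {..<n} (\<lambda>_. \<mu>)))
      \<le> ennreal (400000 * \<sigma> * (r\<^sup>2 * ln (real n) / (real n * \<sigma>) + sqrt (r\<^sup>2 * ln (real n) / (real n * \<sigma>))))"
  \<comment> \<open>At \<sigma> = 0 the prefactor makes the right side 0 whatever the quotients by 0
    are, so the distance must vanish almost surely; the rate estimate divides by \<sigma>.\<close>
  proof (cases "\<sigma> = 0")
    case True
    then have ae: "AE x in \<mu>. ip d x x = 0" by (intro AE_eq_0) (simp add: \<sigma>_def)
    have "AE X in PiM {..<n} (\<lambda>_. \<mu>). ip d (X i) (X i) = 0" if "i \<in> {..<n}" for i
      using that ae by (intro AE_PiM_component prob_space_axioms)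
    then have "AE X in PiM {..<n} (\<lambda>_. \<mu>). \<forall>i\<in>{..<n}. ip d (X i) (X i) = 0"
      by (intro AE_finite_allI) auto
    then have "AE X in PiM {..<n} (\<lambda>_. \<mu>). ennreal ((W21 d \<mu> (emp d X n))\<^sup>2) = 0"
      by (rule eventually_mono) (simp add: W21_eq_0[OF _ ae])
    then have "(\<integral>\<^sup>+ X. ennreal ((W21 d \<mu> (emp d X n))\<^sup>2) \<partial>(PiM {..<n} (\<lambda>_. \<mu>))) = (\<integral>\<^sup>+ X. 0 \<partial>(PiM {..<n} (\<lambda>_. \<mu>)))"
      by (rule nn_integral_cong_AE)
    then show ?thesis by simp
  next
    case False
    then have \<sigma>: "\<sigma> > 0" using opnorm_nonneg by (simp add: \<sigma>_def)
    obtain V \<Phi> where "symmetric_sample_net \<mu> d r n k (r\<^sup>2) (r\<^sup>2 / 2 ^ k) V \<Phi>"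
      by (rule nets_exist)
    then interpret net: symmetric_sample_net \<mu> d r n k "r\<^sup>2" "r\<^sup>2 / 2 ^ k" V \<Phi> .
    have "(\<integral>\<^sup>+ X. ennreal ((W21 d \<mu> (emp d X n))\<^sup>2) \<partial>(PiM {..<n} (\<lambda>_. \<mu>)))
        \<le> ennreal (6048 * sqrt (2 * real k * r\<^sup>2 * (2 * real n * \<sigma> + 130 * real k * r\<^sup>2)) / real n + 20 * r\<^sup>2 / real n)"
      using net.V(3) \<sigma> by (intro net.nn_integral_W21_le) (auto simp: \<sigma>_def intro: expectation_sq_le)
    also have "\<dots> \<le> ennreal (400000 * \<sigma> * (r\<^sup>2 * ln (real n) / (real n * \<sigma>) + sqrt (r\<^sup>2 * ln (real n) / (real n * \<sigma>))))"
      using \<sigma> R A exponent by (intro ennreal_leI W21_rate_le) auto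
    finally show ?thesis .
  qed
  then show "(\<integral>\<^sup>+ X. ennreal ((W21 d \<mu> (emp d X n))\<^sup>2) \<partial>(PiM {..<n} (\<lambda>_. \<mu>)))
      \<le> ennreal (400000 * opnorm d (cov d \<mu>) *
          (r\<^sup>2 * ln (real n) / (real n * opnorm d (cov d \<mu>))
           + sqrt (r\<^sup>2 * ln (real n) / (real n * opnorm d (cov d \<mu>)))))"
    by (simp only: \<sigma>_def)
qed simp

end
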